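(* Let $f_1,f_2\colon(0,\infty)\to(0,\infty)$ be operator monotone decreasing functions. Let $A_1$, $A_2$, $B$ be unital C$^*$-algebras, $\tau$ a tracial positive linear functional on $B$, and $\Phi\colon A_1\to B$, $\Psi\colon A_2\to B$ positive linear maps. Then the map $$A_1^{++}\times A_2^{++}\to\mathbb{R},\qquad (X,Y)\mapsto \tau\Bigl(\Phi(f_1(X))^{1/2}\,\Psi(f_2(Y))\,\Phi(f_1(X))^{1/2}\Bigr)$$ is jointly convex.
   Context: For a unital C$^*$-algebra $A$, $A^{++}$ denotes the set of invertible positive elements. A positive linear functional $\tau$ on $B$ is tracial if $\tau(ab)=\tau(ba)$ for all $a,b\in B$. Operator monotone decreasing: $X\le Y\Rightarrow f(X)\ge f(Y)$ for all self-adjoint $X,Y$ (in any unital C$^*$-algebra) with spectra in $(0,\infty)$, using continuous functional calculus. *)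

theory Defs
  imports "HOL-Analysis.Analysis" "HOL-Computational_Algebra.Polynomial"
    "Jordan_Normal_Form.Schur_Decomposition"
begin

class cstar_algebra = real_normed_algebra_1 + banach +
  fixes cscale :: "complex \<Rightarrow> 'a \<Rightarrow> 'a"
    and cstar :: "'a \<Rightarrow> 'a"
  assumes cscale_of_real: "cscale (complex_of_real r) x = r *\<^sub>R x"
    and cscale_add_left: "cscale (a + b) x = cscale a x + cscale b x"
    and cscale_add_right: "cscale a (x + y) = cscale a x + cscale a y"
    and cscale_cscale: "cscale a (cscale b x) = cscale (a * b) x"
    and cscale_mult_left: "cscale a x * y = cscale a (x * y)"
    and cscale_mult_right: "x * cscale a y = cscale a (x * y)"
    and norm_cscale: "norm (cscale a x) = cmod a * norm x"
    and cstar_cstar: "cstar (cstar x) = x"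
    and cstar_add: "cstar (x + y) = cstar x + cstar y"
    and cstar_mult: "cstar (x * y) = cstar y * cstar x"
    and cstar_cscale: "cstar (cscale a x) = cscale (cnj a) (cstar x)"
    and cstar_identity: "norm (cstar x * x) = (norm x)\<^sup>2"

definition cinvertible :: "'a::cstar_algebra \<Rightarrow> bool" where
  "cinvertible x \<longleftrightarrow> (\<exists>y. x * y = 1 \<and> y * x = 1)"

text \<open>Real part of the spectrum (equal to the whole spectrum for self-adjoint elements).\<close>
definition real_spectrum :: "'a::cstar_algebra \<Rightarrow> real set" where
  "real_spectrum x = {t. \<not> cinvertible (x - of_real t)}"

definition self_adjoint :: "'a::cstar_algebra \<Rightarrow> bool" where
  "self_adjoint x \<longleftrightarrow> cstar x = x"

definition cpositive :: "'a::cstar_algebra \<Rightarrow> bool" where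
  "cpositive x \<longleftrightarrow> self_adjoint x \<and> real_spectrum x \<subseteq> {0..}"

definition pos_inv :: "'a::cstar_algebra set" where
  "pos_inv = {x. cpositive x \<and> cinvertible x}"

definition poly_eval :: "real poly \<Rightarrow> 'a::cstar_algebra \<Rightarrow> 'a" where
  "poly_eval p x = (\<Sum>i\<le>degree p. coeff p i *\<^sub>R x ^ i)"

text \<open>Continuous functional calculus for self-adjoint elements: \<open>f(x)\<close> is the
limit of \<open>p(x)\<close> as the polynomials \<open>p\<close> converge uniformly to \<open>f\<close> on the spectrum.\<close>
definition cfc :: "(real \<Rightarrow> real) \<Rightarrow> 'a::cstar_algebra \<Rightarrow> 'a" where
  "cfc f x = (THE y. \<forall>\<epsilon>>0. \<exists>\<delta>>0. \<forall>p.
      (\<forall>t\<in>real_spectrum x. \<bar>poly p t - f t\<bar> < \<delta>) \<longrightarrow> norm (poly_eval p x - y) < \<epsilon>)"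

definition positive_map :: "('a::cstar_algebra \<Rightarrow> 'b::cstar_algebra) \<Rightarrow> bool" where
  "positive_map \<Phi> \<longleftrightarrow> (\<forall>x y. \<Phi> (x + y) = \<Phi> x + \<Phi> y) \<and>
     (\<forall>a x. \<Phi> (cscale a x) = cscale a (\<Phi> x)) \<and>
     (\<forall>x. cpositive x \<longrightarrow> cpositive (\<Phi> x))"

definition positive_functional :: "('a::cstar_algebra \<Rightarrow> complex) \<Rightarrow> bool" where
  "positive_functional \<tau> \<longleftrightarrow> (\<forall>x y. \<tau> (x + y) = \<tau> x + \<tau> y) \<and>
     (\<forall>a x. \<tau> (cscale a x) = a * \<tau> x) \<and>
     (\<forall>x. cpositive x \<longrightarrow> Im (\<tau> x) = 0 \<and> Re (\<tau> x) \<ge> 0)"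

definition tracial :: "('a::cstar_algebra \<Rightarrow> complex) \<Rightarrow> bool" where
  "tracial \<tau> \<longleftrightarrow> (\<forall>a b. \<tau> (a * b) = \<tau> (b * a))"

definition mat_hermitian :: "complex mat \<Rightarrow> bool" where
  "mat_hermitian X \<longleftrightarrow> mat_adjoint X = X"

definition mat_real_spectrum :: "complex mat \<Rightarrow> real set" where
  "mat_real_spectrum X = {t. eigenvalue X (complex_of_real t)}"

definition mat_positive :: "complex mat \<Rightarrow> bool" where
  "mat_positive X \<longleftrightarrow> mat_hermitian X \<and> mat_real_spectrum X \<subseteq> {0..}"

definition mat_poly_eval :: "real poly \<Rightarrow> complex mat \<Rightarrow> complex mat" where
  "mat_poly_eval p X = mat (dim_row X) (dim_col X)
     (\<lambda>(i,j). \<Sum>k\<le>degree p. complex_of_real (coeff p k) * (X ^\<^sub>m k) $$ (i,j))"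

text \<open>Functional calculus for Hermitian matrices: \<open>f(X) = p(X)\<close> for any polynomial
\<open>p\<close> agreeing with \<open>f\<close> on the spectrum of \<open>X\<close>.\<close>
definition mat_fc :: "(real \<Rightarrow> real) \<Rightarrow> complex mat \<Rightarrow> complex mat" where
  "mat_fc f X = (THE Y. \<exists>p. (\<forall>t\<in>mat_real_spectrum X. poly p t = f t) \<and> Y = mat_poly_eval p X)"

definition op_mono_dec :: "(real \<Rightarrow> real) \<Rightarrow> bool" where
  "op_mono_dec f \<longleftrightarrow> continuous_on {0<..} f \<and>
    (\<forall>n X Y. X \<in> carrier_mat n n \<longrightarrow> Y \<in> carrier_mat n n \<longrightarrow>
       mat_hermitian X \<longrightarrow> mat_hermitian Y \<longrightarrow>
       mat_real_spectrum X \<subseteq> {0<..} \<longrightarrow> mat_real_spectrum Y \<subseteq> {0<..} \<longrightarrow>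
       mat_positive (Y - X) \<longrightarrow> mat_positive (mat_fc f X - mat_fc f Y))"

end

theory Submission
  imports Defs
begin

text \<open>
  Since \<open>\<tau>\<close> is tracial, the map is \<open>B (f\<^sub>1(X), f\<^sub>2(Y))\<close> for the bilinear form
  \<open>B (p, q) = Re \<tau> (\<Phi>(p) \<Psi>(q))\<close>, which is nonnegative on pairs of positive elements. By Loewner's
  theorem an operator monotone decreasing \<open>f > 0\<close> is, uniformly on compact subsets of \<open>(0,\<infinity>)\<close>, a limit of
  sums of functions \<open>c / (t + s)\<close> with \<open>c, s \<ge> 0\<close>; so it suffices that \<open>B (X\<^sup>-\<^sup>1, Y\<^sup>-\<^sup>1)\<close> is jointly
  convex. After conjugating by square roots, \<open>X\<^sub>0 = 1\<close> and \<open>Y\<^sub>0 = 1\<close>, so that everything takes place in the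
  commutative algebras generated by a single \<open>Z\<close> and a single \<open>W\<close>. Bernstein approximation
  \<open>g(Z) \<approx> \<Sum> g(z\<^sub>k) e\<^sub>k\<close> with positive \<open>e\<^sub>k\<close> then reduces the claim to the joint convexity of the scalar
  function \<open>1 / (z w)\<close>.

  The approximation theorem is proved by duality. If \<open>\<Sum> c\<^sub>j / (t\<^sub>j + s) \<ge> 0\<close> for all \<open>s \<ge> 0\<close>, the numerator
  of this rational function is a polynomial nonnegative on \<open>[0,\<infinity>)\<close>, hence a sum of terms \<open>R\<^sup>2\<close> and \<open>s R\<^sup>2\<close>.
  For a single square, \<open>\<Sum> c\<^sub>j f(t\<^sub>j) \<ge> 0\<close> is the inequality \<open>\<langle>w, (f(X) - f(Y)) w\<rangle> \<ge> 0\<close>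
  for \<open>X \<le> Y\<close> differing by a rank one matrix and having the alternate nodes \<open>t\<^sub>j\<close> as eigenvalues.
\<close>

section \<open>Elementary properties of C*-algebras\<close>

text \<open>The maps \<Phi> and \<Psi> are merely positive, so no operator inequality in matrices
  over the algebras can be pushed through them. What survives is a bilinear form with nonnegative
  values on pairs of positive elements, and such a form can be tested one commutative algebra at a
  time. The hypothesis on f speaks of finite matrices and the conclusion of arbitrary C*-algebras.
  The two meet only in a scalar statement, the uniform approximation of f on compact intervals, so
  that matrices and C*-algebras never interact directly. The approximating sums carry no constant
  term: a constant c is the limit of c s / (t + s) for large s. Duality is applied at finitely many
  nodes; the passage to a whole interval rests on the fact that the sums are themselves decreasing.
  Positivity of f enters the duality where the term of a node sent to infinity is discarded. On the
  C*-side everything is derived from the C*-identity, through square roots that commute with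
  whatever the original element commutes with.\<close>

lemma cstar_one [simp]: "cstar (1::'a::cstar_algebra) = 1"
  by (metis cstar_cstar cstar_mult mult.right_neutral mult_1)

lemma cstar_scaleR [simp]: "cstar (r *\<^sub>R x) = r *\<^sub>R cstar (x::'a::cstar_algebra)"
  by (metis complex_cnj_complex_of_real cscale_of_real cstar_cscale)

lemma cstar_zero [simp]: "cstar (0::'a::cstar_algebra) = 0"
  using cstar_scaleR[of 0 "0::'a"] by simp

lemma cstar_minus [simp]: "cstar (- x) = - cstar (x::'a::cstar_algebra)"
  using cstar_scaleR[of "-1" x] by simp

lemma cstar_diff: "cstar (x - y) = cstar x - cstar (y::'a::cstar_algebra)"
  using cstar_add[of x "-y"] by simp

lemma norm_cstar [simp]: "norm (cstar x) = norm (x::'a::cstar_algebra)"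
proof -
  have le: "norm y \<le> norm (cstar y)" for y :: 'a
  proof (cases "y = 0")
    case False
    have "norm y * norm y \<le> norm (cstar y) * norm y"
      using norm_mult_ineq[of "cstar y" y] cstar_identity[of y] by (simp add: power2_eq_square)
    then show ?thesis using False by simp
  qed simp
  show ?thesis using le[of x] le[of "cstar x"] by (simp add: cstar_cstar)
qed

lemma bounded_linear_cstar: "bounded_linear (cstar :: 'a::cstar_algebra \<Rightarrow> 'a)"
  by (rule bounded_linear_intro[where K = 1]) (auto simp: cstar_add)

lemma self_adjoint_simps [simp]:
  "self_adjoint (0::'a::cstar_algebra)" "self_adjoint (1::'a)" "self_adjoint (of_real r :: 'a)"
  by (auto simp: self_adjoint_def of_real_def)

lemma self_adjoint_add: "self_adjoint x \<Longrightarrow> self_adjoint y \<Longrightarrow> self_adjoint (x + y)"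
  and self_adjoint_diff: "self_adjoint x \<Longrightarrow> self_adjoint y \<Longrightarrow> self_adjoint (x - y)"
  and self_adjoint_scaleR: "self_adjoint x \<Longrightarrow> self_adjoint (r *\<^sub>R x)"
  and self_adjoint_mult: "self_adjoint x \<Longrightarrow> self_adjoint y \<Longrightarrow> x * y = y * x \<Longrightarrow> self_adjoint (x * y)"
  and self_adjoint_conj: "self_adjoint x \<Longrightarrow> self_adjoint y \<Longrightarrow> self_adjoint (x * y * x)"
  by (auto simp: self_adjoint_def cstar_add cstar_diff cstar_mult mult.assoc)

lemma self_adjoint_power: "self_adjoint x \<Longrightarrow> self_adjoint (x ^ n)"
  by (induction n) (auto intro!: self_adjoint_mult simp: power_commutes)

lemma self_adjoint_sum: "(\<And>i. i \<in> I \<Longrightarrow> self_adjoint (g i)) \<Longrightarrow> self_adjoint (\<Sum>i\<in>I. g i)"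
  by (induction I rule: infinite_finite_induct) (auto intro: self_adjoint_add)

lemma self_adjoint_lim:
  assumes "X \<longlonglongrightarrow> (x::'a::cstar_algebra)" "\<And>n. self_adjoint (X n)"
  shows "self_adjoint x"
  using bounded_linear.tendsto[OF bounded_linear_cstar assms(1)] assms
  unfolding self_adjoint_def by (auto intro: LIMSEQ_unique)

lemma self_adjoint_inverse:
  assumes "self_adjoint (x::'a::cstar_algebra)" "x * y = 1" "y * x = 1"
  shows "self_adjoint y"
proof -
  have "x * cstar y = 1"
    using assms by (metis cstar_mult cstar_one self_adjoint_def)
  then show ?thesis unfolding self_adjoint_def
    using assms by (metis mult.assoc mult.right_neutral mult_1)
qed

lemma norm_square: "self_adjoint x \<Longrightarrow> norm (x * x) = (norm (x::'a::cstar_algebra))\<^sup>2"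
  using cstar_identity[of x] by (simp add: self_adjoint_def)

lemma cscale_ii: "cscale \<i> (cscale \<i> x) = - (x::'a::cstar_algebra)"
  using cscale_of_real[of "-1" x] by (simp add: cscale_cscale)

lemma cscale_minus_left: "cscale (- a) x = - cscale a (x::'a::cstar_algebra)"
  using cscale_cscale[of "-1" a x] cscale_of_real[of "-1" "cscale a x"] by simp

lemma cscale_zero_right [simp]: "cscale a 0 = (0::'a::cstar_algebra)"
  using cscale_add_right[of a 0 0] by simp

lemma cscale_minus_right: "cscale a (- x) = - cscale a (x::'a::cstar_algebra)"
  using cscale_add_right[of a x "-x"] by (simp add: eq_neg_iff_add_eq_0 add.commute)

lemma cscale_diff_right: "cscale a (x - y) = cscale a x - cscale a (y::'a::cstar_algebra)"
  using cscale_add_right[of a x "-y"] by (simp add: cscale_minus_right)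

lemma cstar_cscale_ii: "self_adjoint b \<Longrightarrow> cstar (cscale \<i> b) = - cscale \<i> (b::'a::cstar_algebra)"
  by (simp add: cstar_cscale self_adjoint_def cscale_minus_left)

text \<open>For self-adjoint a and b these are the products of c = a + \<i> b with its adjoint, in
  both orders. The commutator term vanishes when a and b commute, and also under a trace.\<close>

lemma cartesian_products:
  fixes a b :: "'a::cstar_algebra"
  shows "(a + cscale \<i> b) * (a - cscale \<i> b) = a * a + b * b + cscale \<i> (b * a - a * b)"
    and "(a - cscale \<i> b) * (a + cscale \<i> b) = a * a + b * b - cscale \<i> (b * a - a * b)"
proof -
  have bb: "cscale \<i> b * cscale \<i> b = - (b * b)"
    by (simp add: cscale_mult_left cscale_mult_right cscale_ii)
  note d = cscale_diff_right
  show "(a + cscale \<i> b) * (a - cscale \<i> b) = a * a + b * b + cscale \<i> (b * a - a * b)"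
    "(a - cscale \<i> b) * (a + cscale \<i> b) = a * a + b * b - cscale \<i> (b * a - a * b)"
    unfolding d
    by (simp_all only: distrib_left distrib_right left_diff_distrib right_diff_distrib bb
        cscale_mult_left cscale_mult_right) (simp_all add: cscale_ii algebra_simps cscale_add_right cscale_diff_right)
qed

text \<open>For commuting self-adjoint elements, \<open>a\<^sup>2 + b\<^sup>2 = c\<^sup>* c\<close> with \<open>c = a + \<i> b\<close>,
  whose real part is \<open>a\<close>.\<close>
lemma norm_square_le_sum_squares:
  fixes a b :: "'a::cstar_algebra"
  assumes a: "self_adjoint a" and b: "self_adjoint b" and ab: "a * b = b * a"
  shows "norm (a * a) \<le> norm (a * a + b * b)"
proof -
  define c where "c = a + cscale \<i> b"
  have cs: "cstar c = a - cscale \<i> b"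
    using a b by (simp add: c_def cstar_add cstar_cscale_ii) (simp add: self_adjoint_def)
  have "cstar c * c = a * a + b * b"
    unfolding cs by (simp add: c_def cartesian_products ab)
  then have nc: "norm (a * a + b * b) = (norm c)\<^sup>2"
    using cstar_identity[of c] by simp
  have "2 *\<^sub>R a = c + cstar c" unfolding cs by (simp add: c_def scaleR_2)
  then have "2 * norm a \<le> 2 * norm c"
    using norm_triangle_ineq[of c "cstar c"] by (metis norm_cstar norm_scaleR abs_numeral mult_2)
  then show ?thesis by (simp add: nc norm_square[OF a])
qed

section \<open>Square roots by the binomial series, and invertibility\<close>

text \<open>These are the Taylor coefficients of sqrt(1 - x). After the first they are nonpositive,
  and their partial sums are nonnegative, so the absolute values sum to at most 2; this gives
  convergence up to the boundary of the unit ball. The convolution is Vandermonde's identity for 1/2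
  + 1/2 = 1.\<close>

lemma sqrt_coeffs:
  defines "c \<equiv> \<lambda>n. ((1/2) gchoose n) * (-1)^n :: real"
  shows "summable (\<lambda>n. \<bar>c n\<bar>)"
    and "(\<Sum>i\<le>n. c i * c (n - i)) = (if n = 0 then 1 else if n = 1 then -1 else 0)"
proof -
  have c0: "c 0 = 1" by (simp add: c_def)
  have "c n = pochhammer (-1/2) n / fact n" for n
    by (simp add: c_def gbinomial_pochhammer mult.commute)
  moreover have "pochhammer (-1/2 :: real) (Suc n) \<le> 0" for n
    unfolding pochhammer_rec by (simp add: pochhammer_nonneg)
  ultimately have cneg: "c (Suc n) \<le> 0" for n
    by (simp add: divide_nonpos_pos del: pochhammer_Suc)
  have abs: "\<bar>c n\<bar> = (if n = 0 then 2 else 0) - c n" for n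
    using cneg by (cases n) (auto simp: c0)
  \<comment> \<open>The partial sum is, up to sign, the binomial coefficient for the exponent 1/2 -
    1 = -1/2, and the signs cancel.\<close>
  have "(\<Sum>k\<le>n. c k) \<ge> 0" for n
  proof -
    have "(\<Sum>k\<le>n. c k) = (-1)^n * ((-1/2::real) gchoose n)"
      unfolding c_def gbinomial_sum_lower_neg by simp
    also have "\<dots> = pochhammer (1/2) n / fact n"
      by (simp add: gbinomial_pochhammer)
    also have "\<dots> \<ge> 0" by (simp add: pochhammer_nonneg)
    finally show ?thesis .
  qed
  then have "(\<Sum>k\<le>n. \<bar>c k\<bar>) \<le> 2" for n
    unfolding abs sum_subtractf by (simp add: sum.delta)
  then show "summable (\<lambda>n. \<bar>c n\<bar>)"
    by (intro bounded_imp_summable[where B = 2]) auto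
  have "(\<Sum>i\<le>n. c i * c (n - i)) = (-1)^n * (\<Sum>i\<in>{0..n}. ((1/2) gchoose i) * ((1/2) gchoose (n - i)))"
    unfolding sum_distrib_left atMost_atLeast0
    by (rule sum.cong) (auto simp: c_def algebra_simps simp flip: power_add)
  also have "\<dots> = (-1)^n * ((1::real) gchoose n)"
    by (simp only: gbinomial_Vandermonde) simp
  also have "\<dots> = (-1)^n * real (1 choose n)"
    using binomial_gbinomial[of 1 n, where 'a = real] by simp
  finally show "(\<Sum>i\<le>n. c i * c (n - i)) = (if n = 0 then 1 else if n = 1 then -1 else 0)"
    by (cases n) auto
qed

text \<open>The binomial series converges absolutely even for norm 1, and its Cauchy product
  collapses to 1 - z. The commutation clause is what makes \<open>norm_square_le_sum_squares\<close>
  applicable to the root later on.\<close>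

lemma sqrt_one_minus:
  fixes z :: "'a::cstar_algebra"
  assumes z: "self_adjoint z" and nz: "norm z \<le> 1"
  shows "\<exists>u. self_adjoint u \<and> u * u = 1 - z \<and> (\<forall>y. y * z = z * y \<longrightarrow> y * u = u * y)"
proof -
  define c where "c = (\<lambda>n. ((1/2) gchoose n) * (-1)^n :: real)"
  define g where "g n = c n *\<^sub>R z ^ n" for n
  define u where "u = (\<Sum>n. g n)"
  have sc: "summable (\<lambda>n. \<bar>c n\<bar>)" unfolding c_def by (rule sqrt_coeffs(1))
  have "norm (g n) \<le> \<bar>c n\<bar>" for n
    using norm_power_ineq[of z n] nz power_le_one[of "norm z" n]
    by (simp add: g_def mult_left_le)
  then have sn: "summable (\<lambda>n. norm (g n))"
    by (intro summable_comparison_test'[OF sc, of 0]) simp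
  then have gs: "g sums u" unfolding u_def using summable_norm_cancel summable_sums by blast
  have com: "y * u = u * y" if "y * z = z * y" for y
  proof -
    have "y * z ^ n = z ^ n * y" for n
      by (induction n) (auto simp: mult.assoc, metis mult.assoc that)
    then have "y * g n = g n * y" for n by (simp add: g_def)
    then show ?thesis
      using sums_mult[OF gs, of y] sums_mult2[OF gs, of y] by (simp add: sums_unique2)
  qed
  have sa: "self_adjoint u"
    using gs unfolding sums_def
    by (rule self_adjoint_lim) (auto intro!: self_adjoint_sum self_adjoint_scaleR self_adjoint_power z simp: g_def)
  have "(\<lambda>k. \<Sum>i\<le>k. g i * g (k - i)) sums (u * u)"
    unfolding u_def by (rule Cauchy_product_sums[OF sn sn])
  moreover have "(\<Sum>i\<le>k. g i * g (k - i)) = (if k = 0 then 1 else if k = 1 then - z else 0)" for k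
  proof -
    have "(\<Sum>i\<le>k. g i * g (k - i)) = (\<Sum>i\<le>k. c i * c (k - i)) *\<^sub>R z ^ k"
      unfolding scaleR_sum_left by (rule sum.cong) (auto simp: g_def simp flip: power_add)
    also have "\<dots> = (if k = 0 then 1 else if k = 1 then - z else 0)"
      unfolding c_def sqrt_coeffs(2) by auto
    finally show ?thesis .
  qed
  ultimately have "(\<lambda>k. if k = 0 then 1 else if k = 1 then - z else 0) sums (u * u)" by simp
  moreover have "(\<lambda>k. if k = 0 then 1 else if k = 1 then - z else 0) sums (\<Sum>k\<in>{0,1::nat}. if k = 0 then 1 else if k = 1 then - z else 0)"
    by (rule sums_finite) auto
  ultimately have "u * u = 1 - z" by (auto dest: sums_unique2)
  then show ?thesis using sa com by blast
qed

lemma sqrt_const_minus: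
  fixes x :: "'a::cstar_algebra"
  assumes x: "self_adjoint x" and nx: "norm x \<le> M"
  shows "\<exists>u. self_adjoint u \<and> u * u = of_real M - x \<and> (\<forall>y. y * x = x * y \<longrightarrow> y * u = u * y)"
proof (cases "M = 0")
  case True
  then show ?thesis using nx by (intro exI[of _ 0]) simp
next
  case False
  then have M: "M > 0" using nx norm_ge_zero[of x] by linarith
  have "self_adjoint ((1/M) *\<^sub>R x)" "norm ((1/M) *\<^sub>R x) \<le> 1"
    using x nx M by (simp_all add: self_adjoint_scaleR)
  then obtain v where v: "self_adjoint v" "v * v = 1 - (1/M) *\<^sub>R x"
    and com: "\<forall>y. y * ((1/M) *\<^sub>R x) = ((1/M) *\<^sub>R x) * y \<longrightarrow> y * v = v * y"
    using sqrt_one_minus by blast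
  show ?thesis
  proof (intro exI conjI allI impI)
    show "sqrt M *\<^sub>R v * sqrt M *\<^sub>R v = of_real M - x"
      using M by (simp add: v scaleR_right_diff_distrib of_real_def)
    fix y assume "y * x = x * y"
    then have "y * v = v * y" using com by simp
    then show "y * sqrt M *\<^sub>R v = sqrt M *\<^sub>R v * y" by simp
  qed (simp add: self_adjoint_scaleR v)
qed

lemma cinvertible_const_minus:
  fixes z :: "'a::cstar_algebra"
  assumes "norm z < \<bar>c\<bar>"
  shows "cinvertible (of_real c - z)"
proof -
  have c: "c \<noteq> 0" using assms by auto
  define w where "w = (1/c) *\<^sub>R z"
  have w: "norm w < 1" using assms c by (simp add: w_def divide_simps)
  have s: "summable (\<lambda>n. w ^ n)" using w by (rule complete_algebra_summable_geometric)
  define S where "S = (\<Sum>n. w ^ n)"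
  have S: "(\<lambda>n. w ^ n) sums S" using s by (simp add: S_def summable_sums)
  have S': "(\<lambda>n. w ^ Suc n) sums (S - 1)"
    using S sums_Suc_iff[of "\<lambda>n. w ^ n" "S - 1"] by simp
  have "w * S = S - 1" using sums_unique2[OF sums_mult[OF S, of w]] S' by simp
  moreover have "S * w = S - 1" using sums_unique2[OF sums_mult2[OF S, of w]] S' by (simp add: power_commutes)
  ultimately have "(1 - w) * S = 1" "S * (1 - w) = 1" by (auto simp: algebra_simps)
  moreover have "of_real c - z = c *\<^sub>R (1 - w)" using c by (simp add: w_def scaleR_right_diff_distrib of_real_def)
  ultimately have "(of_real c - z) * ((1/c) *\<^sub>R S) = 1" "((1/c) *\<^sub>R S) * (of_real c - z) = 1"
    using c by auto
  then show ?thesis unfolding cinvertible_def by blast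
qed

lemma cinvertible_mult: "cinvertible x \<Longrightarrow> cinvertible y \<Longrightarrow> cinvertible (x * y)"
  unfolding cinvertible_def
proof (elim exE conjE)
  fix u v assume "x * u = 1" "u * x = 1" "y * v = 1" "v * y = 1"
  then have "(x * y) * (v * u) = 1" "(v * u) * (x * y) = 1"
    by (metis mult.assoc mult.right_neutral)+
  then show "\<exists>z. x * y * z = 1 \<and> z * (x * y) = 1" by blast
qed

lemma cinvertible_minus: "cinvertible (- x) \<longleftrightarrow> cinvertible x"
  unfolding cinvertible_def by (metis minus_mult_minus minus_minus)

lemma cinvertible_of_real: "c \<noteq> 0 \<Longrightarrow> cinvertible (of_real c)"
  using cinvertible_const_minus[of 0 c] by simp

lemma inverse_commute:
  assumes "x * y = 1" "y * x = (1::'a::monoid_mult)" "z * x = x * z"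
  shows "z * y = y * z"
  by (metis assms mult.assoc mult.left_neutral mult.right_neutral)

text \<open>Let N be the norm of x^2 and u^2 = N - x^2 with u commuting with x. Then u^2 has norm at
  most that of u^2 + x^2 = N, so x^2 + c = (N + c) - u^2 is inverted by the Neumann series. Hence
  squares have no negative spectrum, and quadratics without real roots are invertible at x.\<close>

lemma cinvertible_square_plus:
  fixes x :: "'a::cstar_algebra"
  assumes x: "self_adjoint x" and c: "c > 0"
  shows "cinvertible (x * x + of_real c)"
proof -
  have sxx: "self_adjoint (x * x)" using x by (simp add: self_adjoint_mult)
  obtain u where u: "self_adjoint u" "u * u = of_real (norm (x * x)) - x * x"
    and "\<forall>y. y * (x * x) = (x * x) * y \<longrightarrow> y * u = u * y"
    using sqrt_const_minus[OF sxx order.refl] by blast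
  then have "u * x = x * u" by (simp add: mult.assoc)
  then have "norm (u * u) \<le> norm (u * u + x * x)"
    by (rule norm_square_le_sum_squares[OF u(1) x])
  also have "\<dots> = norm (x * x)" by (simp add: u)
  finally have "norm (u * u) < \<bar>norm (x * x) + c\<bar>" using c by linarith
  from cinvertible_const_minus[OF this] show ?thesis by (simp add: u algebra_simps)
qed

text \<open>If \<open>\<plusminus>\<parallel>x\<parallel>\<close> were both outside the spectrum, then \<open>w\<^sup>2 = \<parallel>x\<parallel>\<^sup>2 - x\<^sup>2\<close> would have an
  inverse \<open>r\<close>; taking the square root \<open>u\<close> of \<open>C - r\<close> with \<open>C = \<parallel>r\<parallel>\<close> gives
  \<open>C x\<^sup>2 + (u w)\<^sup>2 = C \<parallel>x\<parallel>\<^sup>2 - 1\<close>, whose norm is smaller than that of \<open>C x\<^sup>2\<close>.\<close>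
lemma norm_in_spectrum:
  fixes x :: "'a::cstar_algebra"
  assumes x: "self_adjoint x"
  shows "norm x \<in> real_spectrum x \<or> - norm x \<in> real_spectrum x"
proof (rule ccontr)
  assume "\<not> ?thesis"
  then have i: "cinvertible (x - of_real (norm x))" "cinvertible (x + of_real (norm x))"
    by (auto simp: real_spectrum_def)
  define M where "M = (norm x)\<^sup>2"
  have M: "norm (x * x) = M" by (simp add: M_def norm_square x)
  have sxx: "self_adjoint (x * x)" using x by (simp add: self_adjoint_mult)
  have "cinvertible (- ((x - of_real (norm x)) * (x + of_real (norm x))))"
    unfolding cinvertible_minus by (rule cinvertible_mult[OF i])
  also have "- ((x - of_real (norm x)) * (x + of_real (norm x))) = of_real M - x * x"
    by (simp add: algebra_simps of_real_def M_def power2_eq_square)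
  finally obtain r where r: "(of_real M - x * x) * r = 1" "r * (of_real M - x * x) = 1"
    unfolding cinvertible_def by blast
  have sr: "self_adjoint r"
    by (rule self_adjoint_inverse[OF _ r]) (simp add: self_adjoint_diff sxx)
  obtain w where w: "self_adjoint w" "w * w = of_real M - x * x"
    and wc: "\<forall>y. y * (x * x) = (x * x) * y \<longrightarrow> y * w = w * y"
    using sqrt_const_minus[OF sxx] M by blast
  have wx: "w * x = x * w" using wc by (simp add: mult.assoc)
  define C where "C = norm r"
  obtain u where u: "self_adjoint u" "u * u = of_real C - r"
    and uc: "\<forall>y. y * r = r * y \<longrightarrow> y * u = u * y"
    using sqrt_const_minus[OF sr, of C] unfolding C_def by blast
  have "x * (of_real M - x * x) = (of_real M - x * x) * x"
    by (simp add: algebra_simps of_real_def)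
  then have xr: "x * r = r * x" by (rule inverse_commute[OF r])
  have "w * (of_real M - x * x) = (of_real M - x * x) * w"
    by (simp add: w(2)[symmetric] mult.assoc)
  then have wr: "w * r = r * w" by (rule inverse_commute[OF r])
  have xu: "x * u = u * x" and wu: "w * u = u * w" using uc xr wr by auto
  have Cpos: "C > 0" using r(1) by (auto simp: C_def)
  define a where "a = sqrt C *\<^sub>R x"
  have a: "self_adjoint a" "a * a = C *\<^sub>R (x * x)"
    using x Cpos by (simp_all add: a_def self_adjoint_scaleR)
  have sb: "self_adjoint (u * w)" using u w wu by (simp add: self_adjoint_mult)
  have "(u * w) * (u * w) = (u * u) * (w * w)" by (metis mult.assoc wu)
  also have "\<dots> = C *\<^sub>R (of_real M - x * x) - 1"
    unfolding u w left_diff_distrib r by (simp add: of_real_def)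
  finally have bb: "a * a + (u * w) * (u * w) = of_real (C * M - 1)"
    by (simp add: a algebra_simps) (simp add: of_real_def)
  have "a * (u * w) = (u * w) * a"
    unfolding a_def using xu wx by (simp add: mult.assoc) (metis mult.assoc)
  from norm_square_le_sum_squares[OF a(1) sb this]
  have le: "C * M \<le> \<bar>C * M - 1\<bar>"
    unfolding bb using Cpos M by (simp add: a flip: of_real_mult of_real_diff)
  \<comment> \<open>The bound \<open>C * M \<ge> 1\<close> opens the absolute value in
    \<open>le\<close>. It follows because r inverts w^2, whose norm is at most M.\<close>
  have "norm (w * w) \<le> norm (w * w + x * x)"
    by (rule norm_square_le_sum_squares[OF w(1) x wx])
  also have "w * w + x * x = of_real M" by (simp add: w)
  finally have "norm (w * w) \<le> M" by (simp add: M_def del: of_real_power)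
  moreover have "1 \<le> norm (w * w) * C"
    using norm_mult_ineq[of "w * w" r] r(1) by (simp add: w C_def)
  ultimately have "1 \<le> C * M" using Cpos
    by (metis mult.commute mult_left_mono order.trans less_imp_le)
  then show False using le by simp
qed

section \<open>Spectrum and functional calculus of self-adjoint elements\<close>

text \<open>A complex root z exists by the fundamental theorem of algebra. If z is not real,
  division by the real quadratic with roots z and its conjugate leaves a real linear remainder
  vanishing at z, hence 0. The factorization serves twice: for the spectral mapping property and for
  polynomials nonnegative on the half-line.\<close>

lemma real_poly_factor:
  fixes p :: "real poly"
  assumes "degree p > 0"
  shows "(\<exists>z q. p = [:-z, 1:] * q) \<or> (\<exists>a b q. b > 0 \<and> p = [:a\<^sup>2 + b, - 2 * a, 1:] * q)"
proof -
  define E where "E p = poly (map_poly complex_of_real p)" for p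
  have E_pCons: "E (pCons a p) z = of_real a + z * E p z" for a p z
    by (cases "p = 0 \<and> a = 0") (auto simp: E_def map_poly_pCons)
  have E_add: "E (p + q) z = E p z + E q z" for p q z
    by (induction p q rule: poly_induct2) (simp_all add: E_pCons algebra_simps, simp add: E_def)
  have E_smult: "E (Polynomial.smult a p) z = of_real a * E p z" for a p z
    by (induction p) (simp_all add: E_pCons algebra_simps, simp add: E_def)
  have E_0: "E 0 z = 0" for z by (simp add: E_def)
  have E_mult: "E (p * q) z = E p z * E q z" for p q z
    by (induction p) (simp_all add: E_pCons E_add E_smult E_0 algebra_simps)
  have E_real: "E p (of_real t) = of_real (poly p t)" for p t
    by (induction p) (simp_all add: E_pCons E_0)
  have "degree (map_poly complex_of_real p) = degree p" by (rule degree_map_poly) simp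
  then have "\<not> constant (poly (map_poly complex_of_real p))"
    using assms by (simp add: constant_degree)
  then obtain z where z: "E p z = 0" using fundamental_theorem_of_algebra unfolding E_def by blast
  show ?thesis
  proof (cases "Im z = 0")
    case True
    then have "z = complex_of_real (Re z)" by (simp add: complex_eq_iff)
    then have "poly p (Re z) = 0"
      using z E_real[of p "Re z"] by (metis of_real_0 of_real_eq_iff)
    then show ?thesis by (metis dvdE poly_eq_0_iff_dvd)
  next
    case False
    define m where "m = [:(Re z)\<^sup>2 + (Im z)\<^sup>2, - 2 * Re z, 1:]"
    define r where "r = p mod m"
    have m0: "E m z = 0"
      by (simp add: m_def E_pCons E_0 complex_eq_iff power2_eq_square algebra_simps)
    have "degree m = 2" "m \<noteq> 0" by (simp_all add: m_def)
    then have "degree r \<le> 1"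
      unfolding r_def using degree_mod_less[of m p] by force
    then have r: "r = [:coeff r 0, coeff r 1:]"
      by (intro poly_eqI) (auto simp: coeff_pCons coeff_eq_0 split: nat.split)
    have "p = p div m * m + r" by (simp add: r_def)
    then have "E p z = E (p div m) z * E m z + E r z" by (metis E_add E_mult)
    then have "E r z = 0" using z m0 by simp
    then have "E [:coeff r 0, coeff r 1:] z = 0" using r by simp
    then have "coeff r 1 = 0" "coeff r 0 = 0" using False by (auto simp: E_pCons E_0 complex_eq_iff)
    then have "r = 0" using r by simp
    then have "p = m * (p div m)" by (simp add: r_def mod_eq_0_iff_dvd)
    then show ?thesis using False unfolding m_def
      by (intro disjI2 exI[of _ "Re z"] exI[of _ "(Im z)\<^sup>2"] exI) auto
  qed
qed

lemma poly_eval_altdef: "degree p \<le> n \<Longrightarrow> poly_eval p x = (\<Sum>i\<le>n. coeff p i *\<^sub>R x ^ i)"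
  unfolding poly_eval_def by (rule sum.mono_neutral_left) (auto simp: coeff_eq_0)

lemma poly_eval_pCons: "poly_eval (pCons a p) x = of_real a + x * poly_eval p x"
proof -
  have "poly_eval (pCons a p) x = (\<Sum>i\<le>Suc (degree p). coeff (pCons a p) i *\<^sub>R x ^ i)"
    by (rule poly_eval_altdef) (simp add: degree_pCons_le)
  then show ?thesis
    unfolding sum.atMost_Suc_shift by (simp add: poly_eval_def of_real_def sum_distrib_left)
qed

lemma poly_eval_0 [simp]: "poly_eval 0 x = 0"
  by (simp add: poly_eval_def)

lemma poly_eval_add: "poly_eval (p + q) x = poly_eval p x + poly_eval q x"
  by (induction p q rule: poly_induct2) (simp_all add: poly_eval_pCons algebra_simps)

lemma poly_eval_smult: "poly_eval (Polynomial.smult a p) x = a *\<^sub>R poly_eval p x"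
  by (induction p) (simp_all add: poly_eval_pCons algebra_simps of_real_def)

lemma poly_eval_diff: "poly_eval (p - q) x = poly_eval p x - poly_eval q x"
  using poly_eval_add[of "p - q" q x] by simp

lemma poly_eval_mult: "poly_eval (p * q) x = poly_eval p x * poly_eval q x"
  by (induction p)
    (simp_all add: poly_eval_pCons poly_eval_add poly_eval_smult distrib_right mult.assoc of_real_def)

lemma poly_eval_const [simp]: "poly_eval [:a:] x = of_real a"
  by (simp add: poly_eval_pCons)

lemma poly_eval_sum: "poly_eval (\<Sum>i\<in>I. g i) x = (\<Sum>i\<in>I. poly_eval (g i) x)"
  by (induction I rule: infinite_finite_induct) (simp_all add: poly_eval_add)

lemma self_adjoint_poly_eval: "self_adjoint x \<Longrightarrow> self_adjoint (poly_eval p x)"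
  unfolding poly_eval_def by (intro self_adjoint_sum self_adjoint_scaleR self_adjoint_power)

text \<open>One half of the spectral mapping theorem: factors with a root outside the spectrum, and
  quadratics without real roots, are invertible at x, so they can be stripped off until a root
  inside the spectrum appears.\<close>

lemma not_cinvertible_poly_eval:
  fixes x :: "'a::cstar_algebra"
  assumes x: "self_adjoint x"
  shows "\<not> cinvertible (poly_eval p x) \<Longrightarrow> \<exists>t\<in>real_spectrum x. poly p t = 0"
proof (induction "degree p" arbitrary: p rule: less_induct)
  case less
  \<comment> \<open>The zero polynomial is never invertible at x, so it requires a spectral point as
    witness.\<close>
  obtain t0 where t0: "t0 \<in> real_spectrum x" using norm_in_spectrum[OF x] by blast
  show ?case
  proof (cases "p = 0 \<or> degree p = 0")
    case True
    then obtain a where p: "p = [:a:]" by (metis degree_eq_zeroE pCons_0_0)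
    then have "a = 0" using less.prems cinvertible_of_real[of a] by auto
    then show ?thesis using t0 p by auto
  next
    case False
    then have "degree p > 0" and p0: "p \<noteq> 0" by auto
    from real_poly_factor[OF this(1)] show ?thesis
    proof (elim disjE exE conjE)
      fix z q assume p: "p = [:-z, 1:] * q"
      then have dq: "degree q < degree p" using p0 by (subst p, subst degree_mult_eq) auto
      show ?thesis
      proof (cases "z \<in> real_spectrum x")
        case True then show ?thesis using p by auto
      next
        case False
        then have "cinvertible (poly_eval [:-z, 1:] x)"
          by (simp add: real_spectrum_def poly_eval_pCons)
        then have "\<not> cinvertible (poly_eval q x)"
          using less.prems cinvertible_mult unfolding p poly_eval_mult by blast
        then show ?thesis using less.hyps[OF dq] by (metis p poly_mult mult_zero_right)
      qed
    next
      fix a b q assume b: "b > 0" and p: "p = [:a\<^sup>2 + b, - 2 * a, 1:] * q"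
      then have dq: "degree q < degree p" using p0 by (subst p, subst degree_mult_eq) auto
      have "cinvertible ((x - of_real a) * (x - of_real a) + of_real b)"
        by (rule cinvertible_square_plus) (simp_all add: x b self_adjoint_diff)
      also have "(x - of_real a) * (x - of_real a) + of_real b = poly_eval [:a\<^sup>2 + b, - 2 * a, 1:] x"
        using scaleR_left_distrib[of a a x]
        by (simp add: poly_eval_pCons algebra_simps of_real_def power2_eq_square)
      finally have "\<not> cinvertible (poly_eval q x)"
        using less.prems cinvertible_mult unfolding p poly_eval_mult by blast
      then show ?thesis using less.hyps[OF dq] by (metis p poly_mult mult_zero_right)
    qed
  qed
qed

text \<open>The norm of p(x) is, up to sign, a spectral value c of p(x); since p - c is not
  invertible at x, c is a value of p on the spectrum of x. Evaluation is thus contractive for the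
  supremum norm on the spectrum, the basis of the functional calculus.\<close>

lemma norm_poly_eval_le:
  fixes x :: "'a::cstar_algebra"
  assumes x: "self_adjoint x" and K: "\<And>t. t \<in> real_spectrum x \<Longrightarrow> \<bar>poly p t\<bar> \<le> K"
  shows "norm (poly_eval p x) \<le> K"
proof -
  let ?n = "norm (poly_eval p x)"
  obtain c where c: "\<bar>c\<bar> = ?n" "c \<in> real_spectrum (poly_eval p x)"
    using norm_in_spectrum[OF self_adjoint_poly_eval[OF x, of p]]
    by (metis abs_minus_cancel abs_norm_cancel)
  then have "\<not> cinvertible (poly_eval (p - [:c:]) x)"
    by (simp add: real_spectrum_def poly_eval_diff)
  then obtain t where "t \<in> real_spectrum x" "poly (p - [:c:]) t = 0"
    using not_cinvertible_poly_eval[OF x] by blast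
  then show ?thesis using K[of t] c by simp
qed

lemma real_spectrum_bounded: "t \<in> real_spectrum x \<Longrightarrow> \<bar>t\<bar> \<le> norm (x::'a::cstar_algebra)"
  using cinvertible_const_minus[of x t] cinvertible_minus[of "x - of_real t"]
  unfolding real_spectrum_def by force

section \<open>Continuous functional calculus\<close>

text \<open>Continuity is asked on an interval enclosing the spectrum, so that Weierstrass
  approximation and boundedness apply directly to a compact interval.\<close>

definition cfc_dom :: "(real \<Rightarrow> real) \<Rightarrow> 'a::cstar_algebra \<Rightarrow> bool" where
  "cfc_dom f x \<longleftrightarrow> self_adjoint x \<and> (\<exists>a b. real_spectrum x \<subseteq> {a..b} \<and> continuous_on {a..b} f)"

lemma poly_approx:
  assumes "continuous_on {a..b::real} f" "e > 0"
  obtains p :: "real poly" where "\<And>t. t \<in> {a..b} \<Longrightarrow> \<bar>poly p t - f t\<bar> < e"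
proof -
  obtain g where g: "real_polynomial_function g" "\<And>t. t \<in> {a..b} \<Longrightarrow> \<bar>f t - g t\<bar> < e"
    using Stone_Weierstrass_real_polynomial_function[of "{a..b}" f e] assms by auto
  then obtain c n where "g = (\<lambda>t. \<Sum>i\<le>n. c i * t ^ i)"
    by (auto simp: real_polynomial_function_iff_sum)
  then have "poly (\<Sum>i\<le>n. monom (c i) i) t = g t" for t
    by (simp add: poly_sum poly_monom)
  then show ?thesis using g(2) by (intro that[of "\<Sum>i\<le>n. monom (c i) i"]) (simp add: abs_minus_commute)
qed

lemma inverse_Suc_tendsto: "(\<lambda>n. 1 / (real n + 1)) \<longlonglongrightarrow> 0"
  using LIMSEQ_inverse_real_of_nat by (simp add: inverse_eq_divide add.commute)

text \<open>Shows that the description in \<open>cfc\<close> denotes. Evaluations of approximating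
  polynomials are Cauchy by contractivity; two candidates agree because one polynomial can be chosen
  close enough for both.\<close>

lemma cfc_limit:
  fixes x :: "'a::cstar_algebra"
  assumes "cfc_dom f x" "e > 0"
  shows "\<exists>d>0. \<forall>p. (\<forall>t\<in>real_spectrum x. \<bar>poly p t - f t\<bar> < d) \<longrightarrow> norm (poly_eval p x - cfc f x) < e"
proof -
  let ?P = "\<lambda>y. \<forall>e>0. \<exists>d>0. \<forall>p. (\<forall>t\<in>real_spectrum x. \<bar>poly p t - f t\<bar> < d) \<longrightarrow> norm (poly_eval p x - y) < e"
  from assms obtain a b where x: "self_adjoint x" and ab: "real_spectrum x \<subseteq> {a..b}" "continuous_on {a..b} f"
    by (auto simp: cfc_dom_def)
  have close: "norm (poly_eval p x - poly_eval q x) \<le> d + d'"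
    if "\<forall>t\<in>real_spectrum x. \<bar>poly p t - f t\<bar> < d" "\<forall>t\<in>real_spectrum x. \<bar>poly q t - f t\<bar> < d'" for p q d d'
  proof -
    have "norm (poly_eval (p - q) x) \<le> d + d'"
      by (rule norm_poly_eval_le[OF x]) (use that in force)
    then show ?thesis by (simp add: poly_eval_diff)
  qed
  have ex: "\<exists>p. \<forall>t\<in>real_spectrum x. \<bar>poly p t - f t\<bar> < d" if "d > 0" for d
    using poly_approx[OF ab(2) that] ab(1) by (metis subset_iff)
  then have "\<exists>p. \<forall>t\<in>real_spectrum x. \<bar>poly p t - f t\<bar> < 1 / (real n + 1)" for n by simp
  then obtain P where P: "\<And>n. \<forall>t\<in>real_spectrum x. \<bar>poly (P n) t - f t\<bar> < 1 / (real n + 1)" by metis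
  note lim = inverse_Suc_tendsto
  have "Cauchy (\<lambda>n. poly_eval (P n) x)"
  proof (rule metric_CauchyI)
    fix e :: real assume "e > 0"
    then obtain N where N: "\<And>n. n \<ge> N \<Longrightarrow> 1 / (real n + 1) < e / 2"
      using order_tendstoD(2)[OF lim, of "e / 2"] by (auto simp: eventually_sequentially)
    have "dist (poly_eval (P m) x) (poly_eval (P n) x) < e" if "m \<ge> N" "n \<ge> N" for m n
      using close[OF P[of m] P[of n]] N[OF that(1)] N[OF that(2)] by (simp add: dist_norm)
    then show "\<exists>N. \<forall>m\<ge>N. \<forall>n\<ge>N. dist (poly_eval (P m) x) (poly_eval (P n) x) < e" by blast
  qed
  then obtain y where y: "(\<lambda>n. poly_eval (P n) x) \<longlonglongrightarrow> y"
    using Cauchy_convergent unfolding convergent_def by blast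
  have Py: "?P y"
  proof (intro allI impI)
    fix e :: real assume e: "e > 0"
    have "norm (poly_eval p x - y) \<le> e / 2" if p: "\<forall>t\<in>real_spectrum x. \<bar>poly p t - f t\<bar> < e / 2" for p
    proof (rule LIMSEQ_le)
      show "(\<lambda>n. norm (poly_eval p x - poly_eval (P n) x)) \<longlonglongrightarrow> norm (poly_eval p x - y)"
        by (intro tendsto_intros y)
      show "(\<lambda>n. e / 2 + 1 / (real n + 1)) \<longlonglongrightarrow> e / 2"
        using tendsto_add[OF tendsto_const lim, of "e / 2"] by simp
    qed (use close[OF p P] in blast)
    then show "\<exists>d>0. \<forall>p. (\<forall>t\<in>real_spectrum x. \<bar>poly p t - f t\<bar> < d) \<longrightarrow> norm (poly_eval p x - y) < e"
      using e by (intro exI[of _ "e / 2"]) force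
  qed
  moreover have "z = y" if Pz: "?P z" for z
  proof (rule ccontr)
    assume "z \<noteq> y"
    define e where "e = norm (z - y) / 2"
    have e: "e > 0" using \<open>z \<noteq> y\<close> by (simp add: e_def)
    obtain d1 where d1: "d1 > 0" "\<And>p. \<forall>t\<in>real_spectrum x. \<bar>poly p t - f t\<bar> < d1 \<Longrightarrow> norm (poly_eval p x - y) < e"
      using Py e by blast
    obtain d2 where d2: "d2 > 0" "\<And>p. \<forall>t\<in>real_spectrum x. \<bar>poly p t - f t\<bar> < d2 \<Longrightarrow> norm (poly_eval p x - z) < e"
      using Pz e by blast
    obtain p where p: "\<forall>t\<in>real_spectrum x. \<bar>poly p t - f t\<bar> < min d1 d2"
      using ex[of "min d1 d2"] d1(1) d2(1) by auto
    have "norm (poly_eval p x - y) < e" "norm (poly_eval p x - z) < e"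
      using p by (intro d1(2) d2(2); simp)+
    then have "norm ((poly_eval p x - y) - (poly_eval p x - z)) < e + e"
      using norm_triangle_ineq4[of "poly_eval p x - y" "poly_eval p x - z"] by linarith
    then show False by (simp add: e_def)
  qed
  ultimately have "?P (cfc f x)" unfolding cfc_def by (rule theI)
  then show ?thesis using assms(2) by blast
qed

lemma cfc_domI: "self_adjoint x \<Longrightarrow> real_spectrum x \<subseteq> {a..b} \<Longrightarrow> continuous_on {a..b} f \<Longrightarrow> cfc_dom f x"
  unfolding cfc_dom_def by blast

lemma cfc_dom_everywhere: "self_adjoint x \<Longrightarrow> continuous_on UNIV f \<Longrightarrow> cfc_dom f x"
  by (rule cfc_domI[of _ "- norm x" "norm x"])
    (auto dest!: real_spectrum_bounded intro: continuous_on_subset)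

lemma cfc_dom_op:
  assumes "cfc_dom f x" "cfc_dom g x"
    and op: "\<And>S. continuous_on S f \<Longrightarrow> continuous_on S g \<Longrightarrow> continuous_on S h"
  shows "cfc_dom h x"
proof -
  from assms obtain a b c d where *: "self_adjoint x" "real_spectrum x \<subseteq> {a..b}" "continuous_on {a..b} f"
    "real_spectrum x \<subseteq> {c..d}" "continuous_on {c..d} g"
    by (auto simp: cfc_dom_def)
  then have "continuous_on {max a c..min b d} h"
    by (intro op) (auto intro: continuous_on_subset)
  then show ?thesis using * by (intro cfc_domI[of x "max a c" "min b d"]) (auto simp: subset_iff)
qed

lemma cfc_dom_add: "cfc_dom f x \<Longrightarrow> cfc_dom g x \<Longrightarrow> cfc_dom (\<lambda>t. f t + g t) x"
  and cfc_dom_mult: "cfc_dom f x \<Longrightarrow> cfc_dom g x \<Longrightarrow> cfc_dom (\<lambda>t. f t * g t) x"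
  by (erule (1) cfc_dom_op, intro continuous_intros, assumption+)+

lemma cfc_dom_scale: "cfc_dom f x \<Longrightarrow> cfc_dom (\<lambda>t. r * f t) x"
  by (rule cfc_dom_op[of f x f]) (auto intro: continuous_intros)

lemma cfc_approx:
  fixes x :: "'a::cstar_algebra"
  assumes "cfc_dom f x"
  obtains P where "\<And>n t. t \<in> real_spectrum x \<Longrightarrow> \<bar>poly (P n) t - f t\<bar> < 1 / (real n + 1)"
    "(\<lambda>n. poly_eval (P n) x) \<longlonglongrightarrow> cfc f x"
proof -
  from assms obtain a b where ab: "real_spectrum x \<subseteq> {a..b}" "continuous_on {a..b} f"
    by (auto simp: cfc_dom_def)
  have "\<exists>p. \<forall>t\<in>real_spectrum x. \<bar>poly p t - f t\<bar> < d" if "d > 0" for d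
    using poly_approx[OF ab(2) that] ab(1) by (metis subset_iff)
  then have "\<exists>p. \<forall>t\<in>real_spectrum x. \<bar>poly p t - f t\<bar> < 1 / (real n + 1)" for n by simp
  then obtain P where P: "\<And>n. \<forall>t\<in>real_spectrum x. \<bar>poly (P n) t - f t\<bar> < 1 / (real n + 1)" by metis
  note lim = inverse_Suc_tendsto
  have "(\<lambda>n. poly_eval (P n) x) \<longlonglongrightarrow> cfc f x"
  proof (rule metric_LIMSEQ_I)
    fix e :: real assume "e > 0"
    from cfc_limit[OF assms this] obtain d where d: "d > 0"
      "\<And>p. \<forall>t\<in>real_spectrum x. \<bar>poly p t - f t\<bar> < d \<Longrightarrow> norm (poly_eval p x - cfc f x) < e" by blast
    obtain N where "\<And>n. n \<ge> N \<Longrightarrow> 1 / (real n + 1) < d"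
      using order_tendstoD(2)[OF lim d(1)] by (auto simp: eventually_sequentially)
    then show "\<exists>N. \<forall>n\<ge>N. dist (poly_eval (P n) x) (cfc f x) < e"
      using d(2) P unfolding dist_norm by (meson less_trans)
  qed
  then show ?thesis using P that by blast
qed

text \<open>Any approximating sequence identifies the value, so each algebraic rule for
  \<open>cfc\<close> reduces to the same rule for polynomials.\<close>

lemma cfc_eqI:
  fixes x :: "'a::cstar_algebra"
  assumes f: "cfc_dom f x" and P: "\<And>n t. t \<in> real_spectrum x \<Longrightarrow> \<bar>poly (P n) t - f t\<bar> \<le> d n"
    and d: "d \<longlonglongrightarrow> 0" and y: "(\<lambda>n. poly_eval (P n) x) \<longlonglongrightarrow> y"
  shows "cfc f x = y"
proof -
  have "(\<lambda>n. poly_eval (P n) x) \<longlonglongrightarrow> cfc f x"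
  proof (rule metric_LIMSEQ_I)
    fix e :: real assume "e > 0"
    from cfc_limit[OF f this] obtain c where c: "c > 0"
      "\<And>p. \<forall>t\<in>real_spectrum x. \<bar>poly p t - f t\<bar> < c \<Longrightarrow> norm (poly_eval p x - cfc f x) < e" by blast
    obtain N where "\<And>n. n \<ge> N \<Longrightarrow> d n < c"
      using order_tendstoD(2)[OF d c(1)] by (auto simp: eventually_sequentially)
    then show "\<exists>N. \<forall>n\<ge>N. dist (poly_eval (P n) x) (cfc f x) < e"
      using c(2) P unfolding dist_norm by (meson le_less_trans)
  qed
  then show ?thesis using y by (rule LIMSEQ_unique)
qed

lemma cfc_poly: "self_adjoint x \<Longrightarrow> cfc (poly p) x = poly_eval p x"
  by (rule cfc_eqI[where P = "\<lambda>_. p" and d = "\<lambda>_. 0"])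
    (auto intro!: cfc_dom_everywhere continuous_intros)

lemma cfc_add:
  assumes "cfc_dom f x" "cfc_dom g x"
  shows "cfc (\<lambda>t. f t + g t) x = cfc f x + cfc g x"
proof -
  obtain P where P: "\<And>n t. t \<in> real_spectrum x \<Longrightarrow> \<bar>poly (P n) t - f t\<bar> < 1 / (real n + 1)"
    "(\<lambda>n. poly_eval (P n) x) \<longlonglongrightarrow> cfc f x" using cfc_approx[OF assms(1)] by blast
  obtain Q where Q: "\<And>n t. t \<in> real_spectrum x \<Longrightarrow> \<bar>poly (Q n) t - g t\<bar> < 1 / (real n + 1)"
    "(\<lambda>n. poly_eval (Q n) x) \<longlonglongrightarrow> cfc g x" using cfc_approx[OF assms(2)] by blast
  show ?thesis
  proof (rule cfc_eqI[where P = "\<lambda>n. P n + Q n" and d = "\<lambda>n. 1 / (real n + 1) + 1 / (real n + 1)"])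
    show "(\<lambda>n. 1 / (real n + 1) + 1 / (real n + 1)) \<longlonglongrightarrow> 0"
      using tendsto_add[OF inverse_Suc_tendsto inverse_Suc_tendsto] by simp
    show "(\<lambda>n. poly_eval (P n + Q n) x) \<longlonglongrightarrow> cfc f x + cfc g x"
      unfolding poly_eval_add by (intro tendsto_intros P Q)
    fix n t assume "t \<in> real_spectrum x"
    from P(1)[OF this, of n] Q(1)[OF this, of n]
    show "\<bar>poly (P n + Q n) t - (f t + g t)\<bar> \<le> 1 / (real n + 1) + 1 / (real n + 1)"
      unfolding poly_add by linarith
  qed (rule cfc_dom_add[OF assms])
qed

lemma cfc_dom_bounded:
  assumes "cfc_dom f x" obtains K where "K \<ge> 0" "\<And>t. t \<in> real_spectrum x \<Longrightarrow> \<bar>f t\<bar> \<le> K"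
proof -
  from assms obtain a b where ab: "real_spectrum x \<subseteq> {a..b}" "continuous_on {a..b} f"
    by (auto simp: cfc_dom_def)
  have "bounded (f ` {a..b})" by (intro compact_imp_bounded compact_continuous_image ab) simp
  then obtain K where "\<forall>t\<in>{a..b}. \<bar>f t\<bar> \<le> K" by (auto simp: bounded_iff)
  then show ?thesis using that[of "max K 0"] ab(1) by (meson in_mono le_max_iff_disj max.cobounded2)
qed

lemma cfc_mult:
  assumes "cfc_dom f x" "cfc_dom g x"
  shows "cfc (\<lambda>t. f t * g t) x = cfc f x * cfc g x"
proof -
  obtain P where P: "\<And>n t. t \<in> real_spectrum x \<Longrightarrow> \<bar>poly (P n) t - f t\<bar> < 1 / (real n + 1)"
    "(\<lambda>n. poly_eval (P n) x) \<longlonglongrightarrow> cfc f x" using cfc_approx[OF assms(1)] by blast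
  obtain Q where Q: "\<And>n t. t \<in> real_spectrum x \<Longrightarrow> \<bar>poly (Q n) t - g t\<bar> < 1 / (real n + 1)"
    "(\<lambda>n. poly_eval (Q n) x) \<longlonglongrightarrow> cfc g x" using cfc_approx[OF assms(2)] by blast
  obtain K where K: "K \<ge> 0" "\<And>t. t \<in> real_spectrum x \<Longrightarrow> \<bar>f t\<bar> \<le> K" using cfc_dom_bounded[OF assms(1)] by blast
  obtain L where L: "L \<ge> 0" "\<And>t. t \<in> real_spectrum x \<Longrightarrow> \<bar>g t\<bar> \<le> L" using cfc_dom_bounded[OF assms(2)] by blast
  show ?thesis
  proof (rule cfc_eqI[where P = "\<lambda>n. P n * Q n" and d = "\<lambda>n. (K + 1) * (1 / (real n + 1)) + 1 / (real n + 1) * L"])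
    show "(\<lambda>n. (K + 1) * (1 / (real n + 1)) + 1 / (real n + 1) * L) \<longlonglongrightarrow> 0"
      by (intro tendsto_add_zero tendsto_mult_right_zero tendsto_mult_left_zero inverse_Suc_tendsto)
    show "(\<lambda>n. poly_eval (P n * Q n) x) \<longlonglongrightarrow> cfc f x * cfc g x"
      unfolding poly_eval_mult by (intro tendsto_intros P Q)
    fix n t assume t: "t \<in> real_spectrum x"
    have e: "1 / (real n + 1) \<le> 1" "1 / (real n + 1) \<ge> 0" by (simp_all add: divide_simps)
    have p: "\<bar>poly (P n) t - f t\<bar> \<le> 1 / (real n + 1)" and q: "\<bar>poly (Q n) t - g t\<bar> \<le> 1 / (real n + 1)"
      using P(1)[OF t] Q(1)[OF t] by (simp_all add: less_imp_le)
    have "\<bar>poly (P n) t\<bar> \<le> K + 1" using p e K(2)[OF t] by linarith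
    then have "\<bar>poly (P n) t * (poly (Q n) t - g t)\<bar> \<le> (K + 1) * (1 / (real n + 1))"
      unfolding abs_mult by (intro mult_mono q) (use K in auto)
    moreover have "\<bar>(poly (P n) t - f t) * g t\<bar> \<le> 1 / (real n + 1) * L"
      unfolding abs_mult by (intro mult_mono p L t) (use e in auto)
    moreover have "poly (P n * Q n) t - f t * g t = poly (P n) t * (poly (Q n) t - g t) + (poly (P n) t - f t) * g t"
      by (simp add: algebra_simps)
    ultimately show "\<bar>poly (P n * Q n) t - f t * g t\<bar> \<le> (K + 1) * (1 / (real n + 1)) + 1 / (real n + 1) * L"
      by linarith
  qed (rule cfc_dom_mult[OF assms])
qed

lemma cfc_const: "self_adjoint x \<Longrightarrow> cfc (\<lambda>t. c) x = of_real c"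
  using cfc_poly[of x "[:c:]"] by (simp add: poly_pCons[abs_def])

lemma cfc_ident: "self_adjoint x \<Longrightarrow> cfc (\<lambda>t. t) x = x"
  using cfc_poly[of x "[:0, 1:]"] by (simp add: poly_pCons[abs_def] poly_eval_pCons)

lemma cfc_scale:
  assumes "cfc_dom f x" shows "cfc (\<lambda>t. r * f t) x = r *\<^sub>R cfc f x"
proof -
  have "self_adjoint x" using assms by (simp add: cfc_dom_def)
  then show ?thesis
    using cfc_mult[of "\<lambda>_. r" x f] assms cfc_dom_everywhere[of x "\<lambda>_. r"]
    by (simp add: cfc_const of_real_def)
qed

lemma cfc_diff:
  assumes "cfc_dom f x" "cfc_dom g x"
  shows "cfc (\<lambda>t. f t - g t) x = cfc f x - cfc g x" "cfc_dom (\<lambda>t. f t - g t) x"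
  using cfc_add[OF assms(1) cfc_dom_scale[OF assms(2), of "-1"]] cfc_scale[OF assms(2), of "-1"]
    cfc_dom_add[OF assms(1) cfc_dom_scale[OF assms(2), of "-1"]] by simp_all

lemma norm_cfc_le:
  fixes x :: "'a::cstar_algebra"
  assumes f: "cfc_dom f x" and K: "\<And>t. t \<in> real_spectrum x \<Longrightarrow> \<bar>f t\<bar> \<le> K"
  shows "norm (cfc f x) \<le> K"
proof -
  obtain P where P: "\<And>n t. t \<in> real_spectrum x \<Longrightarrow> \<bar>poly (P n) t - f t\<bar> < 1 / (real n + 1)"
    "(\<lambda>n. poly_eval (P n) x) \<longlonglongrightarrow> cfc f x" using cfc_approx[OF f] by blast
  have "norm (poly_eval (P n) x) \<le> K + 1 / (real n + 1)" for n
    by (rule norm_poly_eval_le) (use f P(1)[of _ n] K in \<open>force simp: cfc_dom_def\<close>)+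
  moreover have "(\<lambda>n. K + 1 / (real n + 1)) \<longlonglongrightarrow> K + 0" by (intro tendsto_intros inverse_Suc_tendsto)
  ultimately show ?thesis using tendsto_norm[OF P(2)] by (intro LIMSEQ_le) auto
qed

lemma self_adjoint_cfc:
  assumes "cfc_dom f x" shows "self_adjoint (cfc f x)"
proof -
  obtain P where "\<And>n t. t \<in> real_spectrum x \<Longrightarrow> \<bar>poly (P n) t - f t\<bar> < 1 / (real n + 1)"
    and "(\<lambda>n. poly_eval (P n) x) \<longlonglongrightarrow> cfc f x" using cfc_approx[OF assms] by blast
  from this(2) show ?thesis
    by (rule self_adjoint_lim) (use assms in \<open>simp add: self_adjoint_poly_eval cfc_dom_def\<close>)
qed

lemma cfc_cong: "(\<And>t. t \<in> real_spectrum x \<Longrightarrow> f t = g t) \<Longrightarrow> cfc f x = cfc g x"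
  unfolding cfc_def by simp

section \<open>Positive elements\<close>

lemma cpositive_sa: "cpositive x \<Longrightarrow> self_adjoint x"
  by (simp add: cpositive_def)

text \<open>For t < 0, x - t = (K - t) - (K - x) where K - x has norm at most K < K - t, so the
  Neumann series inverts it. With the converse \<open>cpositive_norm_le\<close>, positivity becomes
  a norm condition whose stability under sums is the triangle inequality.\<close>

lemma cpositiveI_norm:
  fixes x :: "'a::cstar_algebra"
  assumes "self_adjoint x" "norm (of_real K - x) \<le> K"
  shows "cpositive x"
  unfolding cpositive_def
proof (intro conjI subsetI assms(1))
  fix t assume t: "t \<in> real_spectrum x"
  show "t \<in> {0..}"
  proof (rule ccontr)
    assume "t \<notin> {0..}"
    then have "norm (of_real K - x) < \<bar>K - t\<bar>" using assms(2) by simp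
    from cinvertible_const_minus[OF this] t show False
      by (simp add: real_spectrum_def)
  qed
qed

lemma cpositive_norm_le:
  fixes x :: "'a::cstar_algebra"
  assumes x: "cpositive x" and K: "norm x \<le> K"
  shows "norm (of_real K - x) \<le> K"
proof -
  have "norm (poly_eval [:K, -1:] x) \<le> K"
  proof (rule norm_poly_eval_le)
    fix t assume t: "t \<in> real_spectrum x"
    then have "t \<ge> 0" using x by (auto simp: cpositive_def)
    then show "\<bar>poly [:K, -1:] t\<bar> \<le> K" using real_spectrum_bounded[OF t] K by simp
  qed (rule cpositive_sa[OF x])
  then show ?thesis by (simp add: poly_eval_pCons)
qed

lemma cpositive_add:
  assumes x: "cpositive (x::'a::cstar_algebra)" and y: "cpositive y"
  shows "cpositive (x + y)"
proof (rule cpositiveI_norm[where K = "norm x + norm y"])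
  have "norm ((of_real (norm x) - x) + (of_real (norm y) - y)) \<le> norm x + norm y"
    by (intro norm_triangle_mono cpositive_norm_le x y order.refl)
  then show "norm (of_real (norm x + norm y) - (x + y)) \<le> norm x + norm y"
    by (simp add: algebra_simps)
qed (simp add: x y cpositive_sa self_adjoint_add)

lemma cpositive_scaleR:
  assumes x: "cpositive (x::'a::cstar_algebra)" and c: "c \<ge> 0"
  shows "cpositive (c *\<^sub>R x)"
proof (rule cpositiveI_norm[where K = "c * norm x"])
  have "norm (c *\<^sub>R (of_real (norm x) - x)) \<le> c * norm x"
    using c cpositive_norm_le[OF x order.refl] by (simp add: mult_left_mono)
  then show "norm (of_real (c * norm x) - c *\<^sub>R x) \<le> c * norm x"
    by (simp add: scaleR_right_diff_distrib of_real_def)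
qed (simp add: x cpositive_sa self_adjoint_scaleR)

lemma cpositive_square:
  assumes x: "self_adjoint (x::'a::cstar_algebra)" shows "cpositive (x * x)"
  unfolding cpositive_def
proof (intro conjI subsetI)
  show "self_adjoint (x * x)" using x by (simp add: self_adjoint_mult)
  fix t assume t: "t \<in> real_spectrum (x * x)"
  show "t \<in> {0..}"
    using t cinvertible_square_plus[OF x, of "- t"] by (force simp: real_spectrum_def)
qed

lemma cpositive_cfc:
  assumes f: "cfc_dom f x" and pos: "\<And>t. t \<in> real_spectrum x \<Longrightarrow> f t \<ge> 0"
  shows "cpositive (cfc f x)"
proof -
  obtain K where K: "\<And>t. t \<in> real_spectrum x \<Longrightarrow> \<bar>f t\<bar> \<le> K" using cfc_dom_bounded[OF f] by blast
  have x: "self_adjoint x" using f by (simp add: cfc_dom_def)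
  have c: "cfc_dom (\<lambda>t. K) x" using x by (auto intro: cfc_dom_everywhere)
  have "norm (cfc (\<lambda>t. K - f t) x) \<le> K"
  proof (rule norm_cfc_le[OF cfc_diff(2)[OF c f]])
    fix t assume t: "t \<in> real_spectrum x"
    show "\<bar>K - f t\<bar> \<le> K" using K[OF t] pos[OF t] by linarith
  qed
  then show ?thesis
    by (intro cpositiveI_norm[where K = K] self_adjoint_cfc f) (simp add: cfc_diff[OF c f] cfc_const x)
qed

lemma cfc_sqrt:
  assumes x: "cpositive (x::'a::cstar_algebra)"
  shows "self_adjoint (cfc sqrt x)" "cfc sqrt x * cfc sqrt x = x"
proof -
  have d: "cfc_dom sqrt x"
    by (intro cfc_dom_everywhere cpositive_sa[OF x] continuous_intros)
  show "self_adjoint (cfc sqrt x)" by (rule self_adjoint_cfc[OF d])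
  have "cfc sqrt x * cfc sqrt x = cfc (\<lambda>t. t) x"
    unfolding cfc_mult[OF d d, symmetric] by (rule cfc_cong) (use x in \<open>auto simp: cpositive_def\<close>)
  then show "cfc sqrt x * cfc sqrt x = x" by (simp add: cfc_ident cpositive_sa[OF x])
qed

lemma real_spectrum_shift: "t \<in> real_spectrum (x - of_real e) \<longleftrightarrow> t + e \<in> real_spectrum (x::'a::cstar_algebra)"
  by (simp add: real_spectrum_def algebra_simps)

text \<open>With y the inverse of x, x - t = x (1 - t y) is invertible as long as 0 \<le> t and t
  times the norm of y is below 1; this is the origin of \<open>e\<close>. A uniform lower bound is
  visibly preserved when a positive element is added.\<close>

lemma pos_inv_iff: "x \<in> pos_inv \<longleftrightarrow> (\<exists>e>0. cpositive (x - of_real e :: 'a::cstar_algebra))"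
proof
  assume "x \<in> pos_inv"
  then have pos: "cpositive x" and "cinvertible x" by (auto simp: pos_inv_def)
  then obtain y where y: "x * y = 1" "y * x = 1" by (auto simp: cinvertible_def)
  define e where "e = 1 / norm y"
  have "y \<noteq> 0" using y by auto
  then have e: "e > 0" by (simp add: e_def)
  have "t \<ge> e" if t: "t \<in> real_spectrum x" for t
  proof (rule ccontr)
    assume "\<not> t \<ge> e"
    then have "t * norm y < 1" using \<open>y \<noteq> 0\<close> by (simp add: e_def field_simps)
    moreover have "t \<ge> 0" using t pos by (auto simp: cpositive_def)
    ultimately have "cinvertible (of_real 1 - t *\<^sub>R y)"
      by (intro cinvertible_const_minus) simp
    then have "cinvertible (x * (of_real 1 - t *\<^sub>R y))"
      using \<open>cinvertible x\<close> by (rule cinvertible_mult[rotated])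
    also have "x * (of_real 1 - t *\<^sub>R y) = x - of_real t"
      by (simp add: right_diff_distrib y of_real_def)
    finally show False using t by (simp add: real_spectrum_def)
  qed
  then have "cpositive (x - of_real e)"
    using pos by (force simp: cpositive_def self_adjoint_diff real_spectrum_shift)
  then show "\<exists>e>0. cpositive (x - of_real e)" using e by blast
next
  assume "\<exists>e>0. cpositive (x - of_real e)"
  then obtain e where e: "e > 0" "cpositive (x - of_real e)" by blast
  have ge: "t \<ge> e" if "t \<in> real_spectrum x" for t
    using e(2) that real_spectrum_shift[of "t - e" x e] by (auto simp: cpositive_def)
  have "self_adjoint (x - of_real e + of_real e)"
    by (intro self_adjoint_add cpositive_sa[OF e(2)]) simp
  then have "cpositive x" using ge e(1) by (force simp: cpositive_def)
  moreover have "0 \<notin> real_spectrum x" using ge[of 0] e(1) by auto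
  ultimately show "x \<in> pos_inv" by (auto simp: pos_inv_def real_spectrum_def)
qed

lemma pos_inv_spectrum:
  assumes "x \<in> pos_inv"
  obtains e K where "0 < e" "e < K" "real_spectrum (x::'a::cstar_algebra) \<subseteq> {e..K}"
proof -
  obtain e where e: "e > 0" "cpositive (x - of_real e)" using assms pos_inv_iff by blast
  have "t \<ge> e" if "t \<in> real_spectrum x" for t
    using e(2) that real_spectrum_shift[of "t - e" x e] by (auto simp: cpositive_def)
  then have "real_spectrum x \<subseteq> {e..norm x + e + 1}"
    using e(1) by (force dest: real_spectrum_bounded)
  then show ?thesis using that[of e "norm x + e + 1"] e(1) norm_ge_zero[of x] by linarith
qed

lemma pos_inv_sa: "x \<in> pos_inv \<Longrightarrow> self_adjoint x"
  by (simp add: pos_inv_def cpositive_def)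

lemma pos_inv_add: "cpositive x \<Longrightarrow> y \<in> pos_inv \<Longrightarrow> x + y \<in> pos_inv"
  unfolding pos_inv_iff by (metis add_diff_eq cpositive_add)

lemma pos_inv_scaleR: "c > 0 \<Longrightarrow> y \<in> pos_inv \<Longrightarrow> c *\<^sub>R y \<in> pos_inv"
proof -
  assume c: "c > 0" and "y \<in> pos_inv"
  then obtain e where e: "e > 0" "cpositive (y - of_real e)" using pos_inv_iff by blast
  from cpositive_scaleR[OF this(2), of c] c have "cpositive (c *\<^sub>R y - of_real (c * e))"
    by (simp add: scaleR_right_diff_distrib of_real_def)
  then show ?thesis using c e unfolding pos_inv_iff by (intro exI[of _ "c * e"]) simp
qed

lemma pos_inv_cpositive: "x \<in> pos_inv \<Longrightarrow> cpositive x"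
  by (simp add: pos_inv_def)

lemma cpositive_of_real: "c \<ge> 0 \<Longrightarrow> cpositive (of_real c)"
  by (rule cpositiveI_norm[where K = c]) auto

lemma pos_inv_shift: "x \<in> pos_inv \<Longrightarrow> s \<ge> 0 \<Longrightarrow> x + of_real s \<in> pos_inv"
  using pos_inv_add[OF cpositive_of_real, of s x] by (simp add: add.commute)

lemma pos_inv_convex_comb:
  assumes "x \<in> pos_inv" "y \<in> pos_inv" "u \<ge> 0" "v \<ge> 0" "u + v = (1::real)"
  shows "u *\<^sub>R x + v *\<^sub>R y \<in> pos_inv"
proof (cases "v = 0")
  case False
  then show ?thesis using assms
    by (intro pos_inv_add cpositive_scaleR pos_inv_scaleR pos_inv_cpositive) auto
qed (use assms in auto)

lemma convex_pos_inv: "convex (pos_inv :: 'a::cstar_algebra set)"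
  unfolding convex_def using pos_inv_convex_comb by blast

lemma pos_inv_cfc_dom: "x \<in> pos_inv \<Longrightarrow> continuous_on {0<..} f \<Longrightarrow> cfc_dom f x"
  by (rule pos_inv_spectrum[of x], assumption, rule cfc_domI)
    (auto intro: pos_inv_sa continuous_on_subset)

lemma pos_inv_spec_pos: "x \<in> pos_inv \<Longrightarrow> t \<in> real_spectrum x \<Longrightarrow> t > 0"
  by (erule pos_inv_spectrum) force

text \<open>The inverse as a value of the functional calculus, so that positivity and Bernstein
  approximation apply to it.\<close>

definition inv_el :: "'a::cstar_algebra \<Rightarrow> 'a" where "inv_el x = cfc (\<lambda>t. 1 / t) x"

lemma cfc_inverse:
  assumes x: "x \<in> pos_inv" and f: "continuous_on {0<..} f" "\<And>t. t > 0 \<Longrightarrow> f t > 0"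
  shows "cfc f x * cfc (\<lambda>t. 1 / f t) x = 1" "cfc (\<lambda>t. 1 / f t) x * cfc f x = 1"
proof -
  have d: "cfc_dom f x" "cfc_dom (\<lambda>t. 1 / f t) x"
    using f(2) by (intro pos_inv_cfc_dom x f(1) continuous_intros; force)+
  have "cfc (\<lambda>t. f t * (1 / f t)) x = cfc (\<lambda>t. 1) x" "cfc (\<lambda>t. 1 / f t * f t) x = cfc (\<lambda>t. 1) x"
    by (rule cfc_cong; use f(2)[OF pos_inv_spec_pos[OF x]] in force)+
  then show "cfc f x * cfc (\<lambda>t. 1 / f t) x = 1" "cfc (\<lambda>t. 1 / f t) x * cfc f x = 1"
    by (simp_all only: cfc_mult[OF d] cfc_mult[OF d(2,1)] cfc_const[OF pos_inv_sa[OF x]] of_real_1)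
qed

lemma inv_el: 
  assumes "x \<in> pos_inv" shows "x * inv_el x = 1" "inv_el x * x = 1"
  using cfc_inverse[OF assms continuous_on_id] unfolding inv_el_def id_def
  by (simp_all add: cfc_ident pos_inv_sa[OF assms])

lemma inverse_unique_right: "x * y = 1 \<Longrightarrow> z * x = 1 \<Longrightarrow> y = (z::'a::monoid_mult)"
  by (metis mult.assoc mult.left_neutral mult.right_neutral)

lemma cfc_affine: "self_adjoint x \<Longrightarrow> cfc (\<lambda>t. a + b * t) x = of_real a + b *\<^sub>R x"
  using cfc_poly[of x "[:a, b:]"] by (simp add: poly_pCons[abs_def] poly_eval_pCons of_real_def mult.commute)

lemma pos_inv_inv_el: assumes "x \<in> pos_inv" shows "inv_el x \<in> pos_inv"
proof -
  have "cpositive (inv_el x)" unfolding inv_el_def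
    by (intro cpositive_cfc pos_inv_cfc_dom assms continuous_intros)
      (auto dest: pos_inv_spec_pos[OF assms])
  then show ?thesis using inv_el[OF assms] by (auto simp: pos_inv_def cinvertible_def)
qed

text \<open>For t < 0 the element W - t R^2 is positive and invertible, and conjugating it by S
  gives S W S - t, which is therefore invertible.\<close>

lemma cpositive_conj:
  fixes S :: "'a::cstar_algebra"
  assumes S: "self_adjoint S" and R: "S * R = 1" "R * S = 1" and W: "cpositive W"
  shows "cpositive (S * W * S)"
  unfolding cpositive_def
proof (intro conjI subsetI)
  show "self_adjoint (S * W * S)" by (intro self_adjoint_conj S cpositive_sa W)
  fix t assume t: "t \<in> real_spectrum (S * W * S)"
  show "t \<in> {0..}"
  proof (rule ccontr)
    assume "t \<notin> {0..}"
    then have "- t > 0" by simp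
    have R': "self_adjoint R" by (rule self_adjoint_inverse[OF S R])
    have inv: "cinvertible S" "cinvertible R" using R by (auto simp: cinvertible_def)
    then have "R * R \<in> pos_inv" by (simp add: pos_inv_def cpositive_square R' cinvertible_mult)
    then have "W + (- t) *\<^sub>R (R * R) \<in> pos_inv" by (intro pos_inv_add W pos_inv_scaleR \<open>- t > 0\<close>)
    then have "cinvertible (S * (W + (- t) *\<^sub>R (R * R)) * S)"
      by (intro cinvertible_mult inv) (simp add: pos_inv_def)
    also have "S * (W + (- t) *\<^sub>R (R * R)) * S = S * W * S + (- t) *\<^sub>R ((S * R) * (R * S))"
      by (simp only: distrib_left distrib_right mult_scaleR_left mult_scaleR_right mult.assoc)
    finally show False using t by (simp add: R real_spectrum_def of_real_def)
  qed
qed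

lemma pos_inv_conj:
  assumes "self_adjoint S" "S * R = 1" "R * S = 1" "W \<in> pos_inv"
  shows "S * W * S \<in> pos_inv"
  using assms cpositive_conj[OF assms(1-3)] unfolding pos_inv_def
  by (auto intro!: cinvertible_mult) (auto simp: cinvertible_def)

section \<open>Bilinear forms positive on pairs of positive elements\<close>

text \<open>This isolates what the convexity argument uses of \<tau>, \<Phi> and \<Psi>. The form is
  only real bilinear, since all elements fed into it are self-adjoint.\<close>

definition positive_form :: "('a::cstar_algebra \<Rightarrow> 'b::cstar_algebra \<Rightarrow> real) \<Rightarrow> bool" where
  "positive_form B \<longleftrightarrow>
     (\<forall>p p' q. B (p + p') q = B p q + B p' q) \<and> (\<forall>p q q'. B p (q + q') = B p q + B p q') \<and>
     (\<forall>r p q. B (r *\<^sub>R p) q = r * B p q) \<and> (\<forall>r p q. B p (r *\<^sub>R q) = r * B p q) \<and>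
     (\<forall>p q. cpositive p \<longrightarrow> cpositive q \<longrightarrow> B p q \<ge> 0)"

lemma positive_formD:
  assumes "positive_form B"
  shows "B (p + p') q = B p q + B p' q" "B p (q + q') = B p q + B p q'"
    "B (r *\<^sub>R p) q = r * B p q" "B p (r *\<^sub>R q) = r * B p q"
    "cpositive p \<Longrightarrow> cpositive q \<Longrightarrow> B p q \<ge> 0"
  using assms by (auto simp: positive_form_def)

lemma positive_form_diff:
  assumes B: "positive_form B"
  shows "B (p - p') q = B p q - B p' q" "B p (q - q') = B p q - B p q'"
  using positive_formD(1)[OF B, of "p - p'" p' q] positive_formD(2)[OF B, of p "q - q'" q'] by simp_all

lemma positive_form_sum:
  assumes B: "positive_form B"
  shows "B (\<Sum>i\<in>I. g i) q = (\<Sum>i\<in>I. B (g i) q)" "B p (\<Sum>i\<in>I. h i) = (\<Sum>i\<in>I. B p (h i))"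
proof -
  have 0: "B 0 q = 0" "B p 0 = 0"
    using positive_formD(3)[OF B, of 0 0 q] positive_formD(4)[OF B, of p 0 0] by simp_all
  show "B (\<Sum>i\<in>I. g i) q = (\<Sum>i\<in>I. B (g i) q)" 
    by (induction I rule: infinite_finite_induct) (simp_all add: 0 positive_formD(1)[OF B])
  show "B p (\<Sum>i\<in>I. h i) = (\<Sum>i\<in>I. B p (h i))"
    by (induction I rule: infinite_finite_induct) (simp_all add: 0 positive_formD(2)[OF B])
qed

lemma cpositive_norm_minus:
  assumes "self_adjoint (p::'a::cstar_algebra)"
  shows "cpositive (of_real (norm p) - p)" "cpositive (of_real (norm p) + p)"
  by (rule cpositiveI_norm[where K = "norm p"], use assms in \<open>simp_all add: self_adjoint_diff self_adjoint_add\<close>)+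

text \<open>Write |p| for the norm. Adding the values of B at (|p| - p, |q| + q) and (|p| + p, |q| -
  q) leaves 2 |p| |q| B(1,1) - 2 B(p,q); equal signs give the other bound. Positivity alone thus
  makes the form continuous on self-adjoint elements.\<close>

lemma positive_form_bound:
  assumes B: "positive_form B" and p: "self_adjoint p" and q: "self_adjoint q"
  shows "\<bar>B p q\<bar> \<le> norm p * norm q * B 1 1"
proof -
  note D = positive_formD[OF B] positive_form_diff[OF B]
  note P = cpositive_norm_minus[OF p] and Q = cpositive_norm_minus[OF q]
  have "B (of_real (norm p) - p) (of_real (norm q) + q) \<ge> 0" "B (of_real (norm p) + p) (of_real (norm q) - q) \<ge> 0"
    "B (of_real (norm p) - p) (of_real (norm q) - q) \<ge> 0" "B (of_real (norm p) + p) (of_real (norm q) + q) \<ge> 0"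
    by (intro D(5) P Q)+
  then show ?thesis by (simp add: D(1-4,6,7) of_real_def algebra_simps abs_le_iff)
qed

lemma positive_form_tendsto:
  assumes B: "positive_form B" and sa: "\<And>n. self_adjoint (p n)" "\<And>n. self_adjoint (q n)"
    and lim: "p \<longlonglongrightarrow> p0" "q \<longlonglongrightarrow> q0"
  shows "(\<lambda>n. B (p n) (q n)) \<longlonglongrightarrow> B p0 q0"
proof -
  have sa0: "self_adjoint p0" "self_adjoint q0"
    using self_adjoint_lim[OF lim(1) sa(1)] self_adjoint_lim[OF lim(2) sa(2)] by auto
  have eq: "B (p n) (q n) - B p0 q0 = B (p n - p0) (q n) + B p0 (q n - q0)" for n
    by (simp add: positive_form_diff[OF B])
  have "\<bar>B (p n) (q n) - B p0 q0\<bar> \<le> norm (p n - p0) * norm (q n) * B 1 1 + norm p0 * norm (q n - q0) * B 1 1" for n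
    unfolding eq
    using positive_form_bound[OF B, of "p n - p0" "q n"] positive_form_bound[OF B, of p0 "q n - q0"] sa sa0
    by (auto simp: self_adjoint_diff intro: order.trans[OF abs_triangle_ineq])
  then have bd: "\<forall>\<^sub>F n in sequentially. norm (B (p n) (q n) - B p0 q0) \<le>
      norm (p n - p0) * norm (q n) * B 1 1 + norm p0 * norm (q n - q0) * B 1 1" by simp
  have "(\<lambda>n. norm (p n - p0) * norm (q n) * B 1 1 + norm p0 * norm (q n - q0) * B 1 1) \<longlonglongrightarrow>
      norm (p0 - p0) * norm q0 * B 1 1 + norm p0 * norm (q0 - q0) * B 1 1"
    by (intro tendsto_intros lim)
  then have "(\<lambda>n. norm (p n - p0) * norm (q n) * B 1 1 + norm p0 * norm (q n - q0) * B 1 1) \<longlonglongrightarrow> 0" by simp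
  then have "(\<lambda>n. B (p n) (q n) - B p0 q0) \<longlonglongrightarrow> 0"
    by (rule Lim_null_comparison[OF bd])
  then show ?thesis by (simp add: LIM_zero_iff)
qed

section \<open>Joint convexity for pairs of inverses\<close>

definition bern_poly :: "real \<Rightarrow> real \<Rightarrow> nat \<Rightarrow> nat \<Rightarrow> real poly" where
  "bern_poly a b n k = of_nat (n choose k) * [:- a / (b - a), 1 / (b - a):] ^ k *
     (1 - [:- a / (b - a), 1 / (b - a):]) ^ (n - k)"

lemma poly_bern_poly: "poly (bern_poly a b n k) t = Bernstein n k ((t - a) / (b - a))"
  by (simp add: bern_poly_def Bernstein_def diff_divide_distrib)

lemma bern_poly_nonneg:
  assumes "a < b" "t \<in> {a..b}" shows "poly (bern_poly a b n k) t \<ge> 0"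
  unfolding poly_bern_poly by (rule Bernstein_nonneg) (use assms in \<open>auto simp: divide_simps\<close>)

text \<open>The function g enters only through scalar samples, while the elements they multiply
  depend on x alone. The same elements therefore serve all functions compared in one
  inequality.\<close>

lemma cfc_bernstein:
  fixes x :: "'a::cstar_algebra"
  assumes x: "self_adjoint x" and ab: "a < b" "real_spectrum x \<subseteq> {a..b}" and g: "continuous_on {a..b} g"
  shows "(\<lambda>n. \<Sum>k\<le>n. g (a + (b - a) * (real k / real n)) *\<^sub>R poly_eval (bern_poly a b n k) x) \<longlonglongrightarrow> cfc g x"
proof -
  define P where "P n = (\<Sum>k\<le>n. Polynomial.smult (g (a + (b - a) * (real k / real n))) (bern_poly a b n k))" for n
  have d: "cfc_dom g x" by (rule cfc_domI[OF x ab(2) g])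
  have "(\<lambda>n. poly_eval (P n) x) \<longlonglongrightarrow> cfc g x"
  proof (rule metric_LIMSEQ_I)
    fix e :: real assume "e > 0"
    from cfc_limit[OF d this] obtain c where c: "c > 0"
      "\<And>p. \<forall>t\<in>real_spectrum x. \<bar>poly p t - g t\<bar> < c \<Longrightarrow> norm (poly_eval p x - cfc g x) < e" by blast
    define h where "h s = g (a + (b - a) * s)" for s
    have "continuous_on {0..1} h"
      unfolding h_def
    proof (rule continuous_on_compose2[OF g])
      show "(\<lambda>s. a + (b - a) * s) ` {0..1} \<subseteq> {a..b}"
      proof clarify
        fix s :: real assume "s \<in> {0..1}"
        then have "0 \<le> (b - a) * s" "(b - a) * s \<le> (b - a) * 1"
          using ab(1) by (auto intro!: mult_nonneg_nonneg mult_left_mono)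
        then show "a + (b - a) * s \<in> {a..b}" by simp
      qed
    qed (intro continuous_intros)
    from Bernstein_Weierstrass[OF this c(1)] obtain N where
      N: "\<And>n s. N \<le> n \<Longrightarrow> s \<in> {0..1} \<Longrightarrow> \<bar>h s - (\<Sum>k\<le>n. h (real k / real n) * Bernstein n k s)\<bar> < c" by blast
    have "norm (poly_eval (P n) x - cfc g x) < e" if n: "N \<le> n" for n
    proof (rule c(2), intro ballI)
      fix t assume "t \<in> real_spectrum x"
      then have "t \<in> {a..b}" using ab(2) by blast
      then have s: "(t - a) / (b - a) \<in> {0..1}" using ab(1) by (auto simp: divide_simps)
      have "h ((t - a) / (b - a)) = g t" using ab(1) by (simp add: h_def)
      then show "\<bar>poly (P n) t - g t\<bar> < c"
        using N[OF n s] by (simp add: P_def poly_sum poly_bern_poly h_def abs_minus_commute)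
    qed
    then show "\<exists>N. \<forall>n\<ge>N. dist (poly_eval (P n) x) (cfc g x) < e" by (auto simp: dist_norm)
  qed
  then show ?thesis by (simp add: P_def poly_eval_sum poly_eval_smult)
qed

text \<open>With \<open>r\<^sup>2 = z w\<close>, the difference of the two sides is bounded below by
  \<open>\<mu> \<lambda> (r - 1)\<^sup>2 (\<lambda> r\<^sup>2 + 2 r + \<mu>)\<close> after clearing denominators.\<close>
lemma harmonic_ineq:
  fixes z w u v :: real
  assumes zw: "z > 0" "w > 0" and uv: "u \<ge> 0" "v \<ge> 0" "u + v = 1"
  shows "1 / (u + v * z) * (1 / (u + v * w)) \<le> u + v * (1 / z * (1 / w))"
proof -
  have pos: "u + v * z > 0" "u + v * w > 0"
    using zw uv by (metis add_nonneg_eq_0_iff add_pos_nonneg add_nonneg_pos le_less mult_nonneg_nonneg mult_pos_pos add.right_neutral zero_neq_one)+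
  define r where "r = sqrt (z * w)"
  have r: "r \<ge> 0" "r * r = z * w" using zw by (auto simp: r_def)
  \<comment> \<open>By the arithmetic-geometric mean, replacing both z and w by r only decreases the
    product of the affine factors. What remains is the case z = w = r.\<close>
  have "2 * r \<le> z + w"
    using arith_geo_mean_sqrt[of z w] zw by (simp add: r_def)
  then have "u * v * (2 * r) \<le> u * v * (z + w)" using uv by (intro mult_left_mono) auto
  moreover have "(u + v * r) * (u + v * r) = u * u + u * v * (2 * r) + v * v * (r * r)"
    "(u + v * z) * (u + v * w) = u * u + u * v * (z + w) + v * v * (z * w)"
    by (simp_all add: algebra_simps)
  ultimately have le: "(u + v * r) * (u + v * r) \<le> (u + v * z) * (u + v * w)"
    by (simp add: r(2))
  have u: "u = 1 - v" using uv by simp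
  have "0 \<le> u * v * ((r - 1)\<^sup>2 * (v * r\<^sup>2 + 2 * r + u))"
    using uv r(1) by (intro mult_nonneg_nonneg add_nonneg_nonneg) auto
  also have "\<dots> = (u * r\<^sup>2 + v) * ((u + v * r) * (u + v * r)) - r\<^sup>2"
    unfolding u by (simp add: algebra_simps power2_eq_square)
  finally have "r\<^sup>2 \<le> (u * r\<^sup>2 + v) * ((u + v * r) * (u + v * r))" by simp
  also have "\<dots> \<le> (u * r\<^sup>2 + v) * ((u + v * z) * (u + v * w))"
    using uv by (intro mult_left_mono le) auto
  finally have "z * w \<le> (u * (z * w) + v) * ((u + v * z) * (u + v * w))"
    using r(2) by (simp add: power2_eq_square)
  then show ?thesis using pos zw by (simp add: divide_simps mult_ac)
qed

text \<open>Expanded along Bernstein elements, both sides are double sums over the sample points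
  with the common weights B(e, f) \<ge> 0, so \<open>harmonic_ineq\<close> applies term by term and
  survives the limit.\<close>

lemma positive_form_harmonic:
  fixes B :: "'a::cstar_algebra \<Rightarrow> 'b::cstar_algebra \<Rightarrow> real"
  assumes B: "positive_form B" and Z: "Z \<in> pos_inv" and W: "W \<in> pos_inv"
    and uv: "u \<ge> 0" "v \<ge> 0" "u + v = 1"
  shows "B (cfc (\<lambda>t. 1 / (u + v * t)) Z) (cfc (\<lambda>t. 1 / (u + v * t)) W) \<le> u * B 1 1 + v * B (inv_el Z) (inv_el W)"
proof -
  obtain a b where ab: "0 < a" "a < b" "real_spectrum Z \<subseteq> {a..b}" using pos_inv_spectrum[OF Z] by blast
  obtain c d where cd: "0 < c" "c < d" "real_spectrum W \<subseteq> {c..d}" using pos_inv_spectrum[OF W] by blast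
  note sa = pos_inv_sa[OF Z] pos_inv_sa[OF W]
  define z where "z n k = a + (b - a) * (real k / real n)" for n k :: nat
  define w where "w n k = c + (d - c) * (real k / real n)" for n k :: nat
  have zpos: "z n k > 0" and wpos: "w n k > 0" for n k
    using ab cd by (auto simp: z_def w_def intro!: add_pos_nonneg)
  define e where "e n k = poly_eval (bern_poly a b n k) Z" for n k
  define f where "f n k = poly_eval (bern_poly c d n k) W" for n k
  have e: "cpositive (e n k)" for n k
    unfolding e_def cfc_poly[OF sa(1), symmetric]
    by (intro cpositive_cfc cfc_dom_everywhere sa continuous_intros bern_poly_nonneg) (use ab in auto)
  have f: "cpositive (f n k)" for n k
    unfolding f_def cfc_poly[OF sa(2), symmetric]
    by (intro cpositive_cfc cfc_dom_everywhere sa continuous_intros bern_poly_nonneg) (use cd in auto)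
  have lim: "(\<lambda>n. B (\<Sum>k\<le>n. g (z n k) *\<^sub>R e n k) (\<Sum>k\<le>n. g (w n k) *\<^sub>R f n k)) \<longlonglongrightarrow> B (cfc g Z) (cfc g W)"
    if "continuous_on {0<..} g" for g
  proof (rule positive_form_tendsto[OF B])
    show "(\<lambda>n. \<Sum>k\<le>n. g (z n k) *\<^sub>R e n k) \<longlonglongrightarrow> cfc g Z" "(\<lambda>n. \<Sum>k\<le>n. g (w n k) *\<^sub>R f n k) \<longlonglongrightarrow> cfc g W"
      unfolding e_def f_def z_def w_def
      by (intro cfc_bernstein sa ab cd continuous_on_subset[OF that]; use ab cd in auto)+
  qed (intro self_adjoint_sum self_adjoint_scaleR cpositive_sa[OF e] cpositive_sa[OF f])+
  have expand: "B (\<Sum>k\<le>n. g (z n k) *\<^sub>R e n k) (\<Sum>k\<le>n. g (w n k) *\<^sub>R f n k) =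
      (\<Sum>k\<le>n. \<Sum>l\<le>n. g (z n k) * g (w n l) * B (e n k) (f n l))" for g n
    by (simp add: positive_form_sum[OF B] positive_formD[OF B] sum_distrib_left)
      (subst sum.swap, simp add: mult_ac)
  let ?h = "\<lambda>t. 1 / (u + v * t)"
  have hpos: "u + v * t > 0" if "t > 0" for t
    using uv that by (metis add_nonneg_eq_0_iff add_pos_nonneg add_nonneg_pos le_less mult_nonneg_nonneg mult_pos_pos add.right_neutral zero_neq_one)
  have h: "continuous_on {0<..} ?h" using hpos by (intro continuous_intros) force
  have i: "continuous_on {0<..} (\<lambda>t::real. 1 / t)" by (intro continuous_intros) auto
  have "B (cfc ?h Z) (cfc ?h W) \<le> u * B (cfc (\<lambda>t. 1) Z) (cfc (\<lambda>t. 1) W) + v * B (cfc (\<lambda>t. 1 / t) Z) (cfc (\<lambda>t. 1 / t) W)"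
  proof (rule LIMSEQ_le[OF lim[OF h]])
    show "(\<lambda>n. u * B (\<Sum>k\<le>n. 1 *\<^sub>R e n k) (\<Sum>k\<le>n. 1 *\<^sub>R f n k) +
        v * B (\<Sum>k\<le>n. (1 / z n k) *\<^sub>R e n k) (\<Sum>k\<le>n. (1 / w n k) *\<^sub>R f n k))
      \<longlonglongrightarrow> u * B (cfc (\<lambda>t. 1) Z) (cfc (\<lambda>t. 1) W) + v * B (cfc (\<lambda>t. 1 / t) Z) (cfc (\<lambda>t. 1 / t) W)"
      by (intro tendsto_add tendsto_mult tendsto_const lim i continuous_intros)
    have "(\<Sum>k\<le>n. \<Sum>l\<le>n. ?h (z n k) * ?h (w n l) * B (e n k) (f n l)) \<le>
      (\<Sum>k\<le>n. \<Sum>l\<le>n. (u + v * (1 / z n k * (1 / w n l))) * B (e n k) (f n l))" for n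
      by (intro sum_mono mult_right_mono harmonic_ineq zpos wpos uv positive_formD(5)[OF B] e f)
    also have "\<And>n. (\<Sum>k\<le>n. \<Sum>l\<le>n. (u + v * (1 / z n k * (1 / w n l))) * B (e n k) (f n l)) =
        u * (\<Sum>k\<le>n. \<Sum>l\<le>n. 1 * 1 * B (e n k) (f n l)) + v * (\<Sum>k\<le>n. \<Sum>l\<le>n. 1 / z n k * (1 / w n l) * B (e n k) (f n l))"
      by (simp add: sum_distrib_left sum.distrib distrib_right mult.assoc)
    finally show "\<exists>N. \<forall>n\<ge>N. B (\<Sum>k\<le>n. ?h (z n k) *\<^sub>R e n k) (\<Sum>k\<le>n. ?h (w n k) *\<^sub>R f n k) \<le>
        u * B (\<Sum>k\<le>n. 1 *\<^sub>R e n k) (\<Sum>k\<le>n. 1 *\<^sub>R f n k) +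
        v * B (\<Sum>k\<le>n. (1 / z n k) *\<^sub>R e n k) (\<Sum>k\<le>n. (1 / w n k) *\<^sub>R f n k)"
      unfolding expand[of ?h] expand[of "\<lambda>t. 1"] expand[of "\<lambda>t. 1 / t"] by blast
  qed
  then show ?thesis by (simp add: inv_el_def cfc_const sa)
qed

lemma affine_pos:
  fixes u v t :: real
  assumes "u \<ge> 0" "v \<ge> 0" "u + v = 1" "t > 0" shows "u + v * t > 0"
  using assms by (cases "v = 0") (auto intro: add_nonneg_pos)

text \<open>Two positive invertible elements are simultaneously transformed: \<open>S\<close> is the square root of
  \<open>x\<^sup>-\<^sup>1\<close> and \<open>Z = S y S\<close>, so that both inverses and that of any convex combination become
  functions of the single element \<open>Z\<close>.\<close>
lemma simultaneous_inverse:
  fixes x y :: "'a::cstar_algebra"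
  assumes x: "x \<in> pos_inv" and y: "y \<in> pos_inv"
  obtains S R Z where "self_adjoint S" "S * R = 1" "R * S = 1" "Z \<in> pos_inv"
    "inv_el x = S * S" "inv_el y = S * inv_el Z * S"
    "\<And>u v. u \<ge> 0 \<Longrightarrow> v \<ge> 0 \<Longrightarrow> u + v = 1 \<Longrightarrow>
      inv_el (u *\<^sub>R x + v *\<^sub>R y) = S * cfc (\<lambda>t. 1 / (u + v * t)) Z * S"
proof -
  define S where "S = cfc sqrt (inv_el x)"
  have S: "self_adjoint S" "S * S = inv_el x"
    using cfc_sqrt[OF pos_inv_cpositive[OF pos_inv_inv_el[OF x]]] by (auto simp: S_def)
  define R where "R = S * x"
  have SR: "S * R = 1" using inv_el[OF x] by (simp add: R_def mult.assoc[symmetric] S)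
  have "x * S * S = 1" using inv_el[OF x] by (simp add: mult.assoc S)
  then have "R = x * S" using SR inverse_unique_right by blast
  then have RS: "R * S = 1" using \<open>x * S * S = 1\<close> by simp
  define Z where "Z = S * y * S"
  have Z: "Z \<in> pos_inv" unfolding Z_def by (rule pos_inv_conj[OF S(1) SR RS y])
  have RR: "R * R = x" 
    using SR RS S(2) inv_el[OF x] \<open>R = x * S\<close> by (metis R_def mult.assoc mult.right_neutral)
  have RZR: "R * Z * R = y"
    unfolding Z_def using SR RS by (metis mult.assoc mult.left_neutral mult.right_neutral)
  have inv: "inv_el (u *\<^sub>R x + v *\<^sub>R y) = S * cfc (\<lambda>t. 1 / (u + v * t)) Z * S"
    if uv: "u \<ge> 0" "v \<ge> 0" "u + v = 1" for u v
  proof -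
    let ?w = "u *\<^sub>R x + v *\<^sub>R y" and ?c = "cfc (\<lambda>t. 1 / (u + v * t)) Z"
    have w: "?w \<in> pos_inv" by (rule pos_inv_convex_comb[OF x y uv])
    have "continuous_on {0<..} (\<lambda>t. u + v * t)" by (intro continuous_intros)
    from cfc_inverse(2)[OF Z this affine_pos[OF uv]]
    have c: "?c * (of_real u + v *\<^sub>R Z) = 1" by (simp add: cfc_affine pos_inv_sa[OF Z])
    have "?w = R * (of_real u + v *\<^sub>R Z) * R"
      by (simp add: distrib_left distrib_right of_real_def RR RZR)
    then have "S * ?c * S * ?w = S * ?c * (S * R) * (of_real u + v *\<^sub>R Z) * R"
      by (simp only: mult.assoc)
    also have "\<dots> = S * (?c * (of_real u + v *\<^sub>R Z)) * R"
      by (simp only: SR mult.assoc mult.right_neutral mult.left_neutral)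
    finally have "S * ?c * S * ?w = 1" by (simp add: c SR)
    then show ?thesis by (rule inverse_unique_right[OF inv_el(1)[OF w]])
  qed
  show ?thesis
  proof (rule that[OF S(1) SR RS Z S(2)[symmetric] _ inv])
    show "inv_el y = S * inv_el Z * S"
      using inv[of 0 1] by (simp add: inv_el_def)
  qed
qed

lemma positive_form_conj:
  assumes B: "positive_form B"
    and S: "self_adjoint S" "S * R = 1" "R * S = 1"
    and T: "self_adjoint T" "T * Q = 1" "Q * T = 1"
  shows "positive_form (\<lambda>p q. B (S * p * S) (T * q * T))"
  unfolding positive_form_def
  by (simp add: distrib_left distrib_right positive_formD[OF B] cpositive_conj[OF S] cpositive_conj[OF T])

lemma positive_form_inverse_convex:
  assumes B: "positive_form B"
    and x: "x0 \<in> pos_inv" "x1 \<in> pos_inv" and y: "y0 \<in> pos_inv" "y1 \<in> pos_inv"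
    and uv: "u \<ge> 0" "v \<ge> 0" "u + v = 1"
  shows "B (inv_el (u *\<^sub>R x0 + v *\<^sub>R x1)) (inv_el (u *\<^sub>R y0 + v *\<^sub>R y1)) \<le>
    u * B (inv_el x0) (inv_el y0) + v * B (inv_el x1) (inv_el y1)"
proof -
  obtain S R Z where S: "self_adjoint S" "S * R = 1" "R * S = 1" and Z: "Z \<in> pos_inv"
    "inv_el x0 = S * S" "inv_el x1 = S * inv_el Z * S"
    "inv_el (u *\<^sub>R x0 + v *\<^sub>R x1) = S * cfc (\<lambda>t. 1 / (u + v * t)) Z * S"
    using simultaneous_inverse[OF x] uv by metis
  obtain T Q W where T: "self_adjoint T" "T * Q = 1" "Q * T = 1" and W: "W \<in> pos_inv"
    "inv_el y0 = T * T" "inv_el y1 = T * inv_el W * T"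
    "inv_el (u *\<^sub>R y0 + v *\<^sub>R y1) = T * cfc (\<lambda>t. 1 / (u + v * t)) W * T"
    using simultaneous_inverse[OF y] uv by metis
  show ?thesis
    using positive_form_harmonic[OF positive_form_conj[OF B S T] Z(1) W(1) uv]
    by (simp add: Z W)
qed

section \<open>Stieltjes sums of elements and passage to the limit\<close>

text \<open>A discrete form of the integral of 1 / (t + s) against a measure in s that represents f
  in Loewner's theorem. Weights and shifts are functions cut off at n, so that a term is appended by
  function update.\<close>

definition stieltjes_sum :: "nat \<Rightarrow> (nat \<Rightarrow> real) \<Rightarrow> (nat \<Rightarrow> real) \<Rightarrow> real \<Rightarrow> real" where
  "stieltjes_sum n c s t = (\<Sum>i<n. c i / (t + s i))"

text \<open>Moves the shift from the function to the element, where
  \<open>positive_form_inverse_convex\<close> can act.\<close>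

lemma cfc_shifted_inverse:
  assumes x: "x \<in> pos_inv" and s: "s \<ge> 0"
  shows "cfc (\<lambda>t. 1 / (t + s)) x = inv_el (x + of_real s)"
proof (rule inverse_unique_right[symmetric])
  have xs: "x + of_real s \<in> pos_inv" by (rule pos_inv_shift[OF x s])
  show "(x + of_real s) * inv_el (x + of_real s) = 1" by (rule inv_el(1)[OF xs])
  have "continuous_on {0<..} (\<lambda>t. s + 1 * t)" by (intro continuous_intros)
  from cfc_inverse(2)[OF x this] s
  have "cfc (\<lambda>t. 1 / (s + 1 * t)) x * cfc (\<lambda>t. s + 1 * t) x = 1" by auto
  then show "cfc (\<lambda>t. 1 / (t + s)) x * (x + of_real s) = 1"
    unfolding cfc_affine[OF pos_inv_sa[OF x]] by (simp add: add.commute)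
qed

lemma cfc_stieltjes_sum:
  assumes x: "x \<in> pos_inv" and s: "\<And>i. i < n \<Longrightarrow> s i \<ge> 0"
  shows "cfc (stieltjes_sum n c s) x = (\<Sum>i<n. c i *\<^sub>R inv_el (x + of_real (s i)))"
    and "continuous_on {0<..} (stieltjes_sum n c s)"
proof -
  have cont: "continuous_on {0<..} (stieltjes_sum m c s)" if "m \<le> n" for m
    unfolding stieltjes_sum_def
  proof (intro continuous_intros ballI)
    fix i :: nat and t :: real assume "i \<in> {..<m}" "t \<in> {0<..}"
    then show "t + s i \<noteq> 0" using s[of i] that by force
  qed
  then show "continuous_on {0<..} (stieltjes_sum n c s)" by simp
  show "cfc (stieltjes_sum n c s) x = (\<Sum>i<n. c i *\<^sub>R inv_el (x + of_real (s i)))"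
    using s cont
  proof (induction n)
    case 0
    then show ?case using cfc_const[OF pos_inv_sa[OF x], of 0] by (simp add: stieltjes_sum_def[abs_def])
  next
    case (Suc n)
    have d: "cfc_dom (stieltjes_sum n c s) x" by (rule pos_inv_cfc_dom[OF x]) (simp add: Suc)
    have "continuous_on {0<..} (\<lambda>t. 1 / (t + s n))"
      by (intro continuous_intros) (use Suc.prems(1)[of n] in force)
    then have d': "cfc_dom (\<lambda>t. 1 / (t + s n)) x" by (rule pos_inv_cfc_dom[OF x])
    have "stieltjes_sum (Suc n) c s = (\<lambda>t. stieltjes_sum n c s t + c n * (1 / (t + s n)))"
      by (simp add: stieltjes_sum_def fun_eq_iff)
    then have "cfc (stieltjes_sum (Suc n) c s) x = cfc (stieltjes_sum n c s) x + c n *\<^sub>R cfc (\<lambda>t. 1 / (t + s n)) x"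
      by (simp only: cfc_add[OF d cfc_dom_scale[OF d']] cfc_scale[OF d'])
    then show ?case using Suc.IH Suc.prems by (simp add: cfc_shifted_inverse x)
  qed
qed

lemma positive_form_stieltjes_convex:
  assumes B: "positive_form B"
    and x: "x0 \<in> pos_inv" "x1 \<in> pos_inv" and y: "y0 \<in> pos_inv" "y1 \<in> pos_inv"
    and uv: "u \<ge> 0" "v \<ge> 0" "u + v = 1"
    and c: "\<And>i. i < m \<Longrightarrow> c i \<ge> 0 \<and> s i \<ge> 0" and d: "\<And>j. j < n \<Longrightarrow> d j \<ge> 0 \<and> r j \<ge> 0"
  defines "g \<equiv> cfc (stieltjes_sum m c s)" and "h \<equiv> cfc (stieltjes_sum n d r)"
  shows "B (g (u *\<^sub>R x0 + v *\<^sub>R x1)) (h (u *\<^sub>R y0 + v *\<^sub>R y1)) \<le> u * B (g x0) (h y0) + v * B (g x1) (h y1)"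
proof -
  \<comment> \<open>Shifts pass through convex combinations because the weights add up to 1.\<close>
  have comb: "u *\<^sub>R z + v *\<^sub>R z' + of_real a = u *\<^sub>R (z + of_real a) + v *\<^sub>R (z' + of_real a)"
    for z z' :: "'z::cstar_algebra" and a
    using uv(3) scaleR_left_distrib[of u v "of_real a :: 'z", symmetric] by (simp add: algebra_simps)
  have exp: "B (g x) (h y) = (\<Sum>i<m. \<Sum>j<n. c i * d j * B (inv_el (x + of_real (s i))) (inv_el (y + of_real (r j))))"
    if "x \<in> pos_inv" "y \<in> pos_inv" for x y
    using c d that
    by (simp add: g_def h_def cfc_stieltjes_sum positive_form_sum(1)[OF B] positive_formD(3)[OF B])
      (simp add: positive_form_sum(2)[OF B] positive_formD(4)[OF B] sum_distrib_left mult.assoc)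
  have "B (inv_el (u *\<^sub>R x0 + v *\<^sub>R x1 + of_real (s i))) (inv_el (u *\<^sub>R y0 + v *\<^sub>R y1 + of_real (r j))) \<le>
      u * B (inv_el (x0 + of_real (s i))) (inv_el (y0 + of_real (r j))) +
      v * B (inv_el (x1 + of_real (s i))) (inv_el (y1 + of_real (r j)))" if "i < m" "j < n" for i j
    unfolding comb using c[OF that(1)] d[OF that(2)]
    by (intro positive_form_inverse_convex B uv pos_inv_shift x y) auto
  then have "(\<Sum>i<m. \<Sum>j<n. c i * d j * B (inv_el (u *\<^sub>R x0 + v *\<^sub>R x1 + of_real (s i))) (inv_el (u *\<^sub>R y0 + v *\<^sub>R y1 + of_real (r j)))) \<le>
    (\<Sum>i<m. \<Sum>j<n. c i * d j * (u * B (inv_el (x0 + of_real (s i))) (inv_el (y0 + of_real (r j))) +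
      v * B (inv_el (x1 + of_real (s i))) (inv_el (y1 + of_real (r j)))))"
    using c d by (intro sum_mono mult_left_mono) auto
  also have "\<dots> = u * B (g x0) (h y0) + v * B (g x1) (h y1)"
    by (simp add: exp x y sum_distrib_left sum.distrib algebra_simps)
  finally show ?thesis by (simp add: exp pos_inv_convex_comb x y uv)
qed

definition stieltjes_approximable :: "(real \<Rightarrow> real) \<Rightarrow> bool" where
  "stieltjes_approximable f \<longleftrightarrow> continuous_on {0<..} f \<and>
    (\<forall>a b e. 0 < a \<longrightarrow> a < b \<longrightarrow> e > 0 \<longrightarrow> (\<exists>n c s. (\<forall>i<n. c i \<ge> 0 \<and> s i \<ge> 0) \<and>
      (\<forall>t\<in>{a..b}. \<bar>stieltjes_sum n c s t - f t\<bar> \<le> e)))"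

text \<open>One sequence of sums has to serve both endpoints and their convex combination, since the
  inequality between them is passed to the limit. Finitely many spectra fit into one compact
  interval of positive numbers.\<close>

lemma stieltjes_approx_cfc:
  fixes X :: "'a::cstar_algebra set"
  assumes f: "stieltjes_approximable f" and X: "finite X" "X \<subseteq> pos_inv"
  obtains n c s where "\<And>k i. i < n k \<Longrightarrow> c k i \<ge> 0 \<and> s k i \<ge> (0::real)"
    "\<And>x. x \<in> X \<Longrightarrow> (\<lambda>k::nat. cfc (stieltjes_sum (n k) (c k) (s k)) x) \<longlonglongrightarrow> cfc f x"
    "\<And>k x. x \<in> X \<Longrightarrow> self_adjoint (cfc (stieltjes_sum (n k) (c k) (s k)) x)"
proof -
  have "\<exists>a b. 0 < a \<and> a < b \<and> (\<forall>x\<in>X. real_spectrum x \<subseteq> {a..b})"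
    using X
  proof (induction X rule: finite_induct)
    case empty
    show ?case by (intro exI[of _ 1] exI[of _ 2]) auto
  next
    case (insert x X)
    then obtain a b where ab: "0 < a" "a < b" "\<And>x. x \<in> X \<Longrightarrow> real_spectrum x \<subseteq> {a..b}" by auto
    obtain a' b' where ab': "0 < a'" "a' < b'" "real_spectrum x \<subseteq> {a'..b'}"
      using insert.prems pos_inv_spectrum[of x] by auto
    have "real_spectrum z \<subseteq> {min a a'..max b b'}" if "z \<in> insert x X" for z
      using that ab(3)[of z] ab'(3) by (fastforce simp: min_le_iff_disj le_max_iff_disj)
    then show ?case using ab ab' by (intro exI[of _ "min a a'"] exI[of _ "max b b'"]) auto
  qed
  then obtain a b where ab: "0 < a" "a < b" "\<And>x. x \<in> X \<Longrightarrow> real_spectrum x \<subseteq> {a..b}" by blast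
  have "\<exists>n c s. (\<forall>i<n. c i \<ge> 0 \<and> s i \<ge> 0) \<and> (\<forall>t\<in>{a..b}. \<bar>stieltjes_sum n c s t - f t\<bar> \<le> 1 / (real k + 1))" for k
    using f ab unfolding stieltjes_approximable_def by auto
  then obtain n c s where ncs: "\<And>k. \<forall>i<n k. c k i \<ge> 0 \<and> s k i \<ge> 0"
    "\<And>k. \<forall>t\<in>{a..b}. \<bar>stieltjes_sum (n k) (c k) (s k) t - f t\<bar> \<le> 1 / (real k + 1)" by metis
  have dom: "cfc_dom (stieltjes_sum (n k) (c k) (s k)) x" "cfc_dom f x" if "x \<in> X" for k x
    using that X(2) ncs(1)[of k] f
    by (auto intro!: pos_inv_cfc_dom cfc_stieltjes_sum(2)[of x] simp: stieltjes_approximable_def)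
  show ?thesis
  proof (rule that[of n c s])
    fix x assume x: "x \<in> X"
    have "norm (cfc (stieltjes_sum (n k) (c k) (s k)) x - cfc f x) \<le> 1 / (real k + 1)" for k
      unfolding cfc_diff(1)[OF dom[OF x], symmetric]
      by (rule norm_cfc_le[OF cfc_diff(2)[OF dom[OF x]]]) (use ncs(2) ab(3)[OF x] in blast)
    then have "\<forall>\<^sub>F k in sequentially. norm (cfc (stieltjes_sum (n k) (c k) (s k)) x - cfc f x) \<le> 1 / (real k + 1)"
      by simp
    from Lim_null_comparison[OF this inverse_Suc_tendsto]
    show "(\<lambda>k. cfc (stieltjes_sum (n k) (c k) (s k)) x) \<longlonglongrightarrow> cfc f x" by (simp add: LIM_zero_iff)
  next
    show "self_adjoint (cfc (stieltjes_sum (n k) (c k) (s k)) x)" if "x \<in> X" for k x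
      by (rule self_adjoint_cfc[OF dom(1)[OF that]])
  qed (use ncs(1) in blast)
qed

lemma positive_form_approximable_convex:
  assumes B: "positive_form B"
    and f: "stieltjes_approximable f" and g: "stieltjes_approximable g"
    and x: "x0 \<in> pos_inv" "x1 \<in> pos_inv" and y: "y0 \<in> pos_inv" "y1 \<in> pos_inv"
    and uv: "u \<ge> 0" "v \<ge> 0" "u + v = 1"
  shows "B (cfc f (u *\<^sub>R x0 + v *\<^sub>R x1)) (cfc g (u *\<^sub>R y0 + v *\<^sub>R y1)) \<le>
    u * B (cfc f x0) (cfc g y0) + v * B (cfc f x1) (cfc g y1)"
proof -
  let ?x = "u *\<^sub>R x0 + v *\<^sub>R x1" and ?y = "u *\<^sub>R y0 + v *\<^sub>R y1"
  have xy: "?x \<in> pos_inv" "?y \<in> pos_inv" by (intro pos_inv_convex_comb x y uv)+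
  obtain m c s where F: "\<And>k i. i < m k \<Longrightarrow> c k i \<ge> 0 \<and> s k i \<ge> (0::real)"
    "\<And>x. x \<in> {x0, x1, ?x} \<Longrightarrow> (\<lambda>k::nat. cfc (stieltjes_sum (m k) (c k) (s k)) x) \<longlonglongrightarrow> cfc f x"
    "\<And>k x. x \<in> {x0, x1, ?x} \<Longrightarrow> self_adjoint (cfc (stieltjes_sum (m k) (c k) (s k)) x)"
    using stieltjes_approx_cfc[OF f, of "{x0, x1, ?x}"] x xy by auto
  obtain n d r where G: "\<And>k i. i < n k \<Longrightarrow> d k i \<ge> 0 \<and> r k i \<ge> (0::real)"
    "\<And>x. x \<in> {y0, y1, ?y} \<Longrightarrow> (\<lambda>k::nat. cfc (stieltjes_sum (n k) (d k) (r k)) x) \<longlonglongrightarrow> cfc g x"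
    "\<And>k x. x \<in> {y0, y1, ?y} \<Longrightarrow> self_adjoint (cfc (stieltjes_sum (n k) (d k) (r k)) x)"
    using stieltjes_approx_cfc[OF g, of "{y0, y1, ?y}"] y xy by auto
  let ?F = "\<lambda>k. cfc (stieltjes_sum (m k) (c k) (s k))" and ?G = "\<lambda>k. cfc (stieltjes_sum (n k) (d k) (r k))"
  have lim: "(\<lambda>k. B (?F k x) (?G k y)) \<longlonglongrightarrow> B (cfc f x) (cfc g y)"
    if "x \<in> {x0, x1, ?x}" "y \<in> {y0, y1, ?y}" for x y
    by (rule positive_form_tendsto[OF B F(3) G(3) F(2) G(2)]; rule that)
  show ?thesis
  proof (rule LIMSEQ_le)
    show "(\<lambda>k. B (?F k ?x) (?G k ?y)) \<longlonglongrightarrow> B (cfc f ?x) (cfc g ?y)" by (rule lim) auto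
    show "(\<lambda>k. u * B (?F k x0) (?G k y0) + v * B (?F k x1) (?G k y1))
      \<longlonglongrightarrow> u * B (cfc f x0) (cfc g y0) + v * B (cfc f x1) (cfc g y1)"
      by (intro tendsto_intros lim) auto
  qed (intro exI[of _ 0] allI impI positive_form_stieltjes_convex[OF B x y uv] F(1) G(1))
qed

section \<open>Positivity of products under a trace\<close>

lemma cscale_scaleR: "cscale a (r *\<^sub>R x) = r *\<^sub>R cscale a (x::'a::cstar_algebra)"
  by (metis cscale_cscale cscale_of_real mult.commute)

lemma cartesian_decomposition:
  fixes x :: "'a::cstar_algebra"
  obtains a b where "self_adjoint a" "self_adjoint b" "x = a + cscale \<i> b" "cstar x = a - cscale \<i> b"
proof -
  define a where "a = (1/2) *\<^sub>R (x + cstar x)"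
  define b where "b = (1/2) *\<^sub>R cscale \<i> (cstar x - x)"
  have ib: "cscale \<i> b = (1/2) *\<^sub>R (x - cstar x)"
    by (simp add: b_def cscale_scaleR cscale_ii algebra_simps)
  have half: "(1/2) *\<^sub>R y + (1/2) *\<^sub>R y = y" for y :: 'a
    by (simp flip: scaleR_left_distrib)
  show ?thesis
  proof (rule that)
    show "self_adjoint a" by (simp add: a_def self_adjoint_def cstar_add cstar_cstar add.commute)
    show "self_adjoint b"
      by (simp add: b_def self_adjoint_def cstar_diff cstar_cstar cstar_cscale cscale_minus_left
          cscale_diff_right)
    show "x = a + cscale \<i> b" "cstar x = a - cscale \<i> b"
      unfolding ib a_def using half[of x] half[of "cstar x"] by (simp_all add: algebra_simps)
  qed
qed

lemma tracial_product_nonneg: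
  fixes \<tau> :: "'c::cstar_algebra \<Rightarrow> complex"
  assumes \<tau>: "positive_functional \<tau>" "tracial \<tau>" and p: "cpositive p" and q: "cpositive q"
  shows "Re (\<tau> (p * q)) \<ge> 0"
proof -
  have add: "\<tau> (x + y) = \<tau> x + \<tau> y" and scale: "\<tau> (cscale a x) = a * \<tau> x"
    and pos: "cpositive x \<Longrightarrow> Re (\<tau> x) \<ge> 0" for x y a
    using \<tau>(1) by (auto simp: positive_functional_def)
  have tr: "\<tau> (x * y) = \<tau> (y * x)" for x y using \<tau>(2) by (auto simp: tracial_def)
  let ?p = "cfc sqrt p" and ?q = "cfc sqrt q"
  note P = cfc_sqrt[OF p] and Q = cfc_sqrt[OF q]
  define x where "x = ?p * ?q"
  have cx: "cstar x = ?q * ?p" using P(1) Q(1) by (simp add: x_def cstar_mult self_adjoint_def)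
  have "\<tau> (p * q) = \<tau> (?p * (?p * ?q * ?q))" by (subst P(2)[symmetric], subst Q(2)[symmetric]) (simp add: mult.assoc)
  also have "\<dots> = \<tau> (x * cstar x)" 
    unfolding cx unfolding x_def tr[of ?p "?p * ?q * ?q"] by (simp add: mult.assoc)
  finally have 1: "\<tau> (p * q) = \<tau> (x * cstar x)" .
  obtain a b where ab: "self_adjoint a" "self_adjoint b" "x = a + cscale \<i> b" "cstar x = a - cscale \<i> b"
    by (rule cartesian_decomposition)
  have "x * cstar x = (a * a + b * b) + cscale \<i> (b * a - a * b)"
    unfolding ab(4) unfolding ab(3) by (rule cartesian_products)
  then have "\<tau> (x * cstar x) = \<tau> (a * a) + \<tau> (b * b) + \<i> * \<tau> (b * a - a * b)"
    by (simp add: add scale)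
  also have "\<tau> (b * a - a * b) = 0"
    using add[of "b * a - a * b" "a * b"] tr[of a b] by simp
  finally show ?thesis using pos[OF cpositive_square[OF ab(1)]] pos[OF cpositive_square[OF ab(2)]]
    by (simp add: 1)
qed

section \<open>Interlacing nodes\<close>

lemma lagrange_interpolation:
  fixes a :: "'i \<Rightarrow> real" and R :: "real poly"
  assumes I: "finite I" "inj_on a I" and deg: "degree R < card I"
  shows "poly R x = (\<Sum>i\<in>I. poly R (a i) * (\<Prod>k\<in>I - {i}. (x - a k) / (a i - a k)))"
proof -
  define L where "L = (\<Sum>i\<in>I. Polynomial.smult (poly R (a i)) (\<Prod>k\<in>I - {i}. Polynomial.smult (1 / (a i - a k)) [:- a k, 1:]))"
  have L: "poly L x = (\<Sum>i\<in>I. poly R (a i) * (\<Prod>k\<in>I - {i}. (x - a k) / (a i - a k)))" for x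
    by (simp add: L_def poly_sum poly_prod diff_divide_distrib)
  have "R = L"
  proof (rule poly_eqI_degree[where A = "a ` I"])
    fix x assume "x \<in> a ` I"
    then obtain j where j: "j \<in> I" "x = a j" by blast
    have "poly R (a i) * (\<Prod>k\<in>I - {i}. (a j - a k) / (a i - a k)) = (if i = j then poly R (a j) else 0)"
      if "i \<in> I" for i
    proof (cases "i = j")
      case True
      have "a j \<noteq> a k" if "k \<in> I - {j}" for k using that j(1) I(2) by (auto dest: inj_onD)
      then show ?thesis using True by (simp add: prod.neutral)
    next
      case False
      then have "\<exists>k\<in>I - {i}. (a j - a k) / (a i - a k) = 0" using j(1) by auto
      then show ?thesis using False I(1) by (simp add: prod_zero)
    qed
    then show "poly R x = poly L x" unfolding L j(2)
      using I(1) j(1) by (simp add: sum.delta)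
  next
    show "degree R < card (a ` I)" using deg I by (simp add: card_image)
    have "degree (\<Prod>k\<in>I - {i}. Polynomial.smult (1 / (a i - a k)) [:- a k, 1:]) \<le> card I - 1" if "i \<in> I" for i
    proof -
      have "degree (\<Prod>k\<in>I - {i}. Polynomial.smult (1 / (a i - a k)) [:- a k, 1:]) \<le>
        (\<Sum>k\<in>I - {i}. degree (Polynomial.smult (1 / (a i - a k)) [:- a k, 1:]))"
        using degree_prod_sum_le[of "I - {i}" "\<lambda>k. Polynomial.smult (1 / (a i - a k)) [:- a k, 1:]"] I(1)
        by (simp add: comp_def)
      also have "\<dots> \<le> (\<Sum>k\<in>I - {i}. 1)" by (intro sum_mono) simp
      also have "\<dots> = card I - 1" using that by simp
      finally show ?thesis .
    qed
    then have "degree L \<le> card I - 1"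
      unfolding L_def by (intro degree_sum_le I(1) order.trans[OF degree_smult_le]) auto
    then show "degree L < card (a ` I)" using deg I by (simp add: card_image)
  qed
  then have "poly R x = poly L x" by (rule arg_cong)
  also note L
  finally show ?thesis .
qed

lemma partial_fractions:
  fixes a :: "'i \<Rightarrow> real" and R :: "real poly"
  assumes I: "finite I" "inj_on a I" and deg: "degree R < card I" and x: "x \<notin> a ` I"
  shows "poly R x / (\<Prod>k\<in>I. x - a k) = (\<Sum>i\<in>I. poly R (a i) / ((\<Prod>k\<in>I - {i}. a i - a k) * (x - a i)))"
proof -
  have nz: "(\<Prod>k\<in>I. x - a k) \<noteq> 0" using x I(1) by auto
  have "(\<Prod>k\<in>I - {i}. (x - a k) / (a i - a k)) / (\<Prod>k\<in>I. x - a k) = 1 / ((\<Prod>k\<in>I - {i}. a i - a k) * (x - a i))"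
    if "i \<in> I" for i
  proof -
    have "(\<Prod>k\<in>I. x - a k) = (x - a i) * (\<Prod>k\<in>I - {i}. x - a k)" using that I(1) by (rule prod.remove[rotated])
    then show ?thesis using nz by (simp add: prod_dividef)
  qed
  then show ?thesis
    unfolding lagrange_interpolation[OF I deg, of x] sum_divide_distrib
    by (intro sum.cong refl) (metis (no_types, lifting) times_divide_eq_right mult.right_neutral)
qed

text \<open>The order a_0 < b_0 < a_1 < b_1 < ... is Cauchy interlacing: it allows the b_j to be the
  eigenvalues of diag(a) plus a positive rank one matrix v v^T.\<close>

locale interlaced =
  fixes m :: nat and a b :: "nat \<Rightarrow> real"
  assumes ab: "\<And>i k. i < m \<Longrightarrow> k < m \<Longrightarrow> i \<le> k \<Longrightarrow> a i < b k"
    and ba: "\<And>i k. i < m \<Longrightarrow> k < m \<Longrightarrow> i < k \<Longrightarrow> b i < a k"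
begin

abbreviation "A' i \<equiv> \<Prod>k\<in>{..<m} - {i}. a i - a k"
abbreviation "B' j \<equiv> \<Prod>k\<in>{..<m} - {j}. b j - b k"
abbreviation "Aat x \<equiv> \<Prod>k<m. x - a k"
abbreviation "Bat x \<equiv> \<Prod>k<m. x - b k"

text \<open>Both come from the expansion of \<open>Bat x / Aat x\<close> as 1 minus the sum of
  \<open>w2 i / (x - a i)\<close>: \<open>w2 i\<close> is minus the residue at a_i and becomes the
  square of v_i, while \<open>\<gamma> j\<close> is the derivative at the zero b_j and becomes the
  squared length of an eigenvector.\<close>

definition "w2 i = - Bat (a i) / A' i"
definition "\<gamma> j = B' j / Aat (b j)"

lemma mono_a: "i < k \<Longrightarrow> k < m \<Longrightarrow> a i < a k"
  using ab[of i i] ba[of i k] by force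

lemma mono_b: "i < k \<Longrightarrow> k < m \<Longrightarrow> b i < b k"
  using ab[of k k] ba[of i k] by force

lemma inj_a: "inj_on a {..<m}"
  by (rule inj_onI) (metis lessThan_iff less_irrefl linorder_neqE_nat mono_a)

lemma inj_b: "inj_on b {..<m}"
  by (rule inj_onI) (metis lessThan_iff less_irrefl linorder_neqE_nat mono_b)

lemma a_neq_b: "i < m \<Longrightarrow> j < m \<Longrightarrow> a i \<noteq> b j"
  using ab[of i j] ba[of j i] by (cases "i \<le> j") force+

lemma A'_nz: "i < m \<Longrightarrow> A' i \<noteq> 0"
  using inj_a by (auto dest: inj_onD)

lemma Bat_a: "i < m \<Longrightarrow> Bat (a i) \<noteq> 0"
  by (simp add: a_neq_b)

lemma Aat_b: "i < m \<Longrightarrow> Aat (b i) \<noteq> 0"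
  by (simp add: a_neq_b[THEN not_sym])

lemma Bat_remove: "i < m \<Longrightarrow> Bat x = (x - b i) * (\<Prod>k\<in>{..<m} - {i}. x - b k)"
  by (subst prod.remove[of _ i]) auto

text \<open>Interlacing gives a_i - b_k and a_i - a_k the same sign for k other than i. Positivity
  is what makes the vector v of square roots real.\<close>

lemma w2_pos: assumes i: "i < m" shows "w2 i > 0"
proof -
  have "w2 i = (b i - a i) * (\<Prod>k\<in>{..<m} - {i}. (a i - b k) / (a i - a k))"
    unfolding w2_def Bat_remove[OF i]
    by (simp only: prod_dividef mult_minus_left[symmetric] minus_diff_eq times_divide_eq_right)
  also have "\<dots> > 0"
  proof (intro mult_pos_pos prod_pos ballI)
    show "b i - a i > 0" using ab[of i i] i by simp
    fix k assume k: "k \<in> {..<m} - {i}"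
    show "(a i - b k) / (a i - a k) > 0"
    proof (cases "k < i")
      case True
      then show ?thesis using ba[of k i] mono_a[of k i] i by simp
    next
      case False
      then have "i < k" using k by auto
      then show ?thesis using ab[of i k] mono_a[of i k] i k by (intro divide_neg_neg) auto
    qed
  qed
  finally show ?thesis .
qed

text \<open>Partial fractions of 1 - Bat/Aat, whose numerator loses its leading term, evaluated at a
  zero of Bat. This is the secular equation characterizing eigenvalues of a rank one
  perturbation.\<close>

lemma secular: assumes j: "j < m" shows "(\<Sum>i<m. w2 i / (b j - a i)) = 1"
proof -
  define D where "D = (\<Prod>k<m. [:- a k, 1:]) - (\<Prod>k<m. [:- b k, 1:])"
  have "degree D < m"
  proof -
    have deg: "degree (\<Prod>k<m. [:- c k, 1:]) = m" "lead_coeff (\<Prod>k<m. [:- c k, 1:]) = 1" for c :: "nat \<Rightarrow> real"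
      by (subst degree_prod_eq_sum_degree) (auto simp: lead_coeff_prod)
    have "coeff D m = 0" using deg[of a] deg[of b] by (simp add: D_def)
    moreover have "degree D \<le> m" unfolding D_def using deg(1)[of a] deg(1)[of b] by (intro degree_diff_le) auto
    ultimately show ?thesis using j by (metis gr_implies_not0 le_neq_implies_less leading_coeff_0_iff degree_0 not_gr_zero)
  qed
  moreover have "b j \<notin> a ` {..<m}" using a_neq_b[OF _ j] by force
  ultimately have "poly D (b j) / Aat (b j) = (\<Sum>i<m. poly D (a i) / (A' i * (b j - a i)))"
    by (intro partial_fractions inj_a) auto
  moreover have "poly D (b j) = Aat (b j)"
    using j by (auto simp: D_def poly_prod prod_zero_iff)
  moreover have "poly D (a i) = - Bat (a i)" if "i < m" for i
    using that by (auto simp: D_def poly_prod prod_zero_iff)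
  ultimately have "(\<Sum>i<m. - Bat (a i) / (A' i * (b j - a i))) = 1"
    using Aat_b[OF j] by simp
  then show ?thesis by (simp add: w2_def)
qed

text \<open>Partial fractions of Bat(x) / ((x - b_j) Aat(x)) at x = b_l, where the numerator
  vanishes unless l = j.\<close>

lemma orthogonality:
  assumes j: "j < m" and l: "l < m"
  shows "(\<Sum>i<m. w2 i / ((b j - a i) * (b l - a i))) = (if j = l then \<gamma> j else 0)"
proof -
  define Q where "Q = (\<Prod>k\<in>{..<m} - {j}. [:- b k, 1:])"
  have "degree Q = m - 1" unfolding Q_def by (subst degree_prod_eq_sum_degree) (use j in auto)
  then have "degree Q < m" using j by simp
  moreover have "b l \<notin> a ` {..<m}" using a_neq_b[OF _ l] by force
  ultimately have "poly Q (b l) / Aat (b l) = (\<Sum>i<m. poly Q (a i) / (A' i * (b l - a i)))"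
    by (intro partial_fractions inj_a) auto
  also have "\<dots> = (\<Sum>i<m. w2 i / ((b j - a i) * (b l - a i)))"
  proof (intro sum.cong refl)
    fix i assume "i \<in> {..<m}"
    then have i: "i < m" by simp
    have "Bat (a i) = (a i - b j) * poly Q (a i)"
      unfolding Bat_remove[OF j] by (simp add: Q_def poly_prod)
    then have "w2 i = (b j - a i) * poly Q (a i) / A' i"
      by (simp only: w2_def mult_minus_left[symmetric] minus_diff_eq)
    then show "poly Q (a i) / (A' i * (b l - a i)) = w2 i / ((b j - a i) * (b l - a i))"
      using a_neq_b[OF i j] by simp
  qed
  also have "poly Q (b l) / Aat (b l) = (if j = l then \<gamma> j else 0)"
    using l by (auto simp: Q_def poly_prod \<gamma>_def)
  finally show ?thesis by simp
qed

lemma \<gamma>_pos: assumes j: "j < m" shows "\<gamma> j > 0"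
proof -
  have "(\<Sum>i<m. w2 i / ((b j - a i) * (b j - a i))) > 0"
  proof (intro sum_pos)
    fix i assume i: "i \<in> {..<m}"
    have "(b j - a i) * (b j - a i) > 0"
      using a_neq_b[of i j] i j by (metis eq_iff_diff_eq_0 lessThan_iff not_real_square_gt_zero)
    then show "w2 i / ((b j - a i) * (b j - a i)) > 0" using w2_pos[of i] i by simp
  qed (use j in auto)
  then show ?thesis using orthogonality[OF j j] by simp
qed

definition "v i = sqrt (w2 i)"
text \<open>Column j is (b_j - diag(a))^{-1} v, divided by its length; by \<open>secular\<close> it
  is an eigenvector of diag(a) + v v^T for b_j.\<close>

definition "U i j = v i / (b j - a i) / sqrt (\<gamma> j)"

lemma v_sq: "i < m \<Longrightarrow> v i * v i = w2 i"
  using w2_pos[of i] by (simp add: v_def)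

lemma U_columns:
  assumes j: "j < m" and l: "l < m"
  shows "(\<Sum>i<m. U i j * U i l) = (if j = l then 1 else 0)"
proof -
  have "(\<Sum>i<m. U i j * U i l) = (\<Sum>i<m. w2 i / ((b j - a i) * (b l - a i))) / (sqrt (\<gamma> j) * sqrt (\<gamma> l))"
    unfolding sum_divide_distrib by (intro sum.cong refl) (simp add: U_def v_sq[symmetric])
  then show ?thesis using \<gamma>_pos[OF j] by (cases "j = l") (simp_all add: orthogonality j l)
qed

lemma v_U: assumes j: "j < m" shows "(\<Sum>i<m. v i * U i j) = 1 / sqrt (\<gamma> j)"
proof -
  have "(\<Sum>i<m. v i * U i j) = (\<Sum>i<m. w2 i / (b j - a i)) / sqrt (\<gamma> j)"
    unfolding sum_divide_distrib by (intro sum.cong refl) (simp add: U_def v_sq[symmetric])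
  then show ?thesis by (simp add: secular j)
qed

lemma b_U: assumes "i < m" "j < m" shows "b j * U i j = a i * U i j + v i / sqrt (\<gamma> j)"
proof -
  have "b j - a i \<noteq> 0" by (metis a_neq_b[OF assms] eq_iff_diff_eq_0)
  then have "(b j - a i) * U i j = v i / sqrt (\<gamma> j)" by (simp add: U_def)
  then show ?thesis unfolding left_diff_distrib by linarith
qed

text \<open>The test vector. By partial fractions its coordinates in the basis \<open>U\<close> have
  the same shape as those in the standard basis, with values of R at b_j replacing those at a_i; the
  squares carry the full product of node differences as denominator.\<close>

definition "wt R i = poly R (a i) / (A' i * v i)"

lemma wt_U:
  assumes j: "j < m" and R: "degree R < m"
  shows "(\<Sum>i<m. wt R i * U i j)\<^sup>2 = (poly R (b j))\<^sup>2 / (Aat (b j) * B' j)"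
proof -
  have nv: "v i \<noteq> 0" if "i < m" for i using w2_pos[OF that] by (simp add: v_def)
  have "b j \<notin> a ` {..<m}" using a_neq_b[OF _ j] by force
  then have "poly R (b j) / Aat (b j) = (\<Sum>i<m. poly R (a i) / (A' i * (b j - a i)))"
    using R by (intro partial_fractions inj_a) auto
  moreover have "(\<Sum>i<m. wt R i * U i j) = (\<Sum>i<m. poly R (a i) / (A' i * (b j - a i))) / sqrt (\<gamma> j)"
    unfolding sum_divide_distrib by (intro sum.cong refl) (simp add: U_def wt_def nv)
  ultimately have "(\<Sum>i<m. wt R i * U i j)\<^sup>2 = (poly R (b j) / Aat (b j))\<^sup>2 / \<gamma> j"
    using \<gamma>_pos[OF j] by (simp add: power_divide)
  then show ?thesis using Aat_b[OF j] by (simp add: \<gamma>_def power2_eq_square field_simps)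
qed

lemma wt_sq: assumes i: "i < m" shows "(wt R i)\<^sup>2 = - (poly R (a i))\<^sup>2 / (A' i * Bat (a i))"
proof -
  have "(wt R i)\<^sup>2 = (poly R (a i))\<^sup>2 / ((A' i)\<^sup>2 * w2 i)"
    using v_sq[OF i] by (simp add: wt_def power_divide power_mult_distrib power2_eq_square)
  then show ?thesis using A'_nz[OF i] Bat_a[OF i] by (simp add: w2_def power2_eq_square field_simps)
qed

end

section \<open>Matrices with prescribed orthonormal eigenvectors\<close>

definition real_mat :: "nat \<Rightarrow> (nat \<Rightarrow> nat \<Rightarrow> real) \<Rightarrow> complex mat" where
  "real_mat m M = mat m m (\<lambda>(i, k). complex_of_real (M i k))"

lemma real_mat_carrier [simp]: "real_mat m M \<in> carrier_mat m m"
  by (simp add: real_mat_def)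

lemma real_mat_dim [simp]: "dim_row (real_mat m M) = m" "dim_col (real_mat m M) = m"
  by (simp_all add: real_mat_def)

lemma real_mat_index [simp]: "i < m \<Longrightarrow> k < m \<Longrightarrow> real_mat m M $$ (i, k) = complex_of_real (M i k)"
  by (simp add: real_mat_def)

lemma real_mat_eqI: "(\<And>i k. i < m \<Longrightarrow> k < m \<Longrightarrow> M i k = N i k) \<Longrightarrow> real_mat m M = real_mat m N"
  by (rule eq_matI) auto

lemma real_mat_mult: "real_mat m M * real_mat m N = real_mat m (\<lambda>i k. \<Sum>j<m. M i j * N j k)"
  by (rule eq_matI) (auto simp: scalar_prod_def atLeast0LessThan)

lemma real_mat_diff: "real_mat m M - real_mat m N = real_mat m (\<lambda>i k. M i k - N i k)"
  by (rule eq_matI) auto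

lemma real_mat_one: "real_mat m (\<lambda>i k. if i = k then 1 else 0) = 1\<^sub>m m"
  by (rule eq_matI) auto

lemma mat_hermitian_real_mat:
  assumes "\<And>i k. i < m \<Longrightarrow> k < m \<Longrightarrow> M i k = M k i"
  shows "mat_hermitian (real_mat m M)"
  unfolding mat_hermitian_def mat_adjoint_def
  by (rule eq_matI) (auto simp: mat_of_rows_def assms)

locale orthogonal_frame =
  fixes m :: nat and U :: "nat \<Rightarrow> nat \<Rightarrow> real"
  assumes columns: "\<And>j l. j < m \<Longrightarrow> l < m \<Longrightarrow> (\<Sum>i<m. U i j * U i l) = (if j = l then 1 else 0)"
begin

lemma rows: assumes "i < m" "k < m" shows "(\<Sum>j<m. U i j * U k j) = (if i = k then 1 else 0)"
proof -
  have "real_mat m (\<lambda>i j. U j i) * real_mat m U = 1\<^sub>m m"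
    unfolding real_mat_mult real_mat_one[symmetric] by (rule real_mat_eqI) (rule columns)
  then have "real_mat m U * real_mat m (\<lambda>i j. U j i) = 1\<^sub>m m"
    by (rule mat_mult_left_right_inverse[rotated 2]) auto
  then have "real_mat m (\<lambda>i k. \<Sum>j<m. U i j * U k j) $$ (i, k) = 1\<^sub>m m $$ (i, k)"
    by (simp add: real_mat_mult)
  then have "complex_of_real (\<Sum>j<m. U i j * U k j) = (if i = k then 1 else 0)"
    unfolding real_mat_index[OF assms] using assms by simp
  then have "complex_of_real (\<Sum>j<m. U i j * U k j) = complex_of_real (if i = k then 1 else 0)" by simp
  then show ?thesis unfolding of_real_eq_iff .
qed

text \<open>This is U diag(d) U^T. Matrices come with their eigenbasis, and polynomials, spectrum
  and functional calculus all act on \<open>d\<close>.\<close>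

definition "D d = real_mat m (\<lambda>i k. \<Sum>j<m. U i j * d j * U k j)"

lemma D_carrier [simp]: "D d \<in> carrier_mat m m" "dim_row (D d) = m" "dim_col (D d) = m"
  by (simp_all add: D_def)

lemma D_mult: "D d * D e = D (\<lambda>j. d j * e j)"
  unfolding D_def real_mat_mult
proof (rule real_mat_eqI)
  fix i k assume ik: "i < m" "k < m"
  have "(\<Sum>n<m. (\<Sum>j<m. U i j * d j * U n j) * (\<Sum>l<m. U n l * e l * U k l)) =
      (\<Sum>n<m. \<Sum>j<m. \<Sum>l<m. U i j * d j * (U n j * U n l) * e l * U k l)"
    by (simp add: sum_product mult.assoc)
  also have "\<dots> = (\<Sum>j<m. \<Sum>l<m. \<Sum>n<m. U i j * d j * (U n j * U n l) * e l * U k l)"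
    by (subst sum.swap) (intro sum.cong refl sum.swap)
  also have "\<dots> = (\<Sum>j<m. \<Sum>l<m. U i j * d j * (\<Sum>n<m. U n j * U n l) * e l * U k l)"
    by (simp add: sum_distrib_left sum_distrib_right)
  also have "\<dots> = (\<Sum>j<m. \<Sum>l<m. if j = l then U i j * d j * e j * U k j else 0)"
    by (intro sum.cong refl) (auto simp: columns)
  also have "\<dots> = (\<Sum>j<m. U i j * (d j * e j) * U k j)"
    by (simp add: mult.assoc)
  finally show "(\<Sum>n<m. (\<Sum>j<m. U i j * d j * U n j) * (\<Sum>j<m. U n j * e j * U k j)) =
    (\<Sum>j<m. U i j * (d j * e j) * U k j)" .
qed

lemma D_one: "D (\<lambda>j. 1) = 1\<^sub>m m"
  unfolding D_def real_mat_one[symmetric] by (rule real_mat_eqI) (simp add: rows)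

lemma D_power: "D d ^\<^sub>m n = D (\<lambda>j. d j ^ n)"
  by (induction n) (simp_all add: D_one D_mult mult.commute)

lemma mat_poly_eval_D: "mat_poly_eval p (D d) = D (\<lambda>j. poly p (d j))"
proof (rule eq_matI)
  fix i k assume ik: "i < dim_row (D (\<lambda>j. poly p (d j)))" "k < dim_col (D (\<lambda>j. poly p (d j)))"
  then have "mat_poly_eval p (D d) $$ (i, k) =
      complex_of_real (\<Sum>n\<le>degree p. coeff p n * (\<Sum>j<m. U i j * d j ^ n * U k j))"
    by (simp add: mat_poly_eval_def D_power) (simp add: D_def)
  also have "(\<Sum>n\<le>degree p. coeff p n * (\<Sum>j<m. U i j * d j ^ n * U k j)) =
      (\<Sum>n\<le>degree p. \<Sum>j<m. U i j * (coeff p n * d j ^ n) * U k j)"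
    by (simp add: sum_distrib_left mult_ac)
  also have "\<dots> = (\<Sum>j<m. U i j * poly p (d j) * U k j)"
    by (subst sum.swap) (simp add: poly_altdef sum_distrib_left sum_distrib_right)
  finally show "mat_poly_eval p (D d) $$ (i, k) = D (\<lambda>j. poly p (d j)) $$ (i, k)"
    using ik by (simp add: D_def)
qed (simp_all add: mat_poly_eval_def)

lemma mat_real_spectrum_D: "mat_real_spectrum (D d) = d ` {..<m}"
proof (intro equalityI subsetI)
  fix t assume "t \<in> d ` {..<m}"
  then obtain l where l: "l < m" "t = d l" by auto
  define v where "v = vec m (\<lambda>i. complex_of_real (U i l))"
  have "D d *\<^sub>v v = complex_of_real t \<cdot>\<^sub>v v"
  proof (rule eq_vecI)
    fix i assume "i < dim_vec (complex_of_real t \<cdot>\<^sub>v v)"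
    then have i: "i < m" by (simp add: v_def)
    have "(\<Sum>n<m. (\<Sum>j<m. U i j * d j * U n j) * U n l) = (\<Sum>n<m. \<Sum>j<m. U i j * d j * (U n j * U n l))"
      by (simp add: sum_distrib_right mult.assoc)
    also have "\<dots> = (\<Sum>j<m. U i j * d j * (\<Sum>n<m. U n j * U n l))"
      by (subst sum.swap) (simp add: sum_distrib_left)
    also have "\<dots> = (\<Sum>j<m. if j = l then U i l * d l else 0)"
      by (intro sum.cong refl) (auto simp: columns l)
    also have "\<dots> = d l * U i l" using l by simp
    finally have "complex_of_real (\<Sum>n<m. (\<Sum>j<m. U i j * d j * U n j) * U n l) = complex_of_real (d l * U i l)"
      by (rule arg_cong)
    then show "vec_index (D d *\<^sub>v v) i = vec_index (complex_of_real t \<cdot>\<^sub>v v) i"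
      using i by (simp add: D_def v_def l scalar_prod_def atLeast0LessThan)
  qed (simp add: v_def)
  moreover have "v \<noteq> 0\<^sub>v m"
  proof
    assume "v = 0\<^sub>v m"
    then have "U i l = 0" if "i < m" for i
      using that by (metis v_def index_vec index_zero_vec(1) of_real_eq_0_iff)
    then show False using columns[OF l(1) l(1)] by simp
  qed
  ultimately show "t \<in> mat_real_spectrum (D d)"
    unfolding mat_real_spectrum_def eigenvalue_def eigenvector_def D_carrier
    by (intro CollectI exI[of _ v]) (simp add: v_def)
next
  fix t assume "t \<in> mat_real_spectrum (D d)"
  then obtain v where v: "v \<in> carrier_vec m" "v \<noteq> 0\<^sub>v m" "D d *\<^sub>v v = complex_of_real t \<cdot>\<^sub>v v"
    by (auto simp: mat_real_spectrum_def eigenvalue_def eigenvector_def)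
  show "t \<in> d ` {..<m}"
  proof (rule ccontr)
    assume t: "t \<notin> d ` {..<m}"
    \<comment> \<open>\<open>D e\<close> is the resolvent of \<open>D d\<close> at t; applied to the
      eigenvalue equation it forces the eigenvector to be zero.\<close>
    define e where "e = (\<lambda>j. 1 / (d j - t))"
    have e: "e j * d j = 1 + t * e j" if "j < m" for j
    proof -
      have "d j - t \<noteq> 0" using t that by auto
      then show ?thesis by (simp add: e_def field_simps)
    qed
    have "D e * D d = D (\<lambda>j. 1 + t * e j)"
      unfolding D_mult unfolding D_def by (intro real_mat_eqI sum.cong refl) (simp add: e)
    also have "\<dots> = D (\<lambda>j. 1) + complex_of_real t \<cdot>\<^sub>m D e"
      unfolding D_def
      by (rule eq_matI) (simp_all add: distrib_left distrib_right sum.distrib sum_distrib_left mult_ac)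
    finally have eq: "D e * D d = 1\<^sub>m m + complex_of_real t \<cdot>\<^sub>m D e" by (simp add: D_one)
    have z: "D e *\<^sub>v v \<in> carrier_vec m" by (rule mult_mat_vec_carrier[OF _ v(1)]) simp
    have "complex_of_real t \<cdot>\<^sub>v (D e *\<^sub>v v) = D e *\<^sub>v (D d *\<^sub>v v)"
      unfolding v(3) by (rule mult_mat_vec[symmetric, OF D_carrier(1) v(1)])
    also have "\<dots> = (D e * D d) *\<^sub>v v" by (rule assoc_mult_mat_vec[symmetric, OF D_carrier(1) D_carrier(1) v(1)])
    also have "\<dots> = 1\<^sub>m m *\<^sub>v v + (complex_of_real t \<cdot>\<^sub>m D e) *\<^sub>v v"
      unfolding eq by (rule add_mult_distrib_mat_vec[of _ m m, OF _ _ v(1)]) simp_all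
    also have "(complex_of_real t \<cdot>\<^sub>m D e) *\<^sub>v v = complex_of_real t \<cdot>\<^sub>v (D e *\<^sub>v v)"
      using v(1) by (intro eq_vecI) simp_all
    also have "1\<^sub>m m *\<^sub>v v = v" using v(1) by simp
    finally have eq: "complex_of_real t \<cdot>\<^sub>v (D e *\<^sub>v v) = v + complex_of_real t \<cdot>\<^sub>v (D e *\<^sub>v v)" .
    have "v = 0\<^sub>v m"
    proof (rule eq_vecI)
      fix i assume "i < dim_vec (0\<^sub>v m :: complex vec)"
      then have i: "i < m" by simp
      from arg_cong[OF eq, of "\<lambda>w. vec_index w i"] show "vec_index v i = vec_index (0\<^sub>v m) i"
        using i v(1) z by simp
    qed (use v(1) in simp)
    then show False using v(2) by blast
  qed
qed

lemma mat_fc_D: "mat_fc f (D d) = D (\<lambda>j. f (d j))"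
  unfolding mat_fc_def
proof (rule the_equality)
  have "\<exists>p. \<forall>t\<in>d ` {..<m}. poly p t = f t"
  proof -
    have "finite S \<Longrightarrow> \<exists>p. \<forall>t\<in>S. poly p t = f t" for S
    proof (induction S rule: finite_induct)
      case (insert x S)
      then obtain p where p: "\<forall>t\<in>S. poly p t = f t" by blast
      \<comment> \<open>Newton's interpolation step: q vanishes at the earlier nodes but not at
        x.\<close>
      define q where "q = (\<Prod>s\<in>S. [:- s, 1:])"
      have "poly q x \<noteq> 0" using insert.hyps by (simp add: q_def poly_prod)
      then have "\<forall>t\<in>insert x S. poly (p + Polynomial.smult ((f x - poly p x) / poly q x) q) t = f t"
        using p insert.hyps by (auto simp: q_def poly_prod prod_zero_iff)
      then show ?case by blast
    qed auto
    then show ?thesis by blast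
  qed
  then obtain p where p: "\<forall>t\<in>d ` {..<m}. poly p t = f t" by blast
  then have "D (\<lambda>j. f (d j)) = mat_poly_eval p (D d)"
    unfolding mat_poly_eval_D unfolding D_def by (intro real_mat_eqI) simp
  then show "\<exists>p. (\<forall>t\<in>mat_real_spectrum (D d). poly p t = f t) \<and> D (\<lambda>j. f (d j)) = mat_poly_eval p (D d)"
    using p unfolding mat_real_spectrum_D by blast
next
  fix Y assume "\<exists>p. (\<forall>t\<in>mat_real_spectrum (D d). poly p t = f t) \<and> Y = mat_poly_eval p (D d)"
  then show "Y = D (\<lambda>j. f (d j))"
    unfolding mat_real_spectrum_D mat_poly_eval_D unfolding D_def by (auto intro!: real_mat_eqI)
qed

lemma mat_hermitian_D: "mat_hermitian (D d)"
  unfolding D_def by (rule mat_hermitian_real_mat) (simp add: mult_ac)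

end

section \<open>Positive matrices as quadratic forms\<close>

text \<open>The shifted matrix has nonzero determinant, and since its entries are real, the real
  part of a complex left inverse is again a left inverse. Stated by sums, it yields a bound on real
  vectors.\<close>

lemma real_mat_left_inverse:
  assumes "\<mu> \<notin> mat_real_spectrum (real_mat m M)"
  shows "\<exists>P. \<forall>x. \<forall>i<m. x i = (\<Sum>k<m. P i k * (\<Sum>l<m. (M k l - (if k = l then \<mu> else 0)) * x l))"
proof -
  define N where "N = real_mat m (\<lambda>k l. M k l - (if k = l then \<mu> else 0))"
  have N: "N \<in> carrier_mat m m" by (simp add: N_def)
  have "det N \<noteq> 0"
  proof
    assume "det N = 0"
    then obtain v where v: "v \<in> carrier_vec m" "v \<noteq> 0\<^sub>v m" "N *\<^sub>v v = 0\<^sub>v m"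
      using det_0_iff_vec_prod_zero[OF N] by blast
    have "real_mat m M *\<^sub>v v = complex_of_real \<mu> \<cdot>\<^sub>v v"
    proof (rule eq_vecI)
      fix k assume "k < dim_vec (complex_of_real \<mu> \<cdot>\<^sub>v v)"
      then have k: "k < m" using v(1) by simp
      have "0 = vec_index (N *\<^sub>v v) k" using k by (simp add: v(3))
      also have "\<dots> = (\<Sum>l<m. complex_of_real (M k l) * vec_index v l) -
          (\<Sum>l<m. complex_of_real (if k = l then \<mu> else 0) * vec_index v l)"
        using k v(1) by (simp add: N_def scalar_prod_def atLeast0LessThan left_diff_distrib sum_subtractf)
      also have "(\<Sum>l<m. complex_of_real (if k = l then \<mu> else 0) * vec_index v l) = complex_of_real \<mu> * vec_index v k"
        using k by (simp add: if_distrib[of complex_of_real] if_distrib[of "\<lambda>c. c * _"] cong: if_cong)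
      finally show "vec_index (real_mat m M *\<^sub>v v) k = vec_index (complex_of_real \<mu> \<cdot>\<^sub>v v) k"
        using k v(1) by (simp add: scalar_prod_def atLeast0LessThan)
    qed (use v(1) in simp)
    then have "\<mu> \<in> mat_real_spectrum (real_mat m M)"
      using v unfolding mat_real_spectrum_def eigenvalue_def eigenvector_def by auto
    then show False using assms by simp
  qed
  from det_non_zero_imp_unit[OF N this, of undefined]
  obtain C where C: "C \<in> carrier_mat m m" "C * N = 1\<^sub>m m"
    by (auto simp: Units_def ring_mat_def)
  define P where "P i k = Re (C $$ (i, k))" for i k
  have CN: "(\<Sum>k<m. P i k * (M k l - (if k = l then \<mu> else 0))) = (if i = l then 1 else 0)"
    if "i < m" "l < m" for i l
  proof -
    have "(C * N) $$ (i, l) = (\<Sum>k<m. C $$ (i, k) * complex_of_real (M k l - (if k = l then \<mu> else 0)))"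
      using that C(1) by (simp add: N_def scalar_prod_def atLeast0LessThan)
    then have "Re (1\<^sub>m m $$ (i, l)) = (\<Sum>k<m. P i k * (M k l - (if k = l then \<mu> else 0)))"
      by (simp add: C(2) P_def Re_sum del: of_real_diff)
    then show ?thesis using that by (auto split: if_splits)
  qed
  show ?thesis
  proof (intro exI[of _ P] allI impI)
    fix x :: "nat \<Rightarrow> real" and i assume i: "i < m"
    have "(\<Sum>k<m. P i k * (\<Sum>l<m. (M k l - (if k = l then \<mu> else 0)) * x l)) =
        (\<Sum>k<m. \<Sum>l<m. P i k * (M k l - (if k = l then \<mu> else 0)) * x l)"
      by (simp add: sum_distrib_left mult.assoc)
    also have "\<dots> = (\<Sum>l<m. (\<Sum>k<m. P i k * (M k l - (if k = l then \<mu> else 0))) * x l)"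
      by (subst sum.swap) (simp add: sum_distrib_right)
    also have "\<dots> = (\<Sum>l<m. if i = l then x l else 0)"
      by (intro sum.cong refl) (simp add: CN i)
    also have "\<dots> = x i" using i by simp
    finally show "x i = (\<Sum>k<m. P i k * (\<Sum>l<m. (M k l - (if k = l then \<mu> else 0)) * x l))" by simp
  qed
qed

text \<open>The infimum \<open>\<mu>\<close> of the Rayleigh quotient is an eigenvalue: \<open>N = M - \<mu>\<close> defines a positive
  semidefinite form, whence \<open>\<parallel>N x\<parallel>\<^sup>2\<close> is bounded by a multiple of \<open>\<langle>x, N x\<rangle>\<close>; the latter gets
  arbitrarily small on unit vectors, so \<open>N\<close> has no bounded inverse.\<close>
lemma mat_positive_form_nonneg:
  fixes M :: "nat \<Rightarrow> nat \<Rightarrow> real"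
  assumes sym: "\<And>i k. M i k = M k i" and pos: "mat_positive (real_mat m M)"
  shows "(\<Sum>i<m. \<Sum>k<m. x i * M i k * x k) \<ge> 0"
proof (rule ccontr)
  define q where "q x = (\<Sum>i<m. \<Sum>k<m. x i * M i k * x k)" for x :: "nat \<Rightarrow> real"
  define n where "n x = (\<Sum>i<m. (x i)\<^sup>2)" for x :: "nat \<Rightarrow> real"
  assume "\<not> ?thesis"
  then have qx: "q x < 0" by (simp add: q_def)
  have n0: "n y \<ge> 0" for y by (simp add: n_def sum_nonneg)
  have le_n: "\<bar>y i\<bar> * \<bar>y k\<bar> \<le> n y" if "i < m" "k < m" for y i k
  proof -
    have "(y i)\<^sup>2 \<le> n y" "(y k)\<^sup>2 \<le> n y" unfolding n_def
      using that by (auto intro!: member_le_sum)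
    then have "\<bar>y i\<bar> \<le> sqrt (n y)" "\<bar>y k\<bar> \<le> sqrt (n y)" by (auto intro: real_le_rsqrt simp: abs_le_square_iff)
    then have "\<bar>y i\<bar> * \<bar>y k\<bar> \<le> sqrt (n y) * sqrt (n y)" by (intro mult_mono) (auto simp: n0)
    then show ?thesis using n0 by simp
  qed
  define K where "K = (\<Sum>i<m. \<Sum>k<m. \<bar>M i k\<bar>)"
  have K0: "K \<ge> 0" by (simp add: K_def sum_nonneg)
  have qK: "\<bar>q y\<bar> \<le> K * n y" for y
  proof -
    have "\<bar>q y\<bar> \<le> (\<Sum>i<m. \<Sum>k<m. \<bar>y i * M i k * y k\<bar>)"
      unfolding q_def by (intro order.trans[OF sum_abs] sum_mono sum_abs)
    also have "\<dots> \<le> (\<Sum>i<m. \<Sum>k<m. \<bar>M i k\<bar> * n y)"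
    proof (intro sum_mono)
      fix i k assume "i \<in> {..<m}" "k \<in> {..<m}"
      then have "\<bar>M i k\<bar> * (\<bar>y i\<bar> * \<bar>y k\<bar>) \<le> \<bar>M i k\<bar> * n y" by (intro mult_left_mono le_n) auto
      then show "\<bar>y i * M i k * y k\<bar> \<le> \<bar>M i k\<bar> * n y" by (simp add: abs_mult mult_ac)
    qed
    also have "\<dots> = K * n y" by (simp add: K_def sum_distrib_right)
    finally show ?thesis .
  qed
  define S where "S = {q y / n y | y. n y > 0}"
  have nx: "n x > 0" using qK[of x] qx n0[of x] by (cases "n x = 0") auto
  have S: "S \<noteq> {}" "bdd_below S"
  proof -
    show "S \<noteq> {}" using nx by (auto simp: S_def)
    have "- K \<le> q y / n y" if "n y > 0" for y
      using qK[of y] that by (simp add: pos_le_divide_eq abs_le_iff)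
    then show "bdd_below S" by (intro bdd_belowI[of _ "- K"]) (auto simp: S_def)
  qed
  define \<mu> where "\<mu> = Inf S"
  have low: "\<mu> * n y \<le> q y" for y
  proof (cases "n y = 0")
    case True then show ?thesis using qK[of y] by simp
  next
    case False
    then have "n y > 0" using n0[of y] by simp
    then have "\<mu> \<le> q y / n y" unfolding \<mu>_def by (intro cInf_lower S) (auto simp: S_def)
    then show ?thesis using \<open>n y > 0\<close> by (simp add: pos_le_divide_eq)
  qed
  have "\<mu> < 0"
  proof -
    have "\<mu> * n x < 0" using low[of x] qx by linarith
    then show ?thesis using nx by (simp add: mult_less_0_iff)
  qed
  then have "\<mu> \<notin> mat_real_spectrum (real_mat m M)" using pos by (force simp: mat_positive_def)
  from real_mat_left_inverse[OF this] obtain P where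
    P: "\<forall>y. \<forall>i<m. y i = (\<Sum>k<m. P i k * (\<Sum>l<m. (M k l - (if k = l then \<mu> else 0)) * y l))" ..
  define N where "N y k = (\<Sum>l<m. (M k l - (if k = l then \<mu> else 0)) * y l)" for y k
  define s where "s y z = (\<Sum>k<m. y k * N z k)" for y z
  have N_lin: "N (\<lambda>i. y i - c * z i) k = N y k - c * N z k" for y z c k
    by (simp add: N_def right_diff_distrib sum_subtractf sum_distrib_left mult.left_commute)
  have sym_s: "s y z = s z y" for y z
  proof -
    have "s y z = (\<Sum>k<m. \<Sum>l<m. y k * (M k l - (if k = l then \<mu> else 0)) * z l)" for y z
      by (simp add: s_def N_def sum_distrib_left mult.assoc)
    note e = this
    have "s y z = (\<Sum>l<m. \<Sum>k<m. y k * (M k l - (if k = l then \<mu> else 0)) * z l)"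
      unfolding e by (rule sum.swap)
    also have "\<dots> = s z y" unfolding e
      by (intro sum.cong refl) (auto simp: sym mult_ac)
    finally show ?thesis .
  qed
  have s_q: "s y y = q y - \<mu> * n y" for y
  proof -
    have "s y y = (\<Sum>k<m. \<Sum>l<m. y k * M k l * y l - (if k = l then \<mu> * (y k)\<^sup>2 else 0))"
      unfolding s_def N_def sum_distrib_left
      by (intro sum.cong refl) (auto simp: algebra_simps power2_eq_square)
    also have "\<dots> = q y - \<mu> * n y"
      by (simp add: sum_subtractf q_def n_def sum_distrib_left)
    finally show ?thesis .
  qed
  have s0: "s y y \<ge> 0" for y using low[of y] s_q by simp
  define L where "L = K + \<bar>\<mu>\<bar> + 1"
  have L: "L > 0" using K0 by (simp add: L_def)
  have sL: "s y y \<le> L * n y" for y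
  proof -
    have "s y y \<le> K * n y + \<bar>\<mu>\<bar> * n y"
      unfolding s_q using qK[of y] mult_right_mono[OF abs_ge_minus_self n0, of \<mu> y] by linarith
    then show ?thesis using n0[of y] unfolding L_def by (simp add: algebra_simps)
  qed
  have nN: "n (N y) \<le> L * s y y" for y
  proof -
    have nn: "s (N y) y = n (N y)" by (simp add: s_def n_def power2_eq_square)
    \<comment> \<open>Nonnegativity of the form after a gradient step of length 1/L from y. As L
      bounds the form, this step length lets half of the linear term absorb the quadratic
      one.\<close>
    have "0 \<le> s (\<lambda>i. y i - (1/L) * N y i) (\<lambda>i. y i - (1/L) * N y i)" by (rule s0)
    also have "\<dots> = s y y - (1/L) * s (N y) y - (1/L) * (s y (N y) - (1/L) * s (N y) (N y))"
      unfolding s_def N_lin by (simp add: algebra_simps sum_subtractf sum.distrib sum_distrib_left)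
    also have "\<dots> = s y y - 2 / L * n (N y) + (1/L) * (1/L) * s (N y) (N y)"
      using sym_s[of y "N y"] nn by (simp add: algebra_simps)
    also have "\<dots> \<le> s y y - 2 / L * n (N y) + (1/L) * (1/L) * (L * n (N y))"
      using L by (intro add_left_mono mult_left_mono sL) auto
    also have "\<dots> = s y y - n (N y) / L" using L by (simp add: field_simps)
    finally show ?thesis using L by (simp add: field_simps)
  qed
  define C where "C = (\<Sum>i<m. \<Sum>k<m. (P i k)\<^sup>2)"
  have C0: "C \<ge> 0" by (simp add: C_def sum_nonneg)
  have nC: "n y \<le> C * n (N y)" for y
  proof -
    have "(y i)\<^sup>2 \<le> (\<Sum>k<m. (P i k)\<^sup>2) * n (N y)" if "i < m" for i
    proof -
      have "y i = (\<Sum>k<m. P i k * N y k)" using P[rule_format, OF that, of y] unfolding N_def .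
      then show ?thesis unfolding n_def using Cauchy_Schwarz_ineq_sum[of "P i" "N y" "{..<m}"] by simp
    qed
    then have "n y \<le> (\<Sum>i<m. (\<Sum>k<m. (P i k)\<^sup>2) * n (N y))" unfolding n_def[of y] by (intro sum_mono) simp
    then show ?thesis by (simp add: C_def sum_distrib_right)
  qed
  have key: "n y \<le> C * L * s y y" for y
    using nC[of y] mult_left_mono[OF nN C0, of y] by (simp add: mult.assoc)
  \<comment> \<open>Small enough that C L \<delta> < 1, which contradicts \<open>key\<close> at a
    vector whose quotient lies within \<delta> of the infimum.\<close>
  define \<delta> where "\<delta> = 1 / (C * L + 1)"
  have CL: "C * L \<ge> 0" using C0 L by simp
  then have \<delta>: "\<delta> > 0" by (simp add: \<delta>_def)
  obtain z where "z \<in> S" "z < \<mu> + \<delta>" using cInf_lessD[OF S(1), of "\<mu> + \<delta>"] \<delta> by (auto simp: \<mu>_def)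
  then obtain y where y: "n y > 0" "q y / n y < \<mu> + \<delta>" by (auto simp: S_def)
  then have "s y y < \<delta> * n y" unfolding s_q by (simp add: pos_divide_less_eq algebra_simps)
  then have "C * L * s y y \<le> C * L * (\<delta> * n y)" using CL by (intro mult_left_mono) auto
  also have "\<dots> < n y"
  proof -
    have "C * L * \<delta> < 1" using CL by (simp add: \<delta>_def divide_simps)
    then show ?thesis using y(1) mult_strict_right_mono[of "C * L * \<delta>" 1 "n y"] by (simp add: mult.assoc)
  qed
  finally show False using key[of y] by simp
qed

text \<open>Pairing the eigenvalue equation with the eigenvector x gives |<v, x>|^2 = t
  |x|^2.\<close>

lemma mat_positive_real_mat_rank_one:
  "mat_positive (real_mat m (\<lambda>i k. v i * v k))"
  unfolding mat_positive_def
proof (intro conjI subsetI)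
  show "mat_hermitian (real_mat m (\<lambda>i k. v i * v k))" by (rule mat_hermitian_real_mat) simp
  fix t assume "t \<in> mat_real_spectrum (real_mat m (\<lambda>i k. v i * v k))"
  then obtain x where x: "x \<in> carrier_vec m" "x \<noteq> 0\<^sub>v m"
    "real_mat m (\<lambda>i k. v i * v k) *\<^sub>v x = complex_of_real t \<cdot>\<^sub>v x"
    by (auto simp: mat_real_spectrum_def eigenvalue_def eigenvector_def)
  define z where "z = (\<Sum>k<m. complex_of_real (v k) * vec_index x k)"
  have ev: "complex_of_real (v i) * z = complex_of_real t * vec_index x i" if "i < m" for i
    using arg_cong[OF x(3), of "\<lambda>w. vec_index w i"] that x(1)
    by (simp add: z_def scalar_prod_def atLeast0LessThan sum_distrib_left mult.assoc)
  have "cnj z = (\<Sum>i<m. complex_of_real (v i) * cnj (vec_index x i))" by (simp add: z_def)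
  then have "cnj z * z = (\<Sum>i<m. complex_of_real (v i) * z * cnj (vec_index x i))"
    by (simp add: sum_distrib_left mult_ac)
  also have "\<dots> = complex_of_real t * (\<Sum>i<m. vec_index x i * cnj (vec_index x i))"
    by (simp add: ev sum_distrib_left mult.assoc)
  also have "\<dots> = complex_of_real (t * (\<Sum>i<m. (cmod (vec_index x i))\<^sup>2))"
    by (simp only: complex_norm_square of_real_mult of_real_sum)
  finally have "(cmod z)\<^sup>2 = t * (\<Sum>i<m. (cmod (vec_index x i))\<^sup>2)"
    by (metis complex_norm_square mult.commute of_real_eq_iff)
  moreover have "(\<Sum>i<m. (cmod (vec_index x i))\<^sup>2) > 0"
  proof -
    obtain i where "i < m" "vec_index x i \<noteq> 0"
      using x(1,2) by (metis carrier_vecD eq_vecI index_zero_vec)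
    then show ?thesis by (intro sum_pos2[of _ i]) auto
  qed
  ultimately show "t \<in> {0..}"
    by (metis atLeast_iff zero_le_mult_iff zero_le_power2 not_less)
qed

section \<open>Divided differences of operator monotone functions\<close>

lemma (in orthogonal_frame) form_D:
  "(\<Sum>i<m. \<Sum>k<m. x i * (\<Sum>j<m. U i j * d j * U k j) * x k) = (\<Sum>j<m. d j * (\<Sum>i<m. x i * U i j)\<^sup>2)"
proof -
  have "(\<Sum>i<m. \<Sum>k<m. x i * (\<Sum>j<m. U i j * d j * U k j) * x k) =
      (\<Sum>i<m. \<Sum>k<m. \<Sum>j<m. d j * (x i * U i j) * (x k * U k j))"
    by (simp add: sum_distrib_left sum_distrib_right mult_ac)
  also have "\<dots> = (\<Sum>i<m. \<Sum>j<m. \<Sum>k<m. d j * (x i * U i j) * (x k * U k j))"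
    by (intro sum.cong refl sum.swap)
  also have "\<dots> = (\<Sum>j<m. \<Sum>i<m. \<Sum>k<m. d j * (x i * U i j) * (x k * U k j))"
    by (rule sum.swap)
  also have "\<dots> = (\<Sum>j<m. d j * (\<Sum>i<m. x i * U i j)\<^sup>2)"
    by (simp only: power2_eq_square sum_product) (simp only: sum_distrib_left mult.assoc)
  finally show ?thesis .
qed

text \<open>X is diag(a) and Y = X + v v^T has eigenvalues b and eigenbasis \<open>U\<close>. The
  quadratic form of f(X) - f(Y) at \<open>wt R\<close> is diagonalized separately for each summand;
  the minus sign in \<open>wt_sq\<close> turns its nonnegativity into a sum of terms of one common
  shape that is \<le> 0.\<close>

lemma (in interlaced) interlaced_ineq:
  assumes f: "op_mono_dec f" and pos: "\<And>i. i < m \<Longrightarrow> a i > 0" and R: "degree R < m"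
  shows "(\<Sum>i<m. f (a i) * ((poly R (a i))\<^sup>2 / (A' i * Bat (a i)))) +
    (\<Sum>j<m. f (b j) * ((poly R (b j))\<^sup>2 / (Aat (b j) * B' j))) \<le> 0"
proof -
  \<comment> \<open>The standard frame, in which \<open>X.D a\<close> is the diagonal matrix of
    a.\<close>
  define I where "I i j = (if i = j then 1 else 0 :: real)" for i j :: nat
  interpret X: orthogonal_frame m I
    by unfold_locales (simp add: I_def if_distrib[of "\<lambda>c. c * _"] cong: if_cong)
  interpret Y: orthogonal_frame m U by unfold_locales (rule U_columns)
  have diff: "Y.D b - X.D a = real_mat m (\<lambda>i k. v i * v k)"
    unfolding X.D_def Y.D_def real_mat_diff
  proof (rule real_mat_eqI)
    fix i k assume ik: "i < m" "k < m"
    have "(\<Sum>j<m. U i j * b j * U k j) = (\<Sum>j<m. (a i * U i j + v i / sqrt (\<gamma> j)) * U k j)"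
      by (intro sum.cong refl) (simp add: b_U[OF ik(1), symmetric] mult.commute)
    also have "\<dots> = a i * (\<Sum>j<m. U i j * U k j) + v i * (\<Sum>j<m. U k j * (1 / sqrt (\<gamma> j)))"
      unfolding distrib_right sum.distrib sum_distrib_left
      by (intro arg_cong2[where f = "(+)"] sum.cong refl) (simp_all add: mult_ac)
    also have "(\<Sum>j<m. U k j * (1 / sqrt (\<gamma> j))) = (\<Sum>j<m. \<Sum>l<m. v l * (U l j * U k j))"
      by (intro sum.cong refl) (simp add: v_U[symmetric] sum_distrib_left mult_ac)
    also have "\<dots> = (\<Sum>l<m. v l * (\<Sum>j<m. U l j * U k j))"
      by (subst sum.swap) (simp add: sum_distrib_left)
    also have "\<dots> = (\<Sum>l<m. if l = k then v l else 0)"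
      by (intro sum.cong refl) (simp add: Y.rows ik)
    also have "\<dots> = v k" using ik by simp
    also have "(\<Sum>j<m. U i j * U k j) = (if i = k then 1 else 0)" by (rule Y.rows[OF ik])
    finally have "(\<Sum>j<m. U i j * b j * U k j) = a i * (if i = k then 1 else 0) + v i * v k" .
    moreover have "(\<Sum>j<m. I i j * a j * I k j) = a i * (if i = k then 1 else 0)"
      using ik by (simp add: I_def if_distrib[of "\<lambda>c. c * _"] if_distrib[of "\<lambda>c. _ * c"] cong: if_cong)
    ultimately show "(\<Sum>j<m. U i j * b j * U k j) - (\<Sum>j<m. I i j * a j * I k j) = v i * v k" by simp
  qed
  have "mat_positive (mat_fc f (X.D a) - mat_fc f (Y.D b))"
  proof (rule f[unfolded op_mono_dec_def, THEN conjunct2, rule_format, of _ m])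
    show "mat_positive (Y.D b - X.D a)" unfolding diff by (rule mat_positive_real_mat_rank_one)
    have "b j > 0" if "j < m" for j using ab[OF that that] pos[OF that] by simp
    then show "mat_real_spectrum (X.D a) \<subseteq> {0<..}" "mat_real_spectrum (Y.D b) \<subseteq> {0<..}"
      using pos by (auto simp: X.mat_real_spectrum_D Y.mat_real_spectrum_D)
  qed (simp_all add: X.mat_hermitian_D Y.mat_hermitian_D)
  then have "mat_positive (real_mat m (\<lambda>i k. (\<Sum>j<m. I i j * f (a j) * I k j) - (\<Sum>j<m. U i j * f (b j) * U k j)))"
    unfolding X.mat_fc_D Y.mat_fc_D unfolding X.D_def Y.D_def real_mat_diff .
  then have "0 \<le> (\<Sum>i<m. \<Sum>k<m. wt R i * ((\<Sum>j<m. I i j * f (a j) * I k j) - (\<Sum>j<m. U i j * f (b j) * U k j)) * wt R k)"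
    by (rule mat_positive_form_nonneg[rotated]) (simp add: mult_ac)
  also have "\<dots> = (\<Sum>i<m. \<Sum>k<m. wt R i * (\<Sum>j<m. I i j * f (a j) * I k j) * wt R k) -
      (\<Sum>i<m. \<Sum>k<m. wt R i * (\<Sum>j<m. U i j * f (b j) * U k j) * wt R k)"
    by (simp add: right_diff_distrib left_diff_distrib sum_subtractf)
  also have "\<dots> = (\<Sum>j<m. f (a j) * (wt R j)\<^sup>2) - (\<Sum>j<m. f (b j) * (\<Sum>i<m. wt R i * U i j)\<^sup>2)"
    unfolding X.form_D Y.form_D
    by (simp add: I_def if_distrib[of "\<lambda>c. _ * c"] cong: if_cong)
  also have "\<dots> = (\<Sum>j<m. f (a j) * (- (poly R (a j))\<^sup>2 / (A' j * Bat (a j)))) -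
      (\<Sum>j<m. f (b j) * ((poly R (b j))\<^sup>2 / (Aat (b j) * B' j)))"
    by (intro arg_cong2[where f = "(-)"] sum.cong refl) (simp_all only: lessThan_iff wt_sq wt_U R)
  finally show ?thesis by (simp add: sum_negf)
qed

text \<open>The denominator of a divided difference: the sum of g(t) divided by it over T is the
  divided difference of g at the nodes T.\<close>

definition node_diff :: "real set \<Rightarrow> real \<Rightarrow> real" where
  "node_diff T t = (\<Prod>u\<in>T - {t}. t - u)"

text \<open>The divided difference of f R^2 at 2m nodes is nonpositive. Sorted nodes of even index
  are the eigenvalues of the smaller matrix, those of odd index the eigenvalues of the larger
  one.\<close>

lemma op_mono_dec_square:
  assumes f: "op_mono_dec f" and T: "finite T" "T \<subseteq> {0<..}" "card T = 2 * m" and R: "degree R < m"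
  shows "(\<Sum>t\<in>T. f t * ((poly R t)\<^sup>2 / node_diff T t)) \<le> 0"
proof -
  define xs where "xs = sorted_list_of_set T"
  have xs: "length xs = 2 * m" "set xs = T" "sorted xs" "distinct xs"
    using T by (auto simp: xs_def)
  have less: "xs ! i < xs ! k" if "i < k" "k < 2 * m" for i k
    using that xs sorted_nth_mono[of xs i k] nth_eq_iff_index_eq[of xs i k] by force
  define a where "a i = xs ! (2 * i)" for i
  define b where "b i = xs ! (2 * i + 1)" for i
  interpret interlaced m a b
    by unfold_locales (auto simp: a_def b_def intro!: less)
  have Tab: "T = a ` {..<m} \<union> b ` {..<m}"
  proof (intro equalityI subsetI)
    fix t assume "t \<in> T"
    then obtain n where n: "n < 2 * m" "t = xs ! n" using xs by (metis in_set_conv_nth)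
    show "t \<in> a ` {..<m} \<union> b ` {..<m}"
    proof (cases "even n")
      case True
      then have "t = a (n div 2)" "n div 2 < m" using n by (auto simp: a_def)
      then show ?thesis by blast
    next
      case False
      then have "t = b (n div 2)" "n div 2 < m" using n by (auto simp: b_def)
      then show ?thesis by blast
    qed
  qed (use xs in \<open>auto simp: a_def b_def\<close>)
  have disj: "a ` {..<m} \<inter> b ` {..<m} = {}" using a_neq_b by blast
  have pa: "node_diff T (a i) = A' i * Bat (a i)" if i: "i < m" for i
  proof -
    have "T - {a i} = a ` ({..<m} - {i}) \<union> b ` {..<m}"
      unfolding Tab using i a_neq_b inj_a by (auto dest: inj_onD)
    then have "node_diff T (a i) = (\<Prod>u\<in>a ` ({..<m} - {i}). a i - u) * (\<Prod>u\<in>b ` {..<m}. a i - u)"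
      unfolding node_diff_def by (simp only:) (rule prod.union_disjoint; use disj in auto)
    moreover have "inj_on a ({..<m} - {i})" by (rule inj_on_subset[OF inj_a]) auto
    ultimately show ?thesis by (simp add: prod.reindex inj_b)
  qed
  have pb: "node_diff T (b j) = Aat (b j) * B' j" if j: "j < m" for j
  proof -
    have "T - {b j} = a ` {..<m} \<union> b ` ({..<m} - {j})"
      unfolding Tab using j a_neq_b inj_b by (auto dest: inj_onD) (metis)+
    then have "node_diff T (b j) = (\<Prod>u\<in>a ` {..<m}. b j - u) * (\<Prod>u\<in>b ` ({..<m} - {j}). b j - u)"
      unfolding node_diff_def by (simp only:) (rule prod.union_disjoint; use disj in auto)
    moreover have "inj_on b ({..<m} - {j})" by (rule inj_on_subset[OF inj_b]) auto
    ultimately show ?thesis by (simp add: prod.reindex inj_a)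
  qed
  have "(\<Sum>t\<in>T. f t * ((poly R t)\<^sup>2 / node_diff T t)) =
      (\<Sum>i<m. f (a i) * ((poly R (a i))\<^sup>2 / (A' i * Bat (a i)))) +
      (\<Sum>j<m. f (b j) * ((poly R (b j))\<^sup>2 / (Aat (b j) * B' j)))"
    using disj by (subst Tab) (simp add: sum.union_disjoint sum.reindex inj_a inj_b pa pb)
  also have "\<dots> \<le> 0"
    using T(2) Tab by (intro interlaced_ineq f R) auto
  finally show ?thesis .
qed

text \<open>Adding a node \<open>\<epsilon>\<close> near \<open>0\<close> and a node \<open>1/\<epsilon>\<close> near infinity to the nodes of the previous lemma,
  and letting the square vanish at \<open>\<epsilon>\<close>, produces the factor \<open>-t\<close> in the limit.\<close>
lemma op_mono_dec_times_square:
  assumes f: "op_mono_dec f" and fpos: "\<And>t. t > 0 \<Longrightarrow> f t > 0"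
    and T: "finite T" "T \<subseteq> {0<..}" "card T = 2 * m" and R: "degree R < m"
  shows "(\<Sum>t\<in>T. f t * (- t * (poly R t)\<^sup>2 / node_diff T t)) \<le> 0"
proof -
  have nz: "node_diff T t \<noteq> 0" for t using T(1) by (simp add: node_diff_def)
  \<comment> \<open>The inequality multiplied by the far node Z = 1/e: the factor Z / (t - Z) equals
    1 / (t e - 1) and tends to -1.\<close>
  let ?g = "\<lambda>e. \<Sum>t\<in>T. f t * ((t - e) / (t * e - 1) * (poly R t)\<^sup>2 / node_diff T t)"
  have lim: "(?g \<longlongrightarrow> (\<Sum>t\<in>T. f t * ((t - 0) / (t * 0 - 1) * (poly R t)\<^sup>2 / node_diff T t))) (at_right 0)"
    by (intro tendsto_intros nz) auto
  have "T \<noteq> {}" using T(3) R by auto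
  have "?g e \<le> 0" if e: "0 < e" "e < Min (insert 1 T)" "e < 1 / Max T" for e
  proof -
    define Z where "Z = 1 / e"
    have "Max T > 0" using T(1,2) \<open>T \<noteq> {}\<close> by (metis Max_in greaterThan_iff subsetD)
    then have "e * Max T < 1" using e(3) by (simp add: pos_less_divide_eq)
    then have Z: "Max T < Z" using e(1) by (simp add: Z_def pos_less_divide_eq mult.commute)
    have lt: "e < t \<and> t < Z" if "t \<in> T" for t
    proof
      show "e < t" using e(2) that T(1) by simp
      have "t \<le> Max T" using that T(1) by simp
      then show "t < Z" using Z by simp
    qed
    have "e < Z" using lt \<open>T \<noteq> {}\<close> by force
    have notin: "e \<notin> T" "Z \<notin> T" using lt by auto
    define T' where "T' = insert e (insert Z T)"
    \<comment> \<open>The zero at e removes the term of the new node e, and of (t - e)^2 one factor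
      cancels against the new node difference.\<close>
    define R' where "R' = [:- e, 1:] * R"
    have "R' = 0 \<or> degree R' = Suc (degree R)"
      unfolding R'_def by (cases "R = 0") (simp_all add: degree_mult_eq del: mult_pCons_left)
    then have "degree R' < Suc m" using R by auto
    moreover have "card T' = 2 * Suc m" using T notin \<open>e < Z\<close> by (simp add: T'_def)
    moreover have "T' \<subseteq> {0<..}" using T(2) e(1) \<open>e < Z\<close> by (auto simp: T'_def)
    ultimately have "(\<Sum>t\<in>T'. f t * ((poly R' t)\<^sup>2 / node_diff T' t)) \<le> 0"
      using T(1) by (intro op_mono_dec_square f) (auto simp: T'_def)
    also have "(\<Sum>t\<in>T'. f t * ((poly R' t)\<^sup>2 / node_diff T' t)) =
        f Z * ((poly R' Z)\<^sup>2 / node_diff T' Z) + (\<Sum>t\<in>T. f t * ((poly R' t)\<^sup>2 / node_diff T' t))"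
      using T(1) notin \<open>e < Z\<close> by (simp add: T'_def R'_def)
    also have "(\<Sum>t\<in>T. f t * ((poly R' t)\<^sup>2 / node_diff T' t)) =
        (\<Sum>t\<in>T. f t * ((t - e) / (t - Z) * (poly R t)\<^sup>2 / node_diff T t))"
    proof (intro sum.cong refl)
      fix t assume t: "t \<in> T"
      have "T' - {t} = insert e (insert Z (T - {t}))" using t notin by (auto simp: T'_def)
      then have "node_diff T' t = (t - e) * (t - Z) * node_diff T t"
        using T(1) notin \<open>e < Z\<close> by (simp add: node_diff_def mult.assoc)
      moreover have "poly R' t = (t - e) * poly R t" by (simp add: R'_def algebra_simps)
      ultimately show "f t * ((poly R' t)\<^sup>2 / node_diff T' t) = f t * ((t - e) / (t - Z) * (poly R t)\<^sup>2 / node_diff T t)"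
        using lt[OF t] by (simp add: power_mult_distrib power2_eq_square[of "t - e"])
    qed
    finally have le: "f Z * ((poly R' Z)\<^sup>2 / node_diff T' Z) + (\<Sum>t\<in>T. f t * ((t - e) / (t - Z) * (poly R t)\<^sup>2 / node_diff T t)) \<le> 0" .
    have "node_diff T' Z > 0"
      unfolding node_diff_def by (intro prod_pos) (use lt \<open>e < Z\<close> in \<open>auto simp: T'_def\<close>)
    moreover have "f Z > 0" using e(1) by (intro fpos) (simp add: Z_def)
    ultimately have "f Z * ((poly R' Z)\<^sup>2 / node_diff T' Z) \<ge> 0" by simp
    with le have "(\<Sum>t\<in>T. f t * ((t - e) / (t - Z) * (poly R t)\<^sup>2 / node_diff T t)) \<le> 0" by linarith
    then have "Z * (\<Sum>t\<in>T. f t * ((t - e) / (t - Z) * (poly R t)\<^sup>2 / node_diff T t)) \<le> 0"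
      using e(1) by (intro mult_nonneg_nonpos) (simp_all add: Z_def)
    moreover have "Z * (f t * ((t - e) / (t - Z) * (poly R t)\<^sup>2 / node_diff T t)) =
        f t * ((t - e) / (t * e - 1) * (poly R t)\<^sup>2 / node_diff T t)" if "t \<in> T" for t
    proof -
      have "Z / (t - Z) = 1 / (t * e - 1)" using e(1) lt[OF that] by (simp add: Z_def field_simps)
      moreover have "Z * (f t * ((t - e) / (t - Z) * (poly R t)\<^sup>2 / node_diff T t)) =
          f t * ((t - e) * (Z / (t - Z)) * (poly R t)\<^sup>2 / node_diff T t)" by simp
      ultimately show ?thesis by simp
    qed
    ultimately show ?thesis by (simp add: sum_distrib_left)
  qed
  then have "\<forall>\<^sub>F e in at_right 0. ?g e \<le> 0"
    unfolding eventually_at_right_field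
  proof (intro exI[of _ "min (Min (insert 1 T)) (1 / Max T)"] conjI allI impI)
    have "Max T > 0" using T(1,2) \<open>T \<noteq> {}\<close> by (metis Max_in greaterThan_iff subsetD)
    moreover have "Min (insert 1 T) > 0" using T(1,2) by (subst Min_gr_iff) auto
    ultimately show "0 < min (Min (insert 1 T)) (1 / Max T)" by simp
  qed auto
  from tendsto_upperbound[OF lim this] show ?thesis by simp
qed

section \<open>Polynomials nonnegative on the half-line\<close>

text \<open>Generated by exactly the two kinds of terms for which a divided difference inequality is
  available, so that the inequality extends to the cone by induction.\<close>

inductive sos_cone :: "real poly \<Rightarrow> bool" where
  square: "sos_cone (p * p)"
| times_square: "sos_cone ([:0, 1:] * (p * p))"
| add: "sos_cone p \<Longrightarrow> sos_cone q \<Longrightarrow> sos_cone (p + q)"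

lemma sos_cone_mult: "sos_cone p \<Longrightarrow> sos_cone q \<Longrightarrow> sos_cone (p * q)"
proof (induction p rule: sos_cone.induct)
  case (square p)
  from this show ?case
  proof (induction q rule: sos_cone.induct)
    case (square q)
    have "p * p * (q * q) = (p * q) * (p * q)" by (simp only: mult_ac)
    then show ?case by (metis sos_cone.square)
  next
    case (times_square q)
    have "p * p * ([:0, 1:] * (q * q)) = [:0, 1:] * ((p * q) * (p * q))" by (simp only: mult_ac)
    then show ?case by (metis sos_cone.times_square)
  qed (simp add: distrib_left sos_cone.add)
next
  case (times_square p)
  from this show ?case
  proof (induction q rule: sos_cone.induct)
    case (square q)
    have "[:0, 1:] * (p * p) * (q * q) = [:0, 1:] * ((p * q) * (p * q))" by (simp only: mult_ac)
    then show ?case by (metis sos_cone.times_square)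
  next
    case (times_square q)
    have "[:0, 1:] * (p * p) * ([:0, 1:] * (q * q)) = ([:0, 1:] * p * q) * ([:0, 1:] * p * q)" by (simp only: mult_ac)
    then show ?case by (metis sos_cone.square)
  qed (simp add: distrib_left sos_cone.add del: mult_pCons_left)
qed (simp add: distrib_right sos_cone.add)

text \<open>Leading coefficients in the cone are nonnegative, so they cannot cancel in a sum. This
  keeps every square in a decomposition within the degree bound of the matrix inequality.\<close>

lemma sos_cone_add_degree:
  "sos_cone p \<Longrightarrow> sos_cone q \<Longrightarrow> degree p \<le> degree (p + q) \<and> degree q \<le> degree (p + q)"
proof -
  have add: "degree p \<le> degree (p + q) \<and> degree q \<le> degree (p + q) \<and> lead_coeff (p + q) \<ge> 0"
    if "lead_coeff p \<ge> 0" "lead_coeff q \<ge> 0" for p q :: "real poly"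
  proof (cases "degree p" "degree q" rule: linorder_cases)
    case less
    then show ?thesis using that by (simp add: degree_add_eq_right coeff_eq_0)
  next
    case greater
    then show ?thesis using that by (simp add: degree_add_eq_left coeff_eq_0)
  next
    case equal
    show ?thesis
    proof (cases "p = 0 \<or> q = 0")
      case False
      then have "lead_coeff p > 0" "lead_coeff q > 0" using that by (auto simp: le_less)
      then have pos: "coeff (p + q) (degree p) > 0" using equal by simp
      then have "degree p \<le> degree (p + q)" by (intro le_degree) simp
      moreover have "degree (p + q) \<le> degree p" using degree_add_le[of p "degree p" q] equal by simp
      ultimately have "degree (p + q) = degree p" by simp
      then show ?thesis using pos equal by simp
    qed (use that in auto)
  qed
  have lc: "sos_cone p \<Longrightarrow> lead_coeff p \<ge> 0" for p
    by (induction p rule: sos_cone.induct) (use add in \<open>auto simp: lead_coeff_mult simp del: mult_pCons_left\<close>)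
  show "sos_cone p \<Longrightarrow> sos_cone q \<Longrightarrow> degree p \<le> degree (p + q) \<and> degree q \<le> degree (p + q)"
    using add lc by blast
qed

lemma sos_cone_const: "c \<ge> 0 \<Longrightarrow> sos_cone [:c:]"
  using square[of "[:sqrt c:]"] by simp

lemma poly_nonneg_left:
  assumes "y < z" "\<And>x. y < x \<Longrightarrow> x < z \<Longrightarrow> poly p x \<ge> (0::real)" shows "poly p z \<ge> 0"
proof (rule tendsto_lowerbound)
  show "(poly p \<longlongrightarrow> poly p z) (at_left z)"
    using DERIV_isCont[OF poly_DERIV[of p z]] by (simp add: isCont_def filterlim_at_split)
  show "\<forall>\<^sub>F x in at_left z. 0 \<le> poly p x"
    using assms by (auto simp: eventually_at_left_field)
qed simp

lemma poly_nonneg_right: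
  assumes "z < y" "\<And>x. z < x \<Longrightarrow> x < y \<Longrightarrow> poly p x \<ge> (0::real)" shows "poly p z \<ge> 0"
proof (rule tendsto_lowerbound)
  show "(poly p \<longlongrightarrow> poly p z) (at_right z)"
    using DERIV_isCont[OF poly_DERIV[of p z]] by (simp add: isCont_def filterlim_at_split)
  show "\<forall>\<^sub>F x in at_right z. 0 \<le> poly p x"
    using assms by (auto simp: eventually_at_right_field)
qed simp

text \<open>Factors are stripped off by induction on the degree. For a root z \<le> 0 the factor s -
  z lies in the cone; a root z > 0 must be at least double, since the cofactor changes sign there; a
  quadratic (s - a)^2 + b is a sum of squares.\<close>

lemma sos_cone_nonneg:
  fixes p :: "real poly"
  shows "(\<And>x. x \<ge> 0 \<Longrightarrow> poly p x \<ge> 0) \<Longrightarrow> sos_cone p"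
proof (induction "degree p" arbitrary: p rule: less_induct)
  case less
  show ?case
  proof (cases "degree p = 0")
    case True
    then obtain c where "p = [:c:]" by (metis degree_eq_zeroE)
    then show ?thesis using less.prems[of 0] by (simp add: sos_cone_const)
  next
    case False
    then have p0: "p \<noteq> 0" and "degree p > 0" by auto
    from real_poly_factor[OF this(2)] show ?thesis
    proof (elim disjE exE conjE)
      fix z q assume p: "p = [:-z, 1:] * q"
      then have dq: "degree q < degree p" using p0 by (subst p, subst degree_mult_eq) auto
      have pq: "poly p x = (x - z) * poly q x" for x by (simp add: p algebra_simps)
      show ?thesis
      proof (cases "z \<le> 0")
        case True
        have q: "poly q x \<ge> 0" if "x > 0" for x
          using less.prems[of x] that True unfolding pq by (simp add: zero_le_mult_iff)
        then have "poly q 0 \<ge> 0" by (intro poly_nonneg_right[of 0 1]) auto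
        then have "poly q x \<ge> 0" if "x \<ge> 0" for x using q that by (cases "x = 0") auto
        then have "sos_cone q" by (rule less.hyps[OF dq])
        moreover have "[:-z, 1:] = [:- z:] + [:0, 1:] * (1 * 1)" by simp
        then have "sos_cone [:-z, 1:]"
          using sos_cone.add[OF sos_cone_const[of "- z"] sos_cone.times_square[of 1]] True by simp
        ultimately show ?thesis unfolding p by (rule sos_cone_mult[rotated])
      next
        case False
        then have z: "z > 0" by simp
        have qr: "poly q x \<ge> 0" if "x > z" for x
          using less.prems[of x] that z unfolding pq by (simp add: zero_le_mult_iff)
        have ql: "poly (- q) x \<ge> 0" if "0 < x" "x < z" for x
          using less.prems[of x] that unfolding pq by (simp add: zero_le_mult_iff)
        have "poly q z \<ge> 0" using qr by (intro poly_nonneg_right[of z "z + 1"]) auto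
        moreover have "poly (- q) z \<ge> 0" by (rule poly_nonneg_left[OF z ql])
        ultimately have "poly q z = 0" by simp
        then obtain r where r: "q = [:-z, 1:] * r" by (metis dvdE poly_eq_0_iff_dvd)
        have pr: "poly p x = (x - z)\<^sup>2 * poly r x" for x
          by (simp add: pq r power2_eq_square algebra_simps)
        have "q \<noteq> 0" using p p0 by auto
        then have "degree r < degree p" using dq by (subst (asm) r, subst (asm) degree_mult_eq) (auto simp: r)
        moreover have rx: "poly r x \<ge> 0" if "x \<ge> 0" "x \<noteq> z" for x
          using less.prems[OF that(1)] that(2) unfolding pr by (simp add: zero_le_mult_iff)
        then have "poly r z \<ge> 0" using z by (intro poly_nonneg_right[of z "z + 1"]) auto
        then have "poly r x \<ge> 0" if "x \<ge> 0" for x using rx that by (cases "x = z") auto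
        ultimately have "sos_cone r" by (rule less.hyps)
        moreover have "p = ([:-z, 1:] * [:-z, 1:]) * r" by (simp only: p r mult.assoc)
        ultimately show ?thesis using sos_cone_mult[OF sos_cone.square] by metis
      qed
    next
      fix a b q assume b: "b > 0" and p: "p = [:a\<^sup>2 + b, - 2 * a, 1:] * q"
      then have dq: "degree q < degree p" using p0 by (subst p, subst degree_mult_eq) auto
      have quad: "poly [:a\<^sup>2 + b, - 2 * a, 1:] x = (x - a)\<^sup>2 + b" for x
        by (simp add: power2_eq_square algebra_simps)
      have "poly q x \<ge> 0" if "x \<ge> 0" for x
      proof -
        have "(x - a)\<^sup>2 + b > 0" using b by (simp add: add_nonneg_pos)
        then show ?thesis using less.prems[OF that] unfolding p poly_mult quad by (simp add: zero_le_mult_iff)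
      qed
      then have "sos_cone q" by (rule less.hyps[OF dq])
      moreover have "[:a\<^sup>2 + b, - 2 * a, 1:] = [:-a, 1:] * [:-a, 1:] + [:b:]"
        by (simp add: power2_eq_square)
      then have "sos_cone [:a\<^sup>2 + b, - 2 * a, 1:]"
        using sos_cone.add[OF sos_cone.square[of "[:-a, 1:]"] sos_cone_const[of b]] b by simp
      ultimately show ?thesis unfolding p by (rule sos_cone_mult[rotated])
    qed
  qed
qed

text \<open>The polynomial p lives in the shift variable s, and the nodes correspond to the poles s
  = -t. The reflection turns p(s)^2 into R(t)^2 and s p(s)^2 into -t R(t)^2, matching the two
  inequalities.\<close>

lemma sos_cone_node_diff:
  assumes f: "op_mono_dec f" and fpos: "\<And>t. t > 0 \<Longrightarrow> f t > 0"
    and T: "finite T" "T \<subseteq> {0<..}" "card T = 2 * m"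
  shows "sos_cone p \<Longrightarrow> degree p < 2 * m \<Longrightarrow> (\<Sum>t\<in>T. f t * (poly p (- t) / node_diff T t)) \<le> 0"
proof (induction p rule: sos_cone.induct)
  case (square p)
  define R where "R = pcompose p [:0, -1:]"
  have R: "poly R t = poly p (- t)" for t by (simp add: R_def poly_pcompose)
  have "degree R < m" using square by (cases "p = 0") (auto simp: R_def degree_pcompose degree_mult_eq)
  from op_mono_dec_square[OF f T this] show ?case by (simp add: R power2_eq_square)
next
  case (times_square p)
  define R where "R = pcompose p [:0, -1:]"
  have R: "poly R t = poly p (- t)" for t by (simp add: R_def poly_pcompose)
  have "m > 0" using times_square by auto
  then have "degree R < m" using times_square
    by (cases "p = 0") (auto simp: R_def degree_pcompose degree_mult_eq simp del: mult_pCons_left)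
  from op_mono_dec_times_square[OF f fpos T this] show ?case by (simp add: R power2_eq_square mult.assoc)
next
  case (add p q)
  then have "degree p < 2 * m" "degree q < 2 * m"
    using sos_cone_add_degree[OF add(1,2)] by auto
  then show ?case using add.IH by (simp add: add_divide_distrib distrib_left sum.distrib)
qed

lemma op_mono_dec_duality:
  assumes f: "op_mono_dec f" and fpos: "\<And>t. t > 0 \<Longrightarrow> f t > 0"
    and T: "finite T" "T \<subseteq> {0<..}" "card T = 2 * m"
    and c: "\<And>s. s \<ge> 0 \<Longrightarrow> (\<Sum>t\<in>T. c t / (t + s)) \<ge> 0"
  shows "(\<Sum>t\<in>T. c t * f t) \<ge> 0"
proof (cases "m = 0")
  case True
  then show ?thesis using T by simp
next
  case False
  \<comment> \<open>The numerator of the rational function in s over the common denominator. At s =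
    -t only the summand of the node t survives, which recovers \<open>c t\<close>.\<close>
  define P where "P = (\<Sum>t\<in>T. Polynomial.smult (c t) (\<Prod>u\<in>T - {t}. [:u, 1:]))"
  have deg: "degree (\<Prod>u\<in>T - {t}. [:u, 1:]) \<le> 2 * m - 1" if "t \<in> T" for t :: real
    using that T by (subst degree_prod_eq_sum_degree) auto
  have "degree P \<le> 2 * m - 1"
    unfolding P_def by (intro degree_sum_le T(1) order.trans[OF degree_smult_le] deg)
  then have dP: "degree P < 2 * m" using False by simp
  have "poly P s \<ge> 0" if s: "s \<ge> 0" for s
  proof -
    have pos: "u + s > 0" if "u \<in> T" for u using T(2) that s by (auto intro: add_pos_nonneg)
    have "poly P s = (\<Sum>t\<in>T. c t * (\<Prod>u\<in>T - {t}. u + s))" by (simp add: P_def poly_sum poly_prod)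
    also have "\<dots> = (\<Sum>t\<in>T. (\<Prod>u\<in>T. u + s) * (c t / (t + s)))"
    proof (intro sum.cong refl)
      fix t assume t: "t \<in> T"
      show "c t * (\<Prod>u\<in>T - {t}. u + s) = (\<Prod>u\<in>T. u + s) * (c t / (t + s))"
        unfolding prod.remove[OF T(1) t, of "\<lambda>u. u + s"] using pos[OF t] by simp
    qed
    also have "\<dots> = (\<Prod>u\<in>T. u + s) * (\<Sum>t\<in>T. c t / (t + s))" by (simp only: sum_distrib_left)
    also have "\<dots> \<ge> 0" using pos by (intro mult_nonneg_nonneg prod_nonneg c s) (auto intro: less_imp_le)
    finally show ?thesis .
  qed
  then have "sos_cone P" by (rule sos_cone_nonneg)
  from sos_cone_node_diff[OF f fpos T this dP]
  have "(\<Sum>t\<in>T. f t * (poly P (- t) / node_diff T t)) \<le> 0" .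
  also have "(\<Sum>t\<in>T. f t * (poly P (- t) / node_diff T t)) = (\<Sum>t\<in>T. - (c t * f t))"
  proof (intro sum.cong refl)
    fix t assume t: "t \<in> T"
    have "poly P (- t) = (\<Sum>v\<in>T. c v * (\<Prod>u\<in>T - {v}. u - t))" by (simp add: P_def poly_sum poly_prod)
    also have "\<dots> = (\<Sum>v\<in>T. if v = t then c t * (\<Prod>u\<in>T - {t}. u - t) else 0)"
      using T(1) t by (intro sum.cong refl) (auto intro!: prod_zero)
    also have "\<dots> = c t * (\<Prod>u\<in>T - {t}. u - t)" using T(1) t by simp
    \<comment> \<open>With 2m nodes an odd number of signs is reversed, which turns the upper bound
      of \<open>sos_cone_node_diff\<close> into the desired lower bound.\<close>
    also have "(\<Prod>u\<in>T - {t}. u - t) = (\<Prod>u\<in>T - {t}. (- 1) * (t - u))" by (intro prod.cong refl) simp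
    also have "\<dots> = (- 1) ^ (2 * m - 1) * node_diff T t"
      unfolding prod.distrib node_diff_def using T t by simp
    also have "(- 1 :: real) ^ (2 * m - 1) = - 1" using False by (cases m) auto
    finally have "poly P (- t) = - c t * node_diff T t" by simp
    moreover have "node_diff T t \<noteq> 0" using T(1) by (simp add: node_diff_def)
    ultimately show "f t * (poly P (- t) / node_diff T t) = - (c t * f t)" by simp
  qed
  finally show ?thesis by (simp add: sum_negf)
qed

section \<open>Approximation by Stieltjes sums\<close>

lemma stieltjes_sum_extend:
  "stieltjes_sum (Suc n) (c(n := r)) (s(n := q)) t = stieltjes_sum n c s t + r / (t + q)"
  by (simp add: stieltjes_sum_def)

lemma stieltjes_sum_scale: "stieltjes_sum n (\<lambda>i. r * c i) s t = r * stieltjes_sum n c s t"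
  by (simp add: stieltjes_sum_def sum_distrib_left)

text \<open>An approximate minimiser \<open>g\<close> of the squared distance from \<open>f\<close> to the cone of Stieltjes sums:
  perturbing \<open>g\<close> inside the cone shows that \<open>g - f + \<delta>\<close> satisfies the hypothesis of the duality
  lemma, which bounds the distance by a multiple of \<open>\<delta>\<close>.\<close>
lemma stieltjes_approx_finite:
  assumes f: "op_mono_dec f" and fpos: "\<And>t. t > 0 \<Longrightarrow> f t > 0"
    and T: "finite T" "T \<subseteq> {0<..}" "card T = 2 * m" and e: "e > 0"
  shows "\<exists>n c s. (\<forall>i<n. c i \<ge> 0 \<and> s i \<ge> 0) \<and> (\<Sum>t\<in>T. (f t - stieltjes_sum n c s t)\<^sup>2) \<le> e"
proof (cases "T = {}")
  case True
  then show ?thesis using e by (intro exI[of _ 0]) simp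
next
  case False
  define G where "G = {g. \<exists>n c s. (\<forall>i<n. c i \<ge> 0 \<and> s i \<ge> 0) \<and> g = stieltjes_sum n c s}"
  have G_add: "(\<lambda>t. g t + r / (t + q)) \<in> G" if g0: "g \<in> G" and rq: "r \<ge> 0" "q \<ge> 0" for g r q
  proof -
    obtain n c s where g: "\<forall>i<n. c i \<ge> 0 \<and> s i \<ge> 0" "g = stieltjes_sum n c s" using g0 by (auto simp: G_def)
    have "(\<lambda>t. g t + r / (t + q)) = stieltjes_sum (Suc n) (c(n := r)) (s(n := q))"
      by (simp add: fun_eq_iff stieltjes_sum_extend g(2))
    then show ?thesis unfolding G_def using g(1) rq
      by (intro CollectI exI[of _ "Suc n"] exI[of _ "c(n := r)"] exI[of _ "s(n := q)"]) (auto simp: less_Suc_eq)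
  qed
  have G_scale: "(\<lambda>t. r * g t) \<in> G" if g0: "g \<in> G" and rq: "r \<ge> 0" for g r
  proof -
    obtain n c s where g: "\<forall>i<n. c i \<ge> 0 \<and> s i \<ge> 0" "g = stieltjes_sum n c s" using g0 by (auto simp: G_def)
    have "(\<lambda>t. r * g t) = stieltjes_sum n (\<lambda>i. r * c i) s"
      by (simp add: fun_eq_iff stieltjes_sum_scale g(2))
    then show ?thesis unfolding G_def using g(1) rq
      by (intro CollectI exI[of _ n] exI[of _ "\<lambda>i. r * c i"] exI[of _ s]) auto
  qed
  have G0: "(\<lambda>t. 0) \<in> G" unfolding G_def by (intro CollectI exI[of _ 0]) (simp add: stieltjes_sum_def fun_eq_iff)
  define E where "E g = (\<Sum>t\<in>T. (f t - g t)\<^sup>2)" for g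
  define d where "d = Inf (E ` G)"
  have E0: "E g \<ge> 0" for g by (simp add: E_def sum_nonneg)
  have bdd: "bdd_below (E ` G)" using E0 by (intro bdd_belowI[of _ 0]) auto
  have d_le: "d \<le> E g" if "g \<in> G" for g unfolding d_def using that bdd by (intro cInf_lower) auto
  define F where "F = (\<Sum>t\<in>T. f t)"
  define N where "N = (\<Sum>t\<in>T. (f t)\<^sup>2)"
  \<comment> \<open>The squared distance splits as <h, f> - <h, g> with h = f - g. The first part is
    at most \<delta> F by duality, the second at most \<delta> (3 + 4 N) / 2 by shrinking g.\<close>
  define C where "C = F + (3 + 4 * N) / 2"
  have fT: "f t > 0" if "t \<in> T" for t using fpos T(2) that by auto
  have "F \<ge> 0" unfolding F_def using fT by (intro sum_nonneg) (simp add: less_imp_le)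
  moreover have "N \<ge> 0" unfolding N_def by (simp add: sum_nonneg)
  ultimately have C: "C > 0" unfolding C_def by (intro add_nonneg_pos) auto
  \<comment> \<open>The cap at 1 keeps (1 - \<delta>) g in the cone and bounds the excess \<delta>^2
    over the infimum.\<close>
  define \<delta> where "\<delta> = min 1 (e / C)"
  have \<delta>: "0 < \<delta>" "\<delta> \<le> 1" "\<delta> * C \<le> e"
    using e C by (auto simp: \<delta>_def min_def pos_le_divide_eq)
  have "\<exists>y\<in>E ` G. y < d + \<delta>\<^sup>2"
    using cInf_lessD[of "E ` G" "d + \<delta>\<^sup>2"] G0 \<delta>(1) by (auto simp: d_def)
  then obtain g where g: "g \<in> G" "E g < d + \<delta>\<^sup>2" by blast
  define h where "h t = f t - g t" for t
  have Eh: "E g = (\<Sum>t\<in>T. (h t)\<^sup>2)" by (simp add: E_def h_def)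
  have expand: "E (\<lambda>t. g t + r * k t) = E g - 2 * r * (\<Sum>t\<in>T. h t * k t) + r\<^sup>2 * (\<Sum>t\<in>T. (k t)\<^sup>2)" for r k
  proof -
    have "(f t - (g t + r * k t))\<^sup>2 = (h t)\<^sup>2 - 2 * r * (h t * k t) + r\<^sup>2 * (k t)\<^sup>2" for t
      by (simp add: h_def power2_eq_square algebra_simps)
    then show ?thesis unfolding E_def by (simp add: h_def sum.distrib sum_subtractf sum_distrib_left)
  qed
  have hk: "(\<Sum>t\<in>T. h t * (1 / (t + s))) \<le> \<delta> * (\<Sum>t\<in>T. 1 / (t + s))" if s: "s \<ge> 0" for s
  proof -
    define \<kappa> where "\<kappa> = (\<Sum>t\<in>T. 1 / (t + s))"
    have kpos: "1 / (t + s) > 0" if "t \<in> T" for t using T(2) that s by (auto intro!: add_pos_nonneg)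
    have \<kappa>: "\<kappa> > 0" unfolding \<kappa>_def using T(1) False kpos by (intro sum_pos)
    \<comment> \<open>This step size balances the two error terms: \<delta>^2 = r^2
      \<kappa>^2.\<close>
    define r where "r = \<delta> / \<kappa>"
    have r: "r > 0" using \<kappa> \<delta>(1) by (simp add: r_def)
    have "(\<lambda>t. g t + r * (1 / (t + s))) \<in> G" using G_add[OF g(1), of r s] r s by simp
    from d_le[OF this] have "2 * r * (\<Sum>t\<in>T. h t * (1 / (t + s))) \<le> \<delta>\<^sup>2 + r\<^sup>2 * (\<Sum>t\<in>T. (1 / (t + s))\<^sup>2)"
      using g(2) unfolding expand by linarith
    also have "(\<Sum>t\<in>T. (1 / (t + s))\<^sup>2) \<le> \<kappa>\<^sup>2"
    proof -
      have "(\<Sum>t\<in>T. (1 / (t + s))\<^sup>2) \<le> (\<Sum>t\<in>T. \<kappa> * (1 / (t + s)))"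
      proof (rule sum_mono)
        fix t assume t: "t \<in> T"
        have "1 / (t + s) \<le> \<kappa>" unfolding \<kappa>_def
          using t kpos T(1) by (intro member_le_sum[of t T "\<lambda>t. 1 / (t + s)"]) (auto intro: less_imp_le)
        then show "(1 / (t + s))\<^sup>2 \<le> \<kappa> * (1 / (t + s))"
          unfolding power2_eq_square using kpos[OF t] by (intro mult_right_mono) simp_all
      qed
      also have "\<dots> = \<kappa>\<^sup>2" unfolding sum_distrib_left[symmetric] \<kappa>_def by (simp add: power2_eq_square)
      finally show ?thesis .
    qed
    finally have "2 * r * (\<Sum>t\<in>T. h t * (1 / (t + s))) \<le> \<delta>\<^sup>2 + r\<^sup>2 * \<kappa>\<^sup>2" by (simp add: mult_left_mono)
    also have "\<dots> = 2 * r * (\<delta> * \<kappa>)" using \<kappa> by (simp add: r_def power2_eq_square)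
    finally show ?thesis using r by (simp add: \<kappa>_def)
  qed
  have "(\<Sum>t\<in>T. (\<delta> - h t) * f t) \<ge> 0"
  proof (rule op_mono_dec_duality[OF f fpos T])
    fix s :: real assume "s \<ge> 0"
    from hk[OF this] show "0 \<le> (\<Sum>t\<in>T. (\<delta> - h t) / (t + s))"
      by (simp add: diff_divide_distrib sum_subtractf sum_distrib_left)
  qed
  then have hf: "(\<Sum>t\<in>T. h t * f t) \<le> \<delta> * F"
    by (simp add: F_def left_diff_distrib sum_subtractf sum_distrib_left)
  \<comment> \<open>Near-optimality of g against its own rescaling controls the inner product of h
    with g.\<close>
  have "(\<lambda>t. g t + (- \<delta>) * g t) \<in> G"
    using G_scale[OF g(1), of "1 - \<delta>"] \<delta>(2) by (simp add: algebra_simps)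
  from d_le[OF this] have "- (2 * \<delta> * (\<Sum>t\<in>T. h t * g t)) \<le> \<delta>\<^sup>2 * (1 + (\<Sum>t\<in>T. (g t)\<^sup>2))"
    using g(2) unfolding expand by (simp add: algebra_simps)
  also have "(\<Sum>t\<in>T. (g t)\<^sup>2) \<le> 4 * N + 2"
  proof -
    have "(g t)\<^sup>2 \<le> 2 * (f t)\<^sup>2 + 2 * (h t)\<^sup>2" for t
    proof -
      have "2 * (f t)\<^sup>2 + 2 * (h t)\<^sup>2 - (g t)\<^sup>2 = (2 * f t - g t)\<^sup>2"
        by (simp add: h_def power2_eq_square algebra_simps)
      also have "\<dots> \<ge> 0" by simp
      finally show ?thesis by simp
    qed
    then have "(\<Sum>t\<in>T. (g t)\<^sup>2) \<le> (\<Sum>t\<in>T. 2 * (f t)\<^sup>2 + 2 * (h t)\<^sup>2)" by (rule sum_mono)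
    also have "\<dots> = 2 * N + 2 * E g" by (simp add: N_def Eh sum.distrib sum_distrib_left)
    also have "E g \<le> N + 1"
    proof -
      have "\<delta>\<^sup>2 \<le> 1" using \<delta> by (simp add: power_le_one)
      moreover have "d \<le> N" using d_le[OF G0] by (simp add: E_def N_def)
      ultimately show ?thesis using g(2) by linarith
    qed
    finally show ?thesis by simp
  qed
  finally have "- (2 * \<delta> * (\<Sum>t\<in>T. h t * g t)) \<le> \<delta>\<^sup>2 * (1 + (4 * N + 2))" by (simp add: mult_left_mono)
  then have "2 * \<delta> * - (\<Sum>t\<in>T. h t * g t) \<le> 2 * \<delta> * (\<delta> * ((3 + 4 * N) / 2))"
    by (simp add: power2_eq_square algebra_simps)
  then have hg: "- (\<Sum>t\<in>T. h t * g t) \<le> \<delta> * ((3 + 4 * N) / 2)"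
    by (rule mult_left_le_imp_le) (use \<delta>(1) in simp)
  have "E g = (\<Sum>t\<in>T. h t * f t) - (\<Sum>t\<in>T. h t * g t)"
    by (simp add: Eh h_def power2_eq_square right_diff_distrib flip: sum_subtractf)
  also have "\<dots> \<le> \<delta> * C" unfolding C_def distrib_left using hf hg by linarith
  finally have "E g \<le> e" using \<delta>(3) by simp
  then show ?thesis using g(1) by (auto simp: G_def E_def)
qed

lemma stieltjes_sum_antimono:
  assumes "\<forall>i<n. c i \<ge> 0 \<and> s i \<ge> 0" "0 < t" "t \<le> u"
  shows "stieltjes_sum n c s u \<le> stieltjes_sum n c s t"
  unfolding stieltjes_sum_def
  by (intro sum_mono divide_left_mono mult_pos_pos) (use assms in \<open>auto intro: add_pos_nonneg\<close>)

text \<open>Between neighbouring nodes a Stieltjes sum lies between its node values because it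
  decreases, and f varies by less than e/2 by uniform continuity; closeness at the nodes contributes
  the other e/2.\<close>

lemma op_mono_dec_approximable:
  assumes f: "op_mono_dec f" and fpos: "\<And>t. t > 0 \<Longrightarrow> f t > 0"
  shows "stieltjes_approximable f"
  unfolding stieltjes_approximable_def
proof (intro conjI allI impI)
  show cont: "continuous_on {0<..} f" using f by (simp add: op_mono_dec_def)
  fix a b e :: real assume ab: "0 < a" "a < b" and e: "0 < e"
  have "uniformly_continuous_on {a..b} f"
    by (intro compact_uniformly_continuous continuous_on_subset[OF cont]) (use ab in auto)
  then obtain \<delta> where \<delta>: "\<delta> > 0"
    "\<And>t u. t \<in> {a..b} \<Longrightarrow> u \<in> {a..b} \<Longrightarrow> \<bar>u - t\<bar> < \<delta> \<Longrightarrow> \<bar>f u - f t\<bar> < e / 2"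
    using e unfolding uniformly_continuous_on_def dist_real_def by (metis half_gt_zero)
  obtain m where m: "(b - a) / \<delta> < real m" using reals_Archimedean2 by blast
  have "m > 0" using m ab(2) \<delta>(1) by (cases m) (auto simp: divide_less_0_iff)
  \<comment> \<open>The n subintervals have n + 1 = 2m endpoints: the duality works with an even
    number of nodes.\<close>
  define n where "n = 2 * m - 1"
  have n: "n > 0" "m \<le> n" "Suc n = 2 * m" using \<open>m > 0\<close> by (auto simp: n_def)
  define p where "p i = a + (b - a) * (real i / real n)" for i
  have step: "p (Suc i) - p i = (b - a) / real n" for i
    using n(1) by (simp add: p_def field_simps)
  have "(b - a) / real n \<le> (b - a) / real m" using n(1,2) ab(2) \<open>m > 0\<close> by (intro divide_left_mono) auto
  also have "\<dots> < \<delta>" using m \<delta>(1) \<open>m > 0\<close> by (simp add: field_simps)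
  finally have small: "(b - a) / real n < \<delta>" .
  have p_range: "p i \<in> {a..b}" if "i \<le> n" for i
  proof -
    have "(b - a) * (real i / real n) \<le> (b - a) * 1" using that n(1) ab(2) by (intro mult_left_mono) auto
    then show ?thesis using ab(2) by (simp add: p_def)
  qed
  define T where "T = p ` {..n}"
  have "inj_on p {..n}" using n(1) ab(2) by (intro inj_onI) (simp add: p_def)
  then have "card T = 2 * m" using n(3) by (simp add: T_def card_image)
  moreover have "T \<subseteq> {0<..}" using p_range ab(1) by (force simp: T_def)
  ultimately obtain k c s where g: "\<forall>i<k. c i \<ge> 0 \<and> s i \<ge> 0"
    "(\<Sum>t\<in>T. (f t - stieltjes_sum k c s t)\<^sup>2) \<le> (e / 2)\<^sup>2"
    using stieltjes_approx_finite[OF f fpos, of T m "(e / 2)\<^sup>2"] e by (auto simp: T_def)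
  let ?g = "stieltjes_sum k c s"
  have node: "\<bar>f (p i) - ?g (p i)\<bar> \<le> e / 2" if "i \<le> n" for i
  proof -
    have "(f (p i) - ?g (p i))\<^sup>2 \<le> (\<Sum>t\<in>T. (f t - ?g t)\<^sup>2)"
      by (rule member_le_sum[where f = "\<lambda>t. (f t - ?g t)\<^sup>2"]) (use that in \<open>auto simp: T_def\<close>)
    then have "(f (p i) - ?g (p i))\<^sup>2 \<le> (e / 2)\<^sup>2" by (rule order.trans[OF _ g(2)])
    then have "\<bar>f (p i) - ?g (p i)\<bar> \<le> \<bar>e / 2\<bar>" unfolding abs_le_square_iff .
    then show ?thesis using e by linarith
  qed
  have "\<bar>?g t - f t\<bar> \<le> e" if t: "t \<in> {a..b}" for t
  proof -
    define x where "x = (t - a) * real n / (b - a)"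
    define i where "i = nat \<lfloor>x\<rfloor>"
    have "x \<ge> 0" using t ab(2) by (simp add: x_def)
    then have "real i = of_int \<lfloor>x\<rfloor>" by (simp add: i_def)
    then have ix: "real i \<le> x" "x < real (Suc i)" by linarith+
    then have "(b - a) * (real i / real n) \<le> (b - a) * (x / real n)"
      "(b - a) * (x / real n) < (b - a) * (real (Suc i) / real n)"
      using n(1) ab(2) by (auto intro!: divide_right_mono divide_strict_right_mono simp del: of_nat_Suc)
    moreover have "(b - a) * (x / real n) = t - a" using n(1) ab(2) by (simp add: x_def)
    ultimately have pi: "p i \<le> t" "t < p (Suc i)" unfolding p_def by linarith+
    have "x \<le> real n"
      unfolding x_def using t ab(2) by (simp add: pos_divide_le_eq mult.commute mult_left_mono)
    then have "i \<le> n" using ix(1) by linarith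
    show ?thesis
    proof (cases "i = n")
      case True
      have "p n = b" using n(1) by (simp add: p_def)
      then have "t = p n" using t pi(1) True by auto
      then show ?thesis using node[of n] e by (simp add: abs_minus_commute)
    next
      case False
      then have i: "Suc i \<le> n" using \<open>i \<le> n\<close> by simp
      have "\<bar>p i - t\<bar> < \<delta>" "\<bar>p (Suc i) - t\<bar> < \<delta>" using pi step[of i] small by auto
      then have "\<bar>f (p i) - f t\<bar> < e / 2" "\<bar>f (p (Suc i)) - f t\<bar> < e / 2"
        using \<delta>(2) t p_range \<open>i \<le> n\<close> i by blast+
      moreover have "?g t \<le> ?g (p i)" "?g (p (Suc i)) \<le> ?g t"
        using pi p_range[OF \<open>i \<le> n\<close>] t ab(1) by (auto intro!: stieltjes_sum_antimono[OF g(1)])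
      ultimately show ?thesis using node[OF \<open>i \<le> n\<close>] node[OF i] by linarith
    qed
  qed
  then show "\<exists>n c s. (\<forall>i<n. c i \<ge> 0 \<and> s i \<ge> 0) \<and> (\<forall>t\<in>{a..b}. \<bar>stieltjes_sum n c s t - f t\<bar> \<le> e)"
    using g(1) by blast
qed

section \<open>Joint convexity\<close>

theorem theorem4p2:
  fixes f1 f2 :: "real \<Rightarrow> real"
    and \<Phi> :: "'a::cstar_algebra \<Rightarrow> 'c::cstar_algebra"
    and \<Psi> :: "'b::cstar_algebra \<Rightarrow> 'c"
    and \<tau> :: "'c \<Rightarrow> complex"
  assumes "\<forall>t>0. f1 t > 0" and "\<forall>t>0. f2 t > 0"
    and "op_mono_dec f1" and "op_mono_dec f2"
    and "positive_functional \<tau>" and "tracial \<tau>"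
    and "positive_map \<Phi>" and "positive_map \<Psi>"
  shows "convex_on (pos_inv \<times> pos_inv)
     (\<lambda>(X, Y). Re (\<tau> (cfc sqrt (\<Phi> (cfc f1 X)) * \<Psi> (cfc f2 Y) * cfc sqrt (\<Phi> (cfc f1 X)))))"
proof -
  have f1: "stieltjes_approximable f1" and f2: "stieltjes_approximable f2"
    using assms(1-4) by (auto intro: op_mono_dec_approximable)
  note \<tau> = assms(5,6) and \<Phi> = assms(7) and \<Psi> = assms(8)
  define B where "B p q = Re (\<tau> (\<Phi> p * \<Psi> q))" for p q
  have pm: "\<Xi> (x + y) = \<Xi> x + \<Xi> y" "\<Xi> (r *\<^sub>R x) = r *\<^sub>R \<Xi> x" "cpositive x \<Longrightarrow> cpositive (\<Xi> x)"
    if "positive_map \<Xi>" for \<Xi> :: "'x::cstar_algebra \<Rightarrow> 'y::cstar_algebra" and x y r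
    using that by (auto simp: positive_map_def simp flip: cscale_of_real)
  have t: "\<tau> (x + y) = \<tau> x + \<tau> y" "\<tau> (r *\<^sub>R x) = of_real r * \<tau> x" for x y r
    using \<tau>(1) by (auto simp: positive_functional_def simp flip: cscale_of_real)
  have B: "positive_form B"
    unfolding positive_form_def B_def
    by (simp add: pm[OF \<Phi>] pm[OF \<Psi>] distrib_left distrib_right t tracial_product_nonneg[OF \<tau>])
  \<comment> \<open>Traciality brings the two square roots together, and they multiply to
    \<Phi>(f1(X)), which is positive because f1 is positive on the spectrum of X.\<close>
  have eq: "Re (\<tau> (cfc sqrt (\<Phi> (cfc f1 X)) * \<Psi> (cfc f2 Y) * cfc sqrt (\<Phi> (cfc f1 X)))) = B (cfc f1 X) (cfc f2 Y)"
    if X: "X \<in> pos_inv" for X Y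
  proof -
    have "cpositive (cfc f1 X)"
      using f1 assms(1) X pos_inv_spec_pos[OF X]
      by (intro cpositive_cfc pos_inv_cfc_dom) (auto simp: stieltjes_approximable_def intro: less_imp_le)
    then have "cfc sqrt (\<Phi> (cfc f1 X)) * cfc sqrt (\<Phi> (cfc f1 X)) = \<Phi> (cfc f1 X)"
      by (intro cfc_sqrt pm[OF \<Phi>])
    then have "\<tau> (cfc sqrt (\<Phi> (cfc f1 X)) * \<Psi> (cfc f2 Y) * cfc sqrt (\<Phi> (cfc f1 X))) = \<tau> (\<Phi> (cfc f1 X) * \<Psi> (cfc f2 Y))"
      using \<tau>(2) unfolding tracial_def by (metis mult.assoc)
    then show ?thesis by (simp add: B_def)
  qed
  show ?thesis
    unfolding convex_on_def
  proof (intro conjI ballI allI impI convex_Times convex_pos_inv)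
    fix x y :: "'a \<times> 'b" and u v :: real
    assume "x \<in> pos_inv \<times> pos_inv" "y \<in> pos_inv \<times> pos_inv" and uv: "0 \<le> u" "0 \<le> v" "u + v = 1"
    then obtain x0 y0 x1 y1 where xy: "x = (x0, y0)" "y = (x1, y1)"
      "x0 \<in> pos_inv" "x1 \<in> pos_inv" "y0 \<in> pos_inv" "y1 \<in> pos_inv" by auto
    have "u *\<^sub>R x0 + v *\<^sub>R x1 \<in> pos_inv" by (intro pos_inv_convex_comb xy uv)
    then show "(case u *\<^sub>R x + v *\<^sub>R y of (X, Y) \<Rightarrow> Re (\<tau> (cfc sqrt (\<Phi> (cfc f1 X)) * \<Psi> (cfc f2 Y) * cfc sqrt (\<Phi> (cfc f1 X))))) \<le>
      u * (case x of (X, Y) \<Rightarrow> Re (\<tau> (cfc sqrt (\<Phi> (cfc f1 X)) * \<Psi> (cfc f2 Y) * cfc sqrt (\<Phi> (cfc f1 X))))) +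
      v * (case y of (X, Y) \<Rightarrow> Re (\<tau> (cfc sqrt (\<Phi> (cfc f1 X)) * \<Psi> (cfc f2 Y) * cfc sqrt (\<Phi> (cfc f1 X)))))"
      using positive_form_approximable_convex[OF B f1 f2 xy(3-6) uv] xy(1-4) by (simp add: eq)
  qed
qed

end
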